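(* Let $q\in(1,+\infty)$, $p=q^{-1}$, and let $\lambda\in\mathbb{C}^*\smallsetminus(-q^{\mathbb{Z}})$. For any $x\in\tilde\Omega_\lambda:=\pi^{-1}\left(\mathbb{C}^*\smallsetminus[-\lambda(1-p);q]\right)$ we have $$\mathcal{E}_q(x)-\mathcal{E}_q^{[\lambda]}(x)=-2\pi i\,\frac{q-1}{\ln q}\left(L_{(-\lambda(1-p))^*,\,q^*}(x^* )-C_{\lambda,q}\right)e_q(-q/x)^{-1},$$ where the following notations are employed: $$x^*=e^{-2\pi i\frac{\log x}{\ln q}},\qquad q^*=e^{4\pi^2/\ln q},$$ $$L_{a,q}(x)=-\frac xa\,\frac{\theta_p'\left(-\frac xa\right)}{\theta_p\left(-\frac xa\right)},\qquad C_{\lambda,q}=L_{(-\lambda(1-p))^*,\,q^*}\left((1-p)^*\right).$$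
   Context: For $a\in\mathbb{C}^*$, $[a;q]=aq^{\mathbb{Z}}$. $[n]_q=\frac{q^n-1}{q-1}$, $[n]_q^!=[n]_q[n-1]_q\cdots[1]_q$, $[0]_q^!=1$; $e_q(x)=\sum_{n\ge0}\frac{x^n}{[n]_q^!}=\prod_{k\ge0}(1+(1-p)p^kx)$; $\theta_p(x)=\sum_{n\in\mathbb{Z}}p^{n(n-1)/2}x^n$. In $L_{a,q}$ one has $p=1/q$; accordingly $L_{a,q^*}$ is the same expression with $\theta_{p^*}$, $p^*=1/q^*$, in place of $\theta_p$. The notation $y^*=e^{-2\pi i\log y/\ln q}$ is used for every $y$, and $(1-p)^*=e^{-2\pi i\ln(1-p)/\ln q}$. The Jackson integral is $\int_{\lambda p^{\mathbb{Z}}}f(\xi)\,d_p\xi=(1-p)\lambda\sum_{n\in\mathbb{Z}}f(p^n\lambda)p^n$. $\pi:\tilde{\mathbb{C}}^*\to\mathbb{C}^*$ is the projection from the Riemann surface of the logarithm; meromorphic functions on $\mathbb{C}^*$ are identified with their pull back by $\pi$ on $\tilde{\mathbb{C}}^*$. Let $\psi(\xi)=\frac1{1+\xi}$. For $d\in(-\pi,\pi)$ and $\arg x\in(d-\pi,d+\pi)$ put $$\mathcal{E}_q^d(x)=\frac{q-1}{\ln q}\int_0^{e^{id}\infty}\frac{\psi(\xi)}{e_q(q\frac\xi x)}\,d\xi .$$ $\mathcal{E}_q$ denotes the analytic continuation of the functions $\mathcal{E}_q^d$ to the sector $\{|\arg x|<2\pi\}$ of $\tilde{\mathbb{C}}^*$,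 which is meromorphic on the whole of $\tilde{\mathbb{C}}^*$. For $\lambda\notin-p^{\mathbb{Z}}$, $$\mathcal{E}_q^{[\lambda]}(x)=\frac q{1-p}\int_{\lambda p^{\mathbb{Z}}}\frac{\psi\left(\frac\xi{1-p}\right)}{e_q\left(q\frac\xi{(1-p)x}\right)}\,d_p\xi,\qquad x\notin(p-1)\lambda q^{\mathbb{Z}}.$$
   Formalization: The right-hand side carries +2πi instead of the printed −2πi (the printed sign contradicts the jump under x→xe^{2πi}), and the Jackson integral defining E_q^{[λ]} runs over (1−p)λp^Z instead of λp^Z, matching the stated excluded sets for λ and x. *)

theory Defs
  imports "HOL-Complex_Analysis.Complex_Analysis"
begin

definition q_int :: "real \<Rightarrow> nat \<Rightarrow> real" where
  "q_int q n = (q ^ n - 1) / (q - 1)"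

definition q_fact :: "real \<Rightarrow> nat \<Rightarrow> real" where
  "q_fact q n = (\<Prod>k=1..n. q_int q k)"

definition q_exp :: "real \<Rightarrow> complex \<Rightarrow> complex" where
  "q_exp q x = (\<Sum>n. x ^ n / of_real (q_fact q n))"

definition theta :: "real \<Rightarrow> complex \<Rightarrow> complex" where
  "theta p x = (\<Sum>\<^sub>\<infinity>n::int. of_real (p powi (n * (n - 1) div 2)) * x powi n)"

definition L_fun :: "complex \<Rightarrow> real \<Rightarrow> complex \<Rightarrow> complex" where
  "L_fun a q x = - (x / a) * (deriv (theta (1 / q)) (- (x / a)) / theta (1 / q) (- (x / a)))"

definition q_spiral :: "complex \<Rightarrow> real \<Rightarrow> complex set" where
  "q_spiral a q = range (\<lambda>n::int. a * of_real q powi n)"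

definition jackson :: "real \<Rightarrow> complex \<Rightarrow> (complex \<Rightarrow> complex) \<Rightarrow> complex" where
  "jackson p lam f =
     of_real (1 - p) * lam * (\<Sum>\<^sub>\<infinity>n::int. f (of_real p powi n * lam) * of_real p powi n)"

text \<open>
  A point of the Riemann surface of the logarithm is represented by its logarithm
  \<open>t :: complex\<close>: its argument is \<open>Im t\<close> and the projection to the punctured plane is
  \<open>exp\<close>.  So meromorphic functions on the Riemann surface are meromorphic functions
  of \<open>t\<close> on \<open>UNIV\<close>.  The map \<open>x \<mapsto> x*\<close> is defined on the Riemann surface:
\<close>

definition q_star :: "real \<Rightarrow> complex \<Rightarrow> complex" where
  "q_star q t = exp (- 2 * of_real pi * \<i> * t / of_real (ln q))"

definition q_dual :: "real \<Rightarrow> real" where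
  "q_dual q = exp (4 * pi\<^sup>2 / ln q)"

definition psi :: "complex \<Rightarrow> complex" where
  "psi \<xi> = 1 / (1 + \<xi>)"

definition E_ray :: "real \<Rightarrow> real \<Rightarrow> complex \<Rightarrow> complex" where
  "E_ray q d x = of_real ((q - 1) / ln q) *
     (LINT r:{0<..}|lborel.
        psi (of_real r * cis d) / q_exp q (of_real q * (of_real r * cis d) / x) * cis d)"

text \<open>
  The meromorphic continuation of the functions \<open>E_ray q d\<close>.  Being nicely meromorphic
  (value \<open>0\<close> at the poles, no removable singularities) makes it unique as a HOL function.
\<close>

definition E_cont :: "real \<Rightarrow> complex \<Rightarrow> complex" where
  "E_cont q = (THE E. E nicely_meromorphic_on UNIV \<and>
     (\<forall>d\<in>{-pi<..<pi}. \<forall>t. Im t \<in> {d - pi<..<d + pi} \<longrightarrow> E t = E_ray q d (exp t)))"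

text \<open>
  The Jackson integral is taken over the spiral of \<open>(1 - p) * lam\<close>.  With this spiral the
  integrand has its poles exactly for \<open>lam\<close> in \<open>q_spiral (-1) q\<close> or \<open>x\<close> in
  \<open>q_spiral (- (1 - p) * lam) q\<close>.  The source prints the spiral of \<open>lam\<close> instead, which
  is incompatible with these excluded sets.
\<close>

definition E_jackson :: "real \<Rightarrow> complex \<Rightarrow> complex \<Rightarrow> complex" where
  "E_jackson q lam x = (let p = 1 / q in
     of_real (q / (1 - p)) * jackson p (of_real (1 - p) * lam)
       (\<lambda>\<xi>. psi (\<xi> / of_real (1 - p)) / q_exp q (of_real q * (\<xi> / (of_real (1 - p) * x)))))"

end

theory Submission
  imports Defs "HOL-Probability.Sinc_Integral"
begin

text \<open>
  Fix \<open>x = exp t\<close> and let the base point \<open>\<lambda> = exp u\<close> of the spiral vary.  In \<open>u\<close> the Jackson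
  integral has the periods \<open>ln q\<close> and \<open>2\<pi>\<i>\<close> and, modulo these, at most two simple poles: one from
  \<open>psi\<close>, with a known residue, and one from the zeros of \<open>q_exp q\<close>.  Two translates of the
  logarithmic derivative of the dual theta function have the same poles and are
  \<open>ln q\<close>-periodic, with additive quasi-period \<open>1\<close> in the direction \<open>2\<pi>\<i>\<close>.  So a combination of
  the three is entire, and Liouville's theorem makes it constant in \<open>u\<close>.  The constant is the mean over a
  horizontal period at height \<open>d\<close>: there the theta parts cancel and the Jackson integrals
  average to the integral along the ray.  This gives the identity for generic \<open>t\<close> in the strip of the
  ray \<open>d\<close>, and its right-hand side continues meromorphically to all \<open>t\<close>.
\<close>

section \<open>The q-exponential function\<close>

text \<open>The base point is varied, rather than \<open>x\<close>, because the ray integral does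
  not depend on \<open>u\<close> at all: only elliptic and quasi-periodic functions of
  \<open>u\<close> remain, while in \<open>log x\<close> there is no such periodicity. At the pole
  of psi a single term of the Jackson series is singular; its residue gives the right-hand side the
  factor \<open>1 / q_exp q (- q / x)\<close>. At the other class of poles infinitely many terms
  blow up together. That residue is left unknown, because the additive quasi-period of the entire
  combination must vanish, which ties the two theta coefficients together. The constant
  \<open>C\<close> is the theta translate that belongs to the pole of psi. The conditions
  \<open>|d| < pi\<close> and \<open>|arg x - d| < pi\<close> say that the line at height
  \<open>d\<close> passes, relative to both classes of poles, between adjacent rows of the lattice
  spanned by \<open>ln q\<close> and \<open>2 pi i\<close>; hence both translates have the same
  mean. The residues of the theta part require simple zeros. These come from comparing the theta
  series with a product of two q-exponentials, whose zeros are known from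
  \<open>e_q(q x) = (1 + (q - 1) x) e_q(x)\<close>.\<close>

lemma q_int_ge: "q > 1 \<Longrightarrow> q_int q n \<ge> n"
proof -
  assume q: "q > 1"
  have "1 + real n * (q - 1) \<le> (1 + (q - 1)) ^ n"
    by (rule Bernoulli_inequality) (use q in auto)
  then show ?thesis using q by (simp add: q_int_def field_simps)
qed

text \<open>Makes the exponential series a majorant of the series of \<open>q_exp\<close>.\<close>

lemma q_fact_ge: "q > 1 \<Longrightarrow> q_fact q n \<ge> fact n"
  unfolding q_fact_def fact_prod of_nat_prod
  by (intro prod_mono) (auto intro: q_int_ge)

lemma q_fact_Suc: "q_fact q (Suc n) = q_fact q n * q_int q (Suc n)"
  by (simp add: q_fact_def)

lemma q_exp_sums:
  assumes "q > 1"
  shows "(\<lambda>n. x ^ n / of_real (q_fact q n)) sums q_exp q x"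
proof -
  have "summable (\<lambda>n. x ^ n / of_real (q_fact q n))"
  proof (rule summable_comparison_test')
    show "summable (\<lambda>n. norm x ^ n / fact n)"
      using summable_exp[of "norm x"] by (simp add: field_simps)
    show "norm (x ^ n / of_real (q_fact q n)) \<le> norm x ^ n / fact n" for n
    proof -
      have "q_fact q n > 0"
        using q_fact_ge[OF assms, of n] by (smt (verit) fact_gt_zero)
      then show ?thesis
        using q_fact_ge[OF assms, of n] by (simp add: norm_divide norm_power frac_le)
    qed
  qed
  then show ?thesis unfolding q_exp_def by (simp add: summable_sums)
qed

lemma q_exp_0 [simp]: "q_exp q 0 = 1"
  unfolding q_exp_def by (subst suminf_finite[of "{0}"]) (auto simp: q_fact_def)

text \<open>Coefficientwise this is \<open>(q - 1) [n]_q = q^n - 1\<close>. It stands in for the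
  infinite product of \<open>q_exp\<close>: the zeros, their simplicity and the growth along spirals
  are all read off from it.\<close>

lemma q_exp_mult_q:
  assumes q: "q > 1"
  shows "q_exp q (of_real q * x) = (1 + of_real (q - 1) * x) * q_exp q x"
proof -
  let ?a = "\<lambda>x n. x ^ n / of_real (q_fact q n) :: complex"
  have s: "(\<lambda>n. ?a (of_real q * x) n) sums q_exp q (of_real q * x)"
    by (rule q_exp_sums[OF q])
  have 1: "(\<lambda>n. ?a x n) sums q_exp q x" by (rule q_exp_sums[OF q])
  have "(\<lambda>n. of_real (q - 1) * x * ?a x n) sums (of_real (q - 1) * x * q_exp q x)"
    by (intro sums_mult 1)
  \<comment> \<open>The second series is moved up by one index, with term 0 at \<open>n = 0\<close>,
    so that both series can be added term by term.\<close>
  then have 2: "(\<lambda>n. if n = 0 then 0 else of_real (q - 1) * x * ?a x (n - 1)) sums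
      (of_real (q - 1) * x * q_exp q x)"
    by (subst sums_Suc_iff[symmetric, where f="\<lambda>n. if n = 0 then 0 else of_real (q - 1) * x * ?a x (n - 1)", simplified]) simp
  have "(\<lambda>n. ?a x n + (if n = 0 then 0 else of_real (q - 1) * x * ?a x (n - 1))) sums
      (q_exp q x + of_real (q - 1) * x * q_exp q x)"
    by (rule sums_add[OF 1 2])
  also have "(\<lambda>n. ?a x n + (if n = 0 then 0 else of_real (q - 1) * x * ?a x (n - 1))) =
      (\<lambda>n. ?a (of_real q * x) n)"
  proof
    fix n show "?a x n + (if n = 0 then 0 else of_real (q - 1) * x * ?a x (n - 1)) = ?a (of_real q * x) n"
    proof (cases n)
      case (Suc m)
      have pos: "q_fact q m > 0" "q_int q n > 0"
        using q_fact_ge[OF q, of m] q_int_ge[OF q, of n] Suc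
        by (smt (verit) fact_gt_zero, simp add: q_int_ge order.strict_trans2[OF _ q_int_ge[OF q]])
      have e: "q_fact q n = q_fact q m * q_int q n" by (simp add: Suc q_fact_Suc)
      have k: "(complex_of_real q - 1) * of_real (q_int q n) = of_real q ^ n - 1"
      proof -
        have "(q - 1) * q_int q n = q ^ n - 1" using q by (simp add: q_int_def)
        then have "complex_of_real ((q - 1) * q_int q n) = of_real (q ^ n - 1)" by simp
        then show ?thesis by simp
      qed
      have "?a x n + of_real (q - 1) * x * ?a x m =
         x ^ n * (1 + (of_real q - 1) * of_real (q_int q n)) / of_real (q_fact q n)"
        using pos unfolding e by (simp add: Suc field_simps)
      also have "\<dots> = ?a (of_real q * x) n" unfolding k by (simp add: power_mult_distrib)
      finally show ?thesis by (simp add: Suc)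
    qed simp
  qed
  finally have "(\<lambda>n. ?a (of_real q * x) n) sums (q_exp q x + of_real (q - 1) * x * q_exp q x)" .
  from sums_unique2[OF s this] show ?thesis by (simp add: algebra_simps)
qed

lemma q_exp_holomorphic:
  assumes q: "q > 1"
  shows "q_exp q holomorphic_on A"
proof -
  have "q_exp q holomorphic_on ball 0 (r::real)" for r
    by (rule power_series_holomorphic[where a="\<lambda>n. 1 / of_real (q_fact q n)"])
      (use q_exp_sums[OF q] in auto)
  then have "q_exp q holomorphic_on (\<Union>r. ball 0 (r::real))"
    by (subst holomorphic_on_UN_open) auto
  also have "(\<Union>r. ball 0 (r::real)) = (UNIV :: complex set)"
    by (auto intro: gt_ex)
  finally show ?thesis by (rule holomorphic_on_subset) auto
qed

lemma q_exp_near_0: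
  assumes q: "q > 1"
  obtains \<delta> where "\<delta> > 0" "\<And>y. norm y < \<delta> \<Longrightarrow> norm (q_exp q y) \<ge> 1 / 2"
proof -
  have "isCont (q_exp q) 0"
    using holomorphic_on_imp_continuous_on[OF q_exp_holomorphic[OF q, of UNIV]]
    by (simp add: continuous_on_eq_continuous_at)
  then obtain \<delta> where d: "\<delta> > 0" "\<And>y. dist y 0 < \<delta> \<Longrightarrow> dist (q_exp q y) (q_exp q 0) < 1 / 2"
    unfolding continuous_at_eps_delta by (metis zero_less_divide_1_iff zero_less_numeral)
  show ?thesis
  proof (rule that[OF d(1)])
    fix y :: complex assume "norm y < \<delta>"
    then have "norm (1 - q_exp q y) < 1 / 2" using d(2)[of y] by (simp add: dist_norm norm_minus_commute)
    then show "norm (q_exp q y) \<ge> 1 / 2"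
      using norm_triangle_ineq2[of 1 "1 - q_exp q y"] by simp
  qed
qed

text \<open>Dividing by \<open>q\<close> often enough brings every point into the disc around 0, so
  a functional equation relating \<open>y\<close> and \<open>q y\<close> serves as an induction
  step.\<close>

lemma complex_scale_induct [consumes 1, case_names near0 step]:
  fixes P :: "complex \<Rightarrow> bool"
  assumes q: "q > 1"
    and "\<exists>\<delta>>0. \<forall>y. norm y < \<delta> \<longrightarrow> P y"
    and step: "\<And>y. P y \<Longrightarrow> P (of_real q * y)"
  shows "P y"
proof -
  obtain \<delta> where d: "\<delta> > 0" "\<And>y. norm y < \<delta> \<Longrightarrow> P y" using assms(2) by blast
  have main: "norm y < q ^ N * \<delta> \<Longrightarrow> P y" for N y
  proof (induction N arbitrary: y)
    case 0 then show ?case using d by simp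
  next
    case (Suc N)
    have "norm (y / of_real q) < q ^ N * \<delta>"
      using Suc.prems q by (simp add: norm_divide field_simps)
    from step[OF Suc.IH[OF this]] show ?case using q by simp
  qed
  obtain N where "norm y / \<delta> < q ^ N" using real_arch_pow[OF q] by blast
  then show ?thesis using main[of y N] d by (simp add: field_simps)
qed

text \<open>Passing from \<open>y\<close> to \<open>q y\<close> scales the old zeros by
  \<open>q\<close> and adds one new zero, that of the factor \<open>1 + (q - 1) y\<close>.\<close>

lemma q_exp_eq_0_iff:
  assumes q: "q > 1"
  shows "q_exp q y = 0 \<longleftrightarrow> (\<exists>k::nat. of_real (q - 1) * y = - of_real (q ^ (k + 1)))"
  using q
proof (induction y rule: complex_scale_induct)
  case near0
  obtain \<delta> where d: "\<delta> > 0" "\<And>y. norm y < \<delta> \<Longrightarrow> norm (q_exp q y) \<ge> 1 / 2"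
    using q_exp_near_0[OF q] by blast
  show ?case
  \<comment> \<open>Below the radius \<open>1 / (q - 1)\<close> the right-hand side fails as well,
    because its points have modulus at least \<open>q / (q - 1)\<close>.\<close>
  proof (intro exI[of _ "min \<delta> (1 / (q - 1))"] conjI allI impI)
    show "0 < min \<delta> (1 / (q - 1))" using d q by simp
    fix y :: complex assume y: "norm y < min \<delta> (1 / (q - 1))"
    then have "q_exp q y \<noteq> 0" using d(2)[of y] by auto
    moreover have "of_real (q - 1) * y \<noteq> - of_real (q ^ (k + 1))" for k
    proof
      assume "of_real (q - 1) * y = - of_real (q ^ (k + 1))"
      then have "norm (of_real (q - 1) * y) = norm (- complex_of_real (q ^ (k + 1)))" by simp
      then have "(q - 1) * norm y = q ^ (k + 1)" using q unfolding norm_mult norm_minus_cancel norm_of_real by simp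
      moreover have "q ^ (k + 1) \<ge> 1" using q by (intro one_le_power) simp
      moreover have "(q - 1) * norm y < 1" using y q by (simp add: field_simps)
      ultimately show False by simp
    qed
    ultimately show "(q_exp q y = 0) = (\<exists>k::nat. of_real (q - 1) * y = - of_real (q ^ (k + 1)))" by blast
  qed
next
  case (step y)
  have "q_exp q (of_real q * y) = 0 \<longleftrightarrow> 1 + of_real (q - 1) * y = 0 \<or> q_exp q y = 0"
    unfolding q_exp_mult_q[OF q] by simp
  also have "1 + of_real (q - 1) * y = 0 \<longleftrightarrow> of_real (q - 1) * (of_real q * y) = - of_real (q ^ (0 + 1))"
  proof -
    have "of_real (q - 1) * (of_real q * y) = - of_real (q ^ (0 + 1)) \<longleftrightarrow>
        of_real q * (of_real (q - 1) * y) = of_real q * (- 1)"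
      by (simp add: algebra_simps)
    also have "\<dots> \<longleftrightarrow> of_real (q - 1) * y = - 1"
      using q by (subst mult_left_cancel) auto
    finally show ?thesis by (metis add.commute eq_neg_iff_add_eq_0)
  qed
  also have "q_exp q y = 0 \<longleftrightarrow> (\<exists>k. of_real (q - 1) * (of_real q * y) = - of_real (q ^ (Suc k + 1)))"
  proof -
    have "of_real (q - 1) * (of_real q * y) = - of_real (q ^ (Suc k + 1)) \<longleftrightarrow>
      of_real (q - 1) * y = - of_real (q ^ (k + 1))" for k
    proof -
      have "of_real (q - 1) * (of_real q * y) = - of_real (q ^ (Suc k + 1)) \<longleftrightarrow>
        of_real q * (of_real (q - 1) * y) = of_real q * (- of_real (q ^ (k + 1)))"
        by (simp add: algebra_simps)
      also have "\<dots> \<longleftrightarrow> of_real (q - 1) * y = - of_real (q ^ (k + 1))"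
        using q by (subst mult_left_cancel) auto
      finally show ?thesis .
    qed
    then show ?thesis using step by blast
  qed
  finally show ?case by (metis nat.exhaust)
qed

text \<open>Differentiating the functional equation reduces the claim to one fact: the factors
  \<open>1 + (q - 1) y\<close> and \<open>q_exp q y\<close> never vanish together, as zeros of the
  latter satisfy \<open>(q - 1) y = - q^(k + 1)\<close> with \<open>q^(k + 1) > 1\<close>.\<close>

lemma q_exp_simple_zero:
  assumes q: "q > 1"
  shows "q_exp q y = 0 \<Longrightarrow> deriv (q_exp q) y \<noteq> 0"
  using q
proof (induction y rule: complex_scale_induct)
  case near0
  obtain \<delta> where d: "\<delta> > 0" "\<And>y. norm y < \<delta> \<Longrightarrow> norm (q_exp q y) \<ge> 1 / 2"
    using q_exp_near_0[OF q] by blast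
  then show ?case by (intro exI[of _ \<delta>]) force
next
  case (step y)
  have D: "(q_exp q has_field_derivative deriv (q_exp q) y) (at y)" for y
    using holomorphic_derivI[OF q_exp_holomorphic[OF q, of UNIV]] by simp
  have 1: "((\<lambda>y. q_exp q (of_real q * y)) has_field_derivative deriv (q_exp q) (of_real q * y) * of_real q) (at y)"
    by (rule DERIV_chain2[OF D]) (auto intro!: derivative_eq_intros)
  have 2: "((\<lambda>y. q_exp q (of_real q * y)) has_field_derivative
      of_real (q - 1) * q_exp q y + (1 + of_real (q - 1) * y) * deriv (q_exp q) y) (at y)"
    unfolding q_exp_mult_q[OF q] by (auto intro!: derivative_eq_intros D)
  have e: "deriv (q_exp q) (of_real q * y) * of_real q =
      of_real (q - 1) * q_exp q y + (1 + of_real (q - 1) * y) * deriv (q_exp q) y"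
    by (rule DERIV_unique[OF 1 2])
  have z: "q_exp q (of_real q * y) = 0" by (rule step.prems)
  show ?case
  proof
    assume d0: "deriv (q_exp q) (of_real q * y) = 0"
    show False
    proof (cases "q_exp q y = 0")
      case True
      then obtain k where "of_real (q - 1) * y = - of_real (q ^ (k + 1))" using q_exp_eq_0_iff[OF q] by blast
      moreover have "q ^ (k + 1) \<noteq> 1" using q by (metis one_less_power less_irrefl add_gr_0 zero_less_one)
      ultimately have "1 + of_real (q - 1) * y \<noteq> 0"
        by (metis add.inverse_inverse eq_neg_iff_add_eq_0 of_real_eq_1_iff)
      then show False using e d0 True step by simp
    next
      case False
      then have "1 + of_real (q - 1) * y = 0" using z q_exp_mult_q[OF q, of y] by simp
      then show False using e d0 False q by simp
    qed
  qed
qed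

section \<open>Series with poles and quasi-periodic functions\<close>

lemma tendsto_div_simple_zero:
  fixes f :: "complex \<Rightarrow> complex"
  assumes "(f has_field_derivative D) (at w)" "f w = 0" "D \<noteq> 0"
  shows "((\<lambda>z. (z - w) / f z) \<longlongrightarrow> 1 / D) (at w)"
proof -
  have "((\<lambda>z. (f z - f w) / (z - w)) \<longlongrightarrow> D) (at w)"
    using assms(1) by (simp add: has_field_derivative_iff)
  from tendsto_inverse[OF this assms(3)] show ?thesis
    using assms(2) by (simp add: inverse_eq_divide)
qed

section \<open>Sums over the integers of holomorphic functions\<close>

lemma summable_on_int:
  fixes f :: "int \<Rightarrow> real"
  assumes "summable (\<lambda>n. f (int n))" "summable (\<lambda>n. f (- int n))" "\<And>n. f n \<ge> 0"
  shows "f summable_on UNIV"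
proof -
  have 1: "f summable_on range int"
    using assms by (subst summable_on_reindex) (auto simp: o_def summable_on_UNIV_nonneg_real_iff)
  have 2: "f summable_on range (\<lambda>n. - int n)"
    using assms by (subst summable_on_reindex) (auto simp: o_def summable_on_UNIV_nonneg_real_iff inj_on_def)
  have "f summable_on (range (\<lambda>n. - int n) - range int)"
    by (rule summable_on_subset_banach[OF 2]) auto
  then have "f summable_on (range int \<union> (range (\<lambda>n. - int n) - range int))"
    by (intro summable_on_Un_disjoint 1) auto
  also have "range int \<union> (range (\<lambda>n. - int n) - range int) = UNIV"
  proof -
    have "n \<in> range int \<union> range (\<lambda>n. - int n)" for n by (cases n rule: int_cases2) auto
    then show ?thesis by blast
  qed
  finally show ?thesis .
qed

lemma infsum_int_shift:
  fixes f :: "int \<Rightarrow> complex"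
  shows "infsum (\<lambda>n. f (n + k)) UNIV = infsum f UNIV"
  using infsum_reindex[of "\<lambda>n::int. n + k" UNIV f]
  by (simp add: o_def surj_plus_right)

lemma infsum_int_minus:
  fixes f :: "int \<Rightarrow> complex"
  shows "infsum (\<lambda>n. f (- n)) UNIV = infsum f UNIV"
  using infsum_reindex[of "\<lambda>n::int. - n" UNIV f]
  by (simp add: o_def)

lemma holomorphic_infsum_local:
  fixes f :: "int \<Rightarrow> complex \<Rightarrow> complex"
  assumes "open S" "\<And>n. f n holomorphic_on S"
    and loc: "\<And>w. w \<in> S \<Longrightarrow> \<exists>r>0. \<exists>M. cball w r \<subseteq> S \<and> M summable_on UNIV \<and>
      (\<forall>n. \<forall>z\<in>cball w r. norm (f n z) \<le> M n)"
  shows "(\<lambda>z. \<Sum>\<^sub>\<infinity>n. f n z) holomorphic_on S"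
proof -
  have "\<exists>r>0. (\<lambda>z. \<Sum>\<^sub>\<infinity>n. f n z) holomorphic_on ball w r" if "w \<in> S" for w
  proof -
    obtain r M where r: "r > 0" "cball w r \<subseteq> S" "M summable_on UNIV"
      "\<And>n z. z \<in> cball w r \<Longrightarrow> norm (f n z) \<le> M n" using loc[OF \<open>w \<in> S\<close>] by blast
    have ul: "uniform_limit (cball w r) (\<lambda>X z. \<Sum>n\<in>X. f n z) (\<lambda>z. \<Sum>\<^sub>\<infinity>n. f n z)
        (finite_subsets_at_top UNIV)"
      by (rule Weierstrass_m_test_general[OF _ r(3)]) (use r(4) in auto)
    have "(\<lambda>z. \<Sum>n\<in>X. f n z) holomorphic_on S" for X
      by (intro holomorphic_intros assms)
    then have "\<forall>\<^sub>F X in finite_subsets_at_top UNIV. continuous_on (cball w r) (\<lambda>z. \<Sum>n\<in>X. f n z) \<and>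
        (\<lambda>z. \<Sum>n\<in>X. f n z) holomorphic_on ball w r"
      using r(2) ball_subset_cball[of w r]
      by (intro always_eventually) (meson holomorphic_on_imp_continuous_on holomorphic_on_subset subset_trans)
    from holomorphic_uniform_limit[OF this ul] r(1) show ?thesis by auto
  qed
  then obtain r where r: "\<And>w. w \<in> S \<Longrightarrow> r w > 0" "\<And>w. w \<in> S \<Longrightarrow> (\<lambda>z. \<Sum>\<^sub>\<infinity>n. f n z) holomorphic_on ball w (r w)"
    by metis
  have "(\<lambda>z. \<Sum>\<^sub>\<infinity>n. f n z) holomorphic_on (\<Union>w\<in>S. ball w (r w))"
    by (subst holomorphic_on_UN_open) (use r in auto)
  then show ?thesis by (rule holomorphic_on_subset) (use r in auto)
qed

text \<open>
  The maximum modulus principle propagates the majorant from the sphere, where no pole is near,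
  to the ball.
\<close>

lemma infsum_simple_poles:
  fixes f :: "int \<Rightarrow> complex \<Rightarrow> complex"
  assumes r: "r > 0"
    and holo: "\<And>n. f n holomorphic_on (ball w r - {w})"
    and lim: "\<And>n. ((\<lambda>z. (z - w) * f n z) \<longlongrightarrow> b n) (at w)"
    and bound: "\<And>s. 0 < s \<Longrightarrow> s < r \<Longrightarrow> \<exists>M. M summable_on UNIV \<and> (\<forall>n. \<forall>z\<in>sphere w s. norm (f n z) \<le> M n)"
  obtains G where "G holomorphic_on ball w r" "\<And>z. z \<in> ball w r - {w} \<Longrightarrow> G z = (z - w) * (\<Sum>\<^sub>\<infinity>n. f n z)"
    "G w = (\<Sum>\<^sub>\<infinity>n. b n)"
proof -
  \<comment> \<open>The factor \<open>z - w\<close> removes the singularity of each term, with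
    \<open>b n\<close> as the value at \<open>w\<close>; hence the residue of the sum is the sum of
    the residues.\<close>
  define g where "g = (\<lambda>n z. if z = w then b n else (z - w) * f n z)"
  define G where "G = (\<lambda>z. \<Sum>\<^sub>\<infinity>n. g n z)"
  have g: "g n holomorphic_on ball w r" for n
    unfolding g_def using lim[of n]
    by (intro removable_singularity holomorphic_intros holo) auto
  have M: "\<exists>M. M summable_on UNIV \<and> (\<forall>n. \<forall>z\<in>cball w s. norm (g n z) \<le> M n)" if s: "0 < s" "s < r" for s
  proof -
    obtain M where M: "M summable_on UNIV" "\<And>n z. z \<in> sphere w s \<Longrightarrow> norm (f n z) \<le> M n"
      using bound[OF s] by blast
    have "norm (g n z) \<le> s * M n" if z: "z \<in> cball w s" for n z
    proof (rule maximum_modulus_frontier[of "g n" "cball w s"])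
      show "g n holomorphic_on interior (cball w s)"
        by (rule holomorphic_on_subset[OF g]) (use s in auto)
      show "continuous_on (closure (cball w s)) (g n)"
        by (rule holomorphic_on_imp_continuous_on, rule holomorphic_on_subset[OF g]) (use s in auto)
      fix y assume "y \<in> frontier (cball w s)"
      then have y: "y \<in> sphere w s" using s by (simp add: frontier_cball)
      then have "y \<noteq> w" "norm (y - w) = s" using s by (auto simp: dist_norm norm_minus_commute)
      then show "norm (g n y) \<le> s * M n"
        using M(2)[OF y, of n] s by (simp add: g_def norm_mult)
    qed (use z in auto)
    moreover have "(\<lambda>n. s * M n) summable_on UNIV" by (rule summable_on_cmult_right[OF M(1)])
    ultimately show ?thesis by blast
  qed
  show ?thesis
  proof (rule that[of G])
    show "G holomorphic_on ball w r"
      unfolding G_def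
    proof (rule holomorphic_infsum_local)
      fix z assume z: "z \<in> ball w r"
      define s where "s = (dist w z + r) / 2"
      have s: "0 < s" "s < r" "dist w z < s" using z r by (auto simp: s_def add_nonneg_pos)
      obtain M where M: "M summable_on UNIV" "\<And>n z. z \<in> cball w s \<Longrightarrow> norm (g n z) \<le> M n"
        using M[OF s(1,2)] by blast
      have sub: "cball z (s - dist w z) \<subseteq> cball w s"
        by (subst cball_subset_cball_iff) (use s in \<open>auto simp: dist_commute\<close>)
      show "\<exists>r'>0. \<exists>M. cball z r' \<subseteq> ball w r \<and> M summable_on UNIV \<and> (\<forall>n. \<forall>y\<in>cball z r'. norm (g n y) \<le> M n)"
      proof (intro exI[of _ "s - dist w z"] conjI exI[of _ M] allI ballI)
        show "cball z (s - dist w z) \<subseteq> ball w r" using sub s by force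
        show "norm (g n y) \<le> M n" if "y \<in> cball z (s - dist w z)" for n y
          using M(2) sub that by blast
      qed (use s M in auto)
    qed (use g in auto)
    show "G w = (\<Sum>\<^sub>\<infinity>n. b n)" by (simp add: G_def g_def)
    have sm: "(\<lambda>n. f n z) summable_on UNIV" if z: "z \<in> ball w r - {w}" for z
    proof -
      have "0 < dist w z" "dist w z < r" using z by auto
      from bound[OF this] obtain M where M: "M summable_on UNIV" "\<And>n. norm (f n z) \<le> M n"
        by auto
      show ?thesis
        by (rule abs_summable_summable, rule summable_on_comparison_test[OF M(1)]) (use M in auto)
    qed
    show "G z = (z - w) * (\<Sum>\<^sub>\<infinity>n. f n z)" if z: "z \<in> ball w r - {w}" for z
      using z sm[OF z] by (simp add: G_def g_def infsum_cmult_right)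
  qed
qed

text \<open>
  A quasi-periodic entire function has a doubly periodic, hence constant, derivative; an affine
  function with a period is constant.
\<close>

lemma entire_quasi_periodic_constant:
  fixes K :: "complex \<Rightarrow> complex"
  assumes K: "K holomorphic_on UNIV" and L: "L > 0" and L': "L' > 0"
    and per1: "\<And>u. K (u + of_real L) = K u"
    and per2: "\<And>u. K (u + of_real L' * \<i>) = K u + c"
  shows "c = 0 \<and> (\<exists>k. \<forall>u. K u = k)"
proof -
  have D: "(K has_field_derivative deriv K u) (at u)" for u
    using holomorphic_derivI[OF K] by simp
  have d1: "deriv K (u + of_real L) = deriv K u" for u
  proof -
    have "((\<lambda>u. K (u + of_real L)) has_field_derivative deriv K (u + of_real L) * 1) (at u)"
      by (rule DERIV_chain2[OF D]) (auto intro!: derivative_eq_intros)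
    then show ?thesis using D[of u] unfolding per1 by (auto dest: DERIV_unique)
  qed
  have d2: "deriv K (u + of_real L' * \<i>) = deriv K u" for u
  proof -
    have "((\<lambda>u. K (u + of_real L' * \<i>)) has_field_derivative deriv K (u + of_real L' * \<i>) * 1) (at u)"
      by (rule DERIV_chain2[OF D]) (auto intro!: derivative_eq_intros)
    moreover have "((\<lambda>u. K (u + of_real L' * \<i>)) has_field_derivative deriv K u + 0) (at u)"
      unfolding per2 by (intro DERIV_add D DERIV_const)
    ultimately show ?thesis by (auto dest: DERIV_unique)
  qed
  have i1: "deriv K (u + of_int m * of_real L) = deriv K u" for u m
  proof (induction m rule: int_induct[of _ 0])
    case (step1 i) then show ?case using d1[of "u + of_int i * of_real L"] by (simp add: algebra_simps)
  next
    case (step2 i) then show ?case using d1[of "u + of_int (i - 1) * of_real L"] by (simp add: algebra_simps)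
  qed simp
  have i2: "deriv K (u + of_int m * (of_real L' * \<i>)) = deriv K u" for u m
  proof (induction m rule: int_induct[of _ 0])
    case (step1 i) then show ?case using d2[of "u + of_int i * (of_real L' * \<i>)"] by (simp add: algebra_simps)
  next
    case (step2 i) then show ?case using d2[of "u + of_int (i - 1) * (of_real L' * \<i>)"] by (simp add: algebra_simps)
  qed simp
  have hd: "deriv K holomorphic_on UNIV" by (rule holomorphic_deriv[OF K]) auto
  have "compact (cbox 0 (Complex L L'))" by (rule compact_cbox)
  then have "bounded (deriv K ` cbox 0 (Complex L L'))"
    by (intro compact_imp_bounded compact_continuous_image holomorphic_on_imp_continuous_on
        holomorphic_on_subset[OF hd]) auto
  moreover have "range (deriv K) \<subseteq> deriv K ` cbox 0 (Complex L L')"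
  proof safe
    fix u
    define v where "v = u + of_int (- \<lfloor>Re u / L\<rfloor>) * of_real L + of_int (- \<lfloor>Im u / L'\<rfloor>) * (of_real L' * \<i>)"
    have "deriv K v = deriv K u" unfolding v_def i1 i2 ..
    moreover have "v \<in> cbox 0 (Complex L L')"
    proof -
      have "Re v = L * frac (Re u / L)" "Im v = L' * frac (Im u / L')"
        using L L' by (simp_all add: v_def frac_def algebra_simps)
      moreover have "0 \<le> frac x" "frac x \<le> 1" for x :: real
        by (auto intro: less_imp_le frac_lt_1)
      ultimately show ?thesis using L L'
        by (simp add: in_cbox_complex_iff mult_left_le)
    qed
    ultimately show "deriv K u \<in> deriv K ` cbox 0 (Complex L L')" by (metis imageI)
  qed
  ultimately have "bounded (range (deriv K))" using bounded_subset by blast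
  then obtain k where k: "\<And>u. deriv K u = k" using Liouville_theorem[OF hd] unfolding constant_on_def by blast
  have "((\<lambda>u. K u - k * u) has_field_derivative 0) (at u)" for u
    using D[of u] unfolding k by (auto intro!: derivative_eq_intros)
  then obtain b where b: "\<And>u. K u - k * u = b"
    using has_field_derivative_zero_constant[of UNIV "\<lambda>u. K u - k * u"] by (metis UNIV_I convex_UNIV)
  have Kb: "K u = k * u + b" for u using b[of u] by (simp add: algebra_simps)
  have "k * of_real L = 0" using per1[of 0] unfolding Kb by simp
  then have "k = 0" using L by simp
  with per2[of 0] show ?thesis unfolding Kb by auto
qed

lemma eventually_eq_imp_eq_continuous:
  fixes f g :: "complex \<Rightarrow> complex"
  assumes "isCont f u" "isCont g u" "\<forall>\<^sub>F z in at u. f z = g z"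
  shows "f u = g u"
proof -
  have "(f \<longlongrightarrow> g u) (at u)"
    by (rule Lim_transform_eventually[of g]) (use assms in \<open>auto simp: isCont_def elim: eventually_mono\<close>)
  then show ?thesis using assms(1) by (metis LIM_unique isCont_def)
qed

lemma eventually_at_shift:
  fixes a :: complex
  assumes "\<forall>\<^sub>F z in at (u + a). P z"
  shows "\<forall>\<^sub>F z in at u. P (z + a)"
proof -
  have "\<forall>\<^sub>F z in at 0. P (z + (u + a))"
    using assms by (subst (asm) at_to_0) (simp add: eventually_filtermap)
  then show ?thesis by (subst at_to_0) (simp add: eventually_filtermap add.assoc)
qed

text \<open>The limit condition is Riemann's criterion for removable singularities. Values of
  \<open>H\<close> at its singular points are arbitrary, for instance through division by 0, so the
  periods are assumed only on punctured neighbourhoods and the conclusion is drawn only at points of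
  continuity.\<close>

lemma quasi_periodic_constant:
  fixes H :: "complex \<Rightarrow> complex"
  assumes sing: "\<And>u. isolated_singularity_at H u" "\<And>u. ((\<lambda>z. (z - u) * H z) \<longlongrightarrow> 0) (at u)"
    and L: "L > 0" and L': "L' > 0"
    and per1: "\<And>u. \<forall>\<^sub>F z in at u. H (z + of_real L) = H z"
    and per2: "\<And>u. \<forall>\<^sub>F z in at u. H (z + of_real L' * \<i>) = H z + c"
  shows "c = 0 \<and> (\<exists>k. \<forall>u. isCont H u \<longrightarrow> H u = k)"
proof -
  define K where "K = remove_sings H"
  have "\<exists>l. (H \<longlongrightarrow> l) (at u)" for u
  proof -
    obtain r where r: "r > 0" "H analytic_on ball u r - {u}"
      using sing(1)[of u] by (auto simp: isolated_singularity_at_def)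
    then have "H holomorphic_on ball u r - {u}" by (simp add: analytic_imp_holomorphic)
    then obtain g where g: "g holomorphic_on ball u r" "\<And>z. z \<in> ball u r - {u} \<Longrightarrow> g z = H z"
      using holomorphic_on_extend_lim[of H "ball u r" u] sing(2)[of u] r(1) by auto
    have "(g \<longlongrightarrow> g u) (at u)"
      using g(1) r(1) by (metis centre_in_ball continuous_on_eq_continuous_at holomorphic_on_imp_continuous_on isCont_def open_ball)
    moreover have "\<forall>\<^sub>F z in at u. g z = H z"
      using eventually_at_in_open[of "ball u r" u] r(1) g(2) by (auto elim!: eventually_mono)
    ultimately show ?thesis using Lim_transform_eventually by blast
  qed
  then obtain l where l: "\<And>u. (H \<longlongrightarrow> l u) (at u)" by metis
  have an: "K analytic_on {u}" for u
    unfolding K_def by (rule remove_sings_analytic_at[OF sing(1) l])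
  then have an': "K analytic_on UNIV" by (simp add: analytic_on_analytic_at[of _ UNIV])
  then have holo: "K holomorphic_on UNIV" by (simp add: analytic_on_open)
  have ev: "\<forall>\<^sub>F z in at u. K z = H z" for u
    unfolding K_def by (rule eventually_remove_sings_eq_at[OF sing(1)])
  have cont: "isCont K u" for u
    using holomorphic_on_imp_continuous_on[OF holo] by (simp add: continuous_on_eq_continuous_at)
  have contc: "isCont (\<lambda>z. K (z + a)) u" for u a
    by (rule isCont_o2[OF _ cont]) (auto intro!: continuous_intros)
  have p1: "K (u + of_real L) = K u" for u
  proof (rule eventually_eq_imp_eq_continuous[where f = "\<lambda>u. K (u + of_real L)" and g = K])
    show "\<forall>\<^sub>F z in at u. K (z + of_real L) = K z"
      using eventually_at_shift[OF ev[of "u + of_real L"]] ev[of u] per1[of u] by eventually_elim simp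
  qed (intro cont contc)+
  have p2: "K (u + of_real L' * \<i>) = K u + c" for u
  proof (rule eventually_eq_imp_eq_continuous[where f = "\<lambda>u. K (u + of_real L' * \<i>)" and g = "\<lambda>u. K u + c"])
    show "\<forall>\<^sub>F z in at u. K (z + of_real L' * \<i>) = K z + c"
      using eventually_at_shift[OF ev[of "u + of_real L' * \<i>"]] ev[of u] per2[of u] by eventually_elim simp
  qed (intro continuous_intros cont contc)+
  obtain k where k: "c = 0" "\<And>u. K u = k"
    using entire_quasi_periodic_constant[OF holo L L' p1 p2] by blast
  have "H u = k" if "isCont H u" for u
    using eventually_eq_imp_eq_continuous[OF cont that ev] k(2) by simp
  with k(1) show ?thesis by blast
qed

section \<open>Theta functions\<close>

lemma summable_gaussian_power:
  fixes p B :: real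
  assumes p: "0 < p" "p < 1" and B: "B \<ge> 0"
  shows "summable (\<lambda>n. p ^ (n * (n - 1) div 2) * B ^ n)"
proof -
  have "(\<lambda>n. p ^ n * B) \<longlonglongrightarrow> 0 * B"
    using p by (intro tendsto_intros LIMSEQ_power_zero) auto
  then have "\<forall>\<^sub>F n in sequentially. p ^ n * B < 1 / 2"
    by (rule order_tendstoD) simp
  then obtain N where N: "\<And>n. n \<ge> N \<Longrightarrow> p ^ n * B < 1 / 2"
    by (auto simp: eventually_sequentially)
  show ?thesis
  proof (rule summable_ratio_test[of "1/2" N])
    fix n assume "n \<ge> N"
    have e: "Suc n * (Suc n - 1) div 2 = n * (n - 1) div 2 + n"
    proof (cases n)
      case (Suc m)
      have "Suc n * (Suc n - 1) = n * (n - 1) + n * 2" by (simp add: Suc algebra_simps)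
      then show ?thesis by simp
    qed simp
    have "norm (p ^ (Suc n * (Suc n - 1) div 2) * B ^ Suc n) =
        (p ^ n * B) * (p ^ (n * (n - 1) div 2) * B ^ n)"
      unfolding e using p B by (simp add: power_add)
    also have "\<dots> \<le> 1 / 2 * (p ^ (n * (n - 1) div 2) * B ^ n)"
      using N[OF \<open>n \<ge> N\<close>] p B by (intro mult_right_mono) auto
    finally show "norm (p ^ (Suc n * (Suc n - 1) div 2) * B ^ Suc n) \<le>
        1 / 2 * norm (p ^ (n * (n - 1) div 2) * B ^ n)" using p B by simp
  qed simp
qed

lemma theta_term_bound:
  assumes p: "0 < p" "p < 1"
  obtains M where "M summable_on UNIV"
    "\<And>n z. norm z \<le> B \<Longrightarrow> norm (1 / z) \<le> B \<Longrightarrow>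
      norm (of_real (p powi (n * (n - 1) div 2)) * z powi n :: complex) \<le> M n"
proof -
  define B' where "B' = max B 1"
  have B': "B' \<ge> 1" by (simp add: B'_def)
  define M where "M = (\<lambda>n::int. p powi (n * (n - 1) div 2) * B' ^ nat \<bar>n\<bar>)"
  have pos: "int m * (int m - 1) div 2 = int (m * (m - 1) div 2)" for m
    by (cases m) (simp_all add: zdiv_int algebra_simps)
  \<comment> \<open>The exponent at \<open>- m\<close> exceeds the one at \<open>m\<close> by
    \<open>m\<close>; as \<open>p < 1\<close>, the negative half of the series is dominated by the
    positive half.\<close>
  have neg: "- int m * (- int m - 1) div 2 = int (m * (m - 1) div 2 + m)" for m
  proof -
    have "- int m * (- int m - 1) = int m * (int m - 1) + int m * 2" by (simp add: algebra_simps)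
    then show ?thesis using pos[of m] by simp
  qed
  show ?thesis
  proof (rule that[of M])
    show "M summable_on UNIV"
    proof (rule summable_on_int)
      show "M n \<ge> 0" for n using p B' by (simp add: M_def)
      show s: "summable (\<lambda>n. M (int n))"
        using summable_gaussian_power[OF p, of B'] B' unfolding M_def pos by (simp add: power_int_of_nat)
      show "summable (\<lambda>n. M (- int n))"
      proof (rule summable_comparison_test'[OF s])
        fix m
        have "p ^ (m * (m - 1) div 2 + m) \<le> p ^ (m * (m - 1) div 2)"
          using p by (intro power_decreasing) auto
        then show "norm (M (- int m)) \<le> M (int m)"
          using p B' unfolding M_def neg pos power_int_of_nat by (simp add: mult_right_mono)
      qed
    qed
    fix n :: int and z :: complex assume z: "norm z \<le> B" "norm (1 / z) \<le> B"
    have "norm (z powi n) \<le> B' ^ nat \<bar>n\<bar>"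
    proof (cases "n \<ge> 0")
      case True then show ?thesis
        using z B' by (simp add: power_int_def norm_power B'_def power_mono le_max_iff_disj)
    next
      case False then show ?thesis
        using z B' by (simp add: power_int_def norm_power B'_def power_mono le_max_iff_disj norm_inverse inverse_eq_divide norm_divide)
    qed
    then show "norm (of_real (p powi (n * (n - 1) div 2)) * z powi n) \<le> M n"
      using p by (simp add: M_def norm_mult norm_power_int mult_left_mono)
  qed
qed

lemma theta_holomorphic:
  assumes p: "0 < p" "p < 1"
  shows "theta p holomorphic_on - {0}"
  unfolding theta_def
proof (rule holomorphic_infsum_local)
  fix w :: complex assume w: "w \<in> - {0}"
  define B where "B = max (2 * norm w) (2 / norm w)"
  obtain M where M: "M summable_on UNIV"
    "\<And>n z. norm z \<le> B \<Longrightarrow> norm (1 / z) \<le> B \<Longrightarrow>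
      norm (of_real (p powi (n * (n - 1) div 2)) * z powi n :: complex) \<le> M n"
    using theta_term_bound[OF p] by blast
  have b: "norm z \<le> B" "norm (1 / z) \<le> B" "z \<noteq> 0" if "z \<in> cball w (norm w / 2)" for z
  proof -
    have d: "norm (w - z) \<le> norm w / 2" using that by (simp add: dist_norm)
    have 1: "norm z \<le> norm w + norm w / 2"
      using d norm_triangle_ineq2[of z w] by (simp add: norm_minus_commute)
    have 2: "norm z \<ge> norm w / 2"
      using d norm_triangle_ineq2[of w z] by simp
    have nw: "norm w > 0" using w by simp
    show "norm z \<le> B" "z \<noteq> 0" using 1 2 nw by (auto simp: B_def)
    have "norm (1 / z) \<le> 2 / norm w" using 2 nw \<open>z \<noteq> 0\<close> by (simp add: norm_divide field_simps)
    then show "norm (1 / z) \<le> B" by (simp add: B_def)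
  qed
  show "\<exists>r>0. \<exists>M. cball w r \<subseteq> - {0} \<and> M summable_on UNIV \<and>
     (\<forall>n. \<forall>z\<in>cball w r. norm (of_real (p powi (n * (n - 1) div 2)) * z powi n) \<le> M n)"
    using w M b by (intro exI[of _ "norm w / 2"] exI[of _ M] conjI) auto
qed (auto intro!: holomorphic_intros)

lemma theta_mult_p:
  assumes p: "p > 0" and z: "z \<noteq> 0"
  shows "theta p z = z * theta p (of_real p * z)"
proof -
  have "z * (of_real (p powi (n * (n - 1) div 2)) * (of_real p * z) powi n) =
     of_real (p powi ((n + 1) * (n + 1 - 1) div 2)) * z powi (n + 1)" for n :: int
  proof -
    have "(n + 1) * (n + 1 - 1) = n * (n - 1) + n * 2" by (simp add: algebra_simps)
    then have "(n + 1) * (n + 1 - 1) div 2 = n * (n - 1) div 2 + n" by simp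
    then show ?thesis using p z by (simp add: power_int_add power_int_mult_distrib)
  qed
  then have "z * theta p (of_real p * z) =
      (\<Sum>\<^sub>\<infinity>n::int. of_real (p powi ((n + 1) * (n + 1 - 1) div 2)) * z powi (n + 1))"
    unfolding theta_def by (subst infsum_cmult_right'[symmetric]) simp
  also have "\<dots> = theta p z"
    unfolding theta_def by (rule infsum_int_shift)
  finally show ?thesis ..
qed

text \<open>The exponent \<open>n (n - 1) / 2\<close> is invariant under \<open>n -> 1 - n\<close>,
  while the sign \<open>(- 1)^n\<close> flips, so the sum equals its own negative.\<close>

lemma theta_minus_1: "theta p (- 1) = 0"
proof -
  define a where "a = (\<lambda>n::int. of_real (p powi (n * (n - 1) div 2)) * (- 1) powi n :: complex)"
  have a: "a (1 - n) = - a n" for n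
  proof -
    have "(1 - n) * (1 - n - 1) = n * (n - 1)" by (simp add: algebra_simps)
    then show ?thesis by (auto simp: a_def power_int_minus_left)
  qed
  have "infsum a UNIV = infsum (\<lambda>n. a (n + 1)) UNIV" by (rule infsum_int_shift[symmetric])
  also have "\<dots> = infsum (\<lambda>n. a (- n + 1)) UNIV" by (rule infsum_int_minus[symmetric])
  also have "\<dots> = infsum (\<lambda>n. - a n) UNIV" using a by (simp add: add.commute)
  also have "\<dots> = - infsum a UNIV" by (rule infsum_uminus)
  finally show ?thesis unfolding theta_def a_def by simp
qed

text \<open>All terms are positive at 1 and the term \<open>n = 0\<close> equals 1. This keeps the
  constant in the triple product away from 0.\<close>

lemma theta_1_neq_0:
  assumes p: "0 < p" "p < 1"
  shows "theta p 1 \<noteq> 0"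
proof -
  obtain M where M: "M summable_on UNIV"
    "\<And>n z. norm z \<le> 1 \<Longrightarrow> norm (1 / z) \<le> 1 \<Longrightarrow>
      norm (of_real (p powi (n * (n - 1) div 2)) * z powi n :: complex) \<le> M n"
    using theta_term_bound[OF p] by blast
  have s: "(\<lambda>n::int. p powi (n * (n - 1) div 2)) summable_on UNIV"
    by (rule summable_on_comparison_test[OF M(1)]) (use M(2)[of 1] p in \<open>simp_all add: norm_power_int\<close>)
  have "theta p 1 = of_real (\<Sum>\<^sub>\<infinity>n::int. p powi (n * (n - 1) div 2))"
    unfolding theta_def power_int_1_left mult_1_right
    by (rule infsumI, rule has_sum_of_real, rule has_sum_infsum[OF s])
  moreover have "(\<Sum>n\<in>{0::int}. p powi (n * (n - 1) div 2)) \<le> (\<Sum>\<^sub>\<infinity>n::int. p powi (n * (n - 1) div 2))"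
    by (rule finite_sum_le_infsum[OF s]) (use p in auto)
  ultimately show ?thesis by auto
qed

text \<open>\<open>theta_prod q z\<close> is the product of \<open>(1 + p^k z) (1 + p^(k+1) / z)\<close> over \<open>k \<ge> 0\<close>, where \<open>p = 1/q\<close>.\<close>

definition theta_prod :: "real \<Rightarrow> complex \<Rightarrow> complex" where
  "theta_prod q z = q_exp q (of_real q * z / of_real (q - 1)) * q_exp q (1 / (z * of_real (q - 1)))"

lemma theta_prod_holomorphic: "q > 1 \<Longrightarrow> theta_prod q holomorphic_on - {0}"
  unfolding theta_prod_def
  by (intro holomorphic_on_mult holomorphic_on_compose_gen[OF _ q_exp_holomorphic[of q UNIV], unfolded o_def])
    (auto intro!: holomorphic_intros)

lemma q_exp_factor1_zero:
  assumes q: "q > 1"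
  shows "q_exp q (of_real q * z / of_real (q - 1)) = 0 \<longleftrightarrow> (\<exists>k::nat. z = - of_real (q ^ k))"
proof -
  have "of_real (q - 1) * (of_real q * z / of_real (q - 1)) = - of_real (q ^ (k + 1)) \<longleftrightarrow> z = - of_real (q ^ k)" for k
  proof -
    have "of_real (q - 1) * (of_real q * z / of_real (q - 1)) = of_real q * z"
      using q by simp
    moreover have "- complex_of_real (q ^ (k + 1)) = of_real q * (- of_real (q ^ k))" by simp
    moreover have "of_real q * z = of_real q * (- of_real (q ^ k)) \<longleftrightarrow> z = - of_real (q ^ k)"
      using q by (subst mult_left_cancel) auto
    ultimately show ?thesis by simp
  qed
  then show ?thesis unfolding q_exp_eq_0_iff[OF q] by blast
qed

lemma q_exp_factor2_zero:
  assumes q: "q > 1" and z: "z \<noteq> 0"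
  shows "q_exp q (1 / (z * of_real (q - 1))) = 0 \<longleftrightarrow> (\<exists>k::nat. z = - (1 / of_real (q ^ (k + 1))))"
proof -
  have "of_real (q - 1) * (1 / (z * of_real (q - 1))) = - of_real (q ^ (k + 1)) \<longleftrightarrow> z = - (1 / of_real (q ^ (k + 1)))" for k
  proof -
    have "of_real (q - 1) * (1 / (z * of_real (q - 1))) = 1 / z" using q by simp
    moreover have "complex_of_real (q ^ (k + 1)) \<noteq> 0" using q by simp
    then have "1 / z = - complex_of_real (q ^ (k + 1)) \<longleftrightarrow> z = - (1 / of_real (q ^ (k + 1)))"
      using z by (auto simp: field_simps eq_neg_iff_add_eq_0)
    ultimately show ?thesis by simp
  qed
  then show ?thesis unfolding q_exp_eq_0_iff[OF q] by blast
qed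

lemma theta_prod_zero_iff:
  assumes q: "q > 1" and z: "z \<noteq> 0"
  shows "theta_prod q z = 0 \<longleftrightarrow> (\<exists>n::int. z = - (of_real q powi n))"
proof
  assume "theta_prod q z = 0"
  then consider k where "z = - of_real (q ^ k)" | k where "z = - (1 / of_real (q ^ (k + 1)))"
    unfolding theta_prod_def mult_eq_0_iff q_exp_factor1_zero[OF q] q_exp_factor2_zero[OF q z] by blast
  then show "\<exists>n::int. z = - (of_real q powi n)"
  proof cases
    case 1 then show ?thesis by (intro exI[of _ "int k"]) (simp add: power_int_of_nat)
  next
    case 2 then show ?thesis by (intro exI[of _ "- int (k + 1)"])
        (simp only: power_int_minus power_int_of_nat of_real_power inverse_eq_divide)
  qed
next
  assume "\<exists>n::int. z = - (of_real q powi n)"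
  then obtain n :: int where n: "z = - (of_real q powi n)" by blast
  show "theta_prod q z = 0"
  proof (cases n rule: int_cases2)
    case (nonneg k)
    then have "z = - of_real (q ^ k)" using n by (simp add: power_int_of_nat)
    then show ?thesis unfolding theta_prod_def mult_eq_0_iff q_exp_factor1_zero[OF q] by blast
  next
    case (nonpos k)
    show ?thesis
    proof (cases k)
      case 0
      then have "z = - of_real (q ^ 0)" using n nonpos by simp
      then show ?thesis unfolding theta_prod_def mult_eq_0_iff q_exp_factor1_zero[OF q] by blast
    next
      case (Suc j)
      then have "z = - (1 / of_real (q ^ (j + 1)))"
        using n nonpos by (simp only: power_int_minus power_int_of_nat of_real_power inverse_eq_divide Suc_eq_plus1)
      then show ?thesis unfolding theta_prod_def mult_eq_0_iff q_exp_factor2_zero[OF q z] by blast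
    qed
  qed
qed

text \<open>The zeros of the first factor have modulus at least 1, those of the second modulus below
  1, so exactly one factor vanishes, and it does so simply.\<close>

lemma theta_prod_simple_zero:
  assumes q: "q > 1" and z: "z \<noteq> 0" and "theta_prod q z = 0"
  shows "deriv (theta_prod q) z \<noteq> 0"
proof -
  let ?a = "of_real q * z / of_real (q - 1)" and ?b = "1 / (z * of_real (q - 1))"
  have D: "(q_exp q has_field_derivative deriv (q_exp q) y) (at y)" for y
    using holomorphic_derivI[OF q_exp_holomorphic[OF q, of UNIV]] by simp
  have q0: "complex_of_real (q - 1) \<noteq> 0" "complex_of_real q \<noteq> 0" using q by auto
  have 1: "((\<lambda>z. q_exp q (of_real q * z / of_real (q - 1))) has_field_derivative
      deriv (q_exp q) ?a * (of_real q / of_real (q - 1))) (at z)"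
    by (rule DERIV_chain2[OF D]) (use q0 in \<open>auto intro!: derivative_eq_intros\<close>)
  have 2: "((\<lambda>z. q_exp q (1 / (z * of_real (q - 1)))) has_field_derivative
      deriv (q_exp q) ?b * (- 1 / (z ^ 2 * of_real (q - 1)))) (at z)"
    by (rule DERIV_chain2[OF D])
      (use q0 z in \<open>auto intro!: derivative_eq_intros simp: power2_eq_square divide_simps\<close>)
  have "(theta_prod q has_field_derivative
      (deriv (q_exp q) ?a * (of_real q / of_real (q - 1))) * q_exp q ?b +
      (deriv (q_exp q) ?b * (- 1 / (z ^ 2 * of_real (q - 1)))) * q_exp q ?a) (at z)"
    unfolding theta_prod_def by (rule DERIV_mult[OF 1 2])
  then have d: "deriv (theta_prod q) z = (deriv (q_exp q) ?a * (of_real q / of_real (q - 1))) * q_exp q ?b +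
      (deriv (q_exp q) ?b * (- 1 / (z ^ 2 * of_real (q - 1)))) * q_exp q ?a"
    by (rule DERIV_imp_deriv)
  have notboth: "q_exp q ?a \<noteq> 0 \<or> q_exp q ?b \<noteq> 0"
  proof (rule ccontr)
    assume "\<not> ?thesis"
    then obtain k j where zk: "z = - of_real (q ^ k)" and zj: "z = - (1 / of_real (q ^ (j + 1)))"
      unfolding q_exp_factor1_zero[OF q] q_exp_factor2_zero[OF q z] by blast
    have "norm z = q ^ k" unfolding zk norm_minus_cancel norm_of_real using q by simp
    moreover have "norm z = 1 / q ^ (j + 1)"
      unfolding zj norm_minus_cancel norm_divide norm_of_real using q by simp
    moreover have "q ^ k \<ge> 1" using q by simp
    moreover have "q ^ (j + 1) > 1" using q by (intro one_less_power) auto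
    then have "1 / q ^ (j + 1) < 1" using q by (subst divide_less_eq_1) auto
    ultimately show False by linarith
  qed
  show ?thesis
  proof (cases "q_exp q ?a = 0")
    case True
    then show ?thesis unfolding d using notboth q_exp_simple_zero[OF q True] q0 by simp
  next
    case False
    then have "q_exp q ?b = 0" using assms(3) by (simp add: theta_prod_def)
    from q_exp_simple_zero[OF q this] show ?thesis unfolding d using False q0 z \<open>q_exp q ?b = 0\<close> by simp
  qed
qed

text \<open>Under \<open>z -> q z\<close> the first factor gains \<open>1 + q z\<close> and the
  second loses \<open>1 + 1 / (q z)\<close>; the quotient of the two is \<open>q z\<close>. This is
  the functional equation of \<open>theta (1 / q)\<close>.\<close>

lemma theta_prod_mult_q:
  assumes q: "q > 1" and z: "z \<noteq> 0"
  shows "theta_prod q (of_real q * z) = of_real q * z * theta_prod q z"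
proof (cases "of_real q * z = - 1")
  case True
  have "theta_prod q (of_real q * z) = 0"
    unfolding True using theta_prod_zero_iff[OF q, of "- 1"] by (auto intro: exI[of _ 0])
  moreover have "theta_prod q z = 0"
  proof -
    have "z = - (of_real q powi (- 1))" using True q by (simp add: field_simps power_int_minus eq_neg_iff_add_eq_0)
    then show ?thesis using theta_prod_zero_iff[OF q z] by blast
  qed
  ultimately show ?thesis by simp
next
  case False
  have q0: "complex_of_real (q - 1) \<noteq> 0" "complex_of_real q \<noteq> 0" using q by auto
  have 1: "q_exp q (of_real q * (of_real q * z) / of_real (q - 1)) =
      (1 + of_real q * z) * q_exp q (of_real q * z / of_real (q - 1))"
    using q_exp_mult_q[OF q, of "of_real q * z / of_real (q - 1)"] q0 by simp
  have 2: "q_exp q (1 / (z * of_real (q - 1))) =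
      (1 + 1 / (of_real q * z)) * q_exp q (1 / (of_real q * z * of_real (q - 1)))"
    using q_exp_mult_q[OF q, of "1 / (of_real q * z * of_real (q - 1))"] q0 by simp
  have 3: "of_real q * z * (1 + 1 / (of_real q * z)) = 1 + of_real q * z"
    using q0 z by (simp add: field_simps)
  have "of_real q * z * theta_prod q z = (of_real q * z * (1 + 1 / (of_real q * z))) *
      (q_exp q (of_real q * z / of_real (q - 1)) * q_exp q (1 / (of_real q * z * of_real (q - 1))))"
    unfolding theta_prod_def 2 by (simp only: ac_simps)
  then show ?thesis unfolding theta_prod_def 1 3 by (simp only: ac_simps)
qed

lemma theta_mult_q:
  assumes q: "q > 1" and z: "z \<noteq> 0"
  shows "theta (1 / q) (of_real q * z) = of_real q * z * theta (1 / q) z"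
  using theta_mult_p[of "1 / q" "of_real q * z"] q z by simp

lemma theta_zero_on_spiral:
  assumes q: "q > 1"
  shows "theta (1 / q) (- (of_real q powi n)) = 0"
proof (induction n rule: int_induct[of _ 0])
  case base then show ?case by (simp add: theta_minus_1)
next
  case (step1 n)
  have "- (of_real q powi (n + 1)) = of_real q * (- (of_real q powi n) :: complex)"
    using q by (simp add: power_int_add)
  then show ?case using theta_mult_q[OF q, of "- (of_real q powi n)"] step1 q by simp
next
  case (step2 n)
  have e: "- (of_real q powi n) = of_real q * (- (of_real q powi (n - 1)) :: complex)"
    using q by (simp add: power_int_diff)
  then show ?case using theta_mult_q[OF q, of "- (of_real q powi (n - 1))"] step2 q by simp
qed

text \<open>The Jacobi triple product up to its constant factor, by Liouville's theorem.\<close>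

lemma theta_eq_theta_prod:
  assumes q: "q > 1"
  obtains k where "k \<noteq> 0" "\<And>z. z \<noteq> 0 \<Longrightarrow> theta (1 / q) z = k * theta_prod q z"
proof -
  have p: "0 < 1 / q" "1 / q < 1" using q by auto
  \<comment> \<open>Both functions satisfy \<open>f (q z) = q z f z\<close>, so their quotient,
    pulled back by exp, has the periods \<open>ln q\<close> and \<open>2 pi i\<close>.\<close>
  define H where "H = (\<lambda>v. theta (1 / q) (exp v) / theta_prod q (exp v))"
  have h1: "(\<lambda>v. theta (1 / q) (exp v)) holomorphic_on UNIV"
    by (rule holomorphic_on_compose_gen[OF _ theta_holomorphic[OF p], unfolded o_def]) (auto intro: holomorphic_intros)
  have h2: "(\<lambda>v. theta_prod q (exp v)) holomorphic_on UNIV"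
    by (rule holomorphic_on_compose_gen[OF _ theta_prod_holomorphic[OF q], unfolded o_def]) (auto intro: holomorphic_intros)
  have c1: "isCont (\<lambda>v. theta (1 / q) (exp v)) u" and c2: "isCont (\<lambda>v. theta_prod q (exp v)) u" for u
    using holomorphic_on_imp_continuous_on[OF h1] holomorphic_on_imp_continuous_on[OF h2]
    by (simp_all add: continuous_on_eq_continuous_at)
  have "H meromorphic_on UNIV"
    unfolding H_def using h1 h2
    by (intro meromorphic_intros analytic_on_imp_meromorphic_on) (simp_all add: analytic_on_open)
  then have sing: "isolated_singularity_at H u" for u 
    by (meson UNIV_I empty_subsetI insert_subset meromorphic_at_iff meromorphic_on_subset)
  have lim: "((\<lambda>z. (z - u) * H z) \<longlongrightarrow> 0) (at u)" for u
  proof (cases "theta_prod q (exp u) = 0")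
    case False
    have "((\<lambda>z. (z - u) * H z) \<longlongrightarrow> (u - u) * (theta (1 / q) (exp u) / theta_prod q (exp u))) (at u)"
      unfolding H_def using c1 c2 False by (intro tendsto_intros) (auto simp: isCont_def)
    then show ?thesis by simp
  next
    case True
    then obtain n :: int where n: "exp u = - (of_real q powi n)" using theta_prod_zero_iff[OF q, of "exp u"] by auto
    \<comment> \<open>The simple zero of the denominator is met by a zero of theta, so the quotient
      has no pole here.\<close>
    have "((\<lambda>v. theta_prod q (exp v)) has_field_derivative deriv (theta_prod q) (exp u) * exp u) (at u)"
      by (rule DERIV_chain2[OF holomorphic_derivI[OF theta_prod_holomorphic[OF q]]]) (auto intro!: derivative_eq_intros)
    from tendsto_div_simple_zero[OF this True] theta_prod_simple_zero[OF q _ True]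
    have "((\<lambda>z. (z - u) / theta_prod q (exp z)) \<longlongrightarrow> 1 / (deriv (theta_prod q) (exp u) * exp u)) (at u)" by simp
    from tendsto_mult[OF this c1[unfolded isCont_def]]
    show ?thesis unfolding n theta_zero_on_spiral[OF q] by (simp add: H_def)
  qed
  have L: "ln q > 0" "2 * pi > 0" using q by auto
  have per1: "H (z + of_real (ln q)) = H z" for z
  proof -
    have "exp (z + of_real (ln q)) = of_real q * exp z"
      using q by (simp add: exp_add exp_of_real)
    then show ?thesis unfolding H_def using theta_mult_q[OF q, of "exp z"] theta_prod_mult_q[OF q, of "exp z"] q by simp
  qed
  have per2: "H (z + of_real (2 * pi) * \<i>) = H z + 0" for z
    by (simp add: H_def exp_add mult_ac)
  obtain k where k: "\<And>u. isCont H u \<Longrightarrow> H u = k"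
    using quasi_periodic_constant[of H "ln q" "2 * pi" 0, OF sing lim L] per1 per2 by auto
  have eq: "theta (1 / q) z = k * theta_prod q z" if z: "z \<noteq> 0" for z
  proof (cases "theta_prod q z = 0")
    case True
    then show ?thesis using theta_prod_zero_iff[OF q z] theta_zero_on_spiral[OF q] by auto
  next
    case False
    have "isCont H (Ln z)" unfolding H_def using c1 c2 False z by (intro continuous_intros) auto
    from k[OF this] show ?thesis using False z by (simp add: H_def field_simps)
  qed
  show ?thesis
  proof (rule that[OF _ eq])
    show "k \<noteq> 0" using eq[of 1] theta_1_neq_0[OF p] by auto
  qed
qed

lemma theta_zero_iff:
  assumes q: "q > 1" and z: "z \<noteq> 0"
  shows "theta (1 / q) z = 0 \<longleftrightarrow> (\<exists>n::int. z = - (of_real q powi n))"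
  using theta_eq_theta_prod[OF q] theta_prod_zero_iff[OF q z] z by (metis mult_eq_0_iff)

text \<open>Simplicity is not visible in the series; it is inherited from the product, and it makes
  the poles of \<open>L_fun\<close> simple with a known residue.\<close>

lemma theta_simple_zero:
  assumes q: "q > 1" and z: "z \<noteq> 0" "theta (1 / q) z = 0"
  shows "deriv (theta (1 / q)) z \<noteq> 0"
proof -
  obtain k where k: "k \<noteq> 0" "\<And>z. z \<noteq> 0 \<Longrightarrow> theta (1 / q) z = k * theta_prod q z"
    using theta_eq_theta_prod[OF q] by blast
  have "\<forall>\<^sub>F z in nhds z. theta (1 / q) z = k * theta_prod q z"
    using t1_space_nhds[OF z(1)] by eventually_elim (rule k)
  then have "deriv (theta (1 / q)) z = deriv (\<lambda>z. k * theta_prod q z) z"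
    by (rule deriv_cong_ev) simp
  also have "\<dots> = k * deriv (theta_prod q) z"
    using holomorphic_on_imp_differentiable_at[OF theta_prod_holomorphic[OF q]] z
    by (intro deriv_cmult) auto
  finally show ?thesis using k theta_prod_simple_zero[OF q z(1)] z by simp
qed

section \<open>The logarithmic derivative of the dual theta function on the logarithmic
  scale\<close>

lemma q_dual_gt_1: "q > 1 \<Longrightarrow> q_dual q > 1"
  by (simp add: q_dual_def)

lemma of_real_q_dual: "of_real (q_dual q) = exp (4 * of_real pi ^ 2 / of_real (ln q) :: complex)"
  by (simp add: q_dual_def flip: exp_of_real)

text \<open>\<open>L_fun\<close> with both arguments read on the logarithmic scale, where only their difference matters.\<close>

definition L_log :: "real \<Rightarrow> complex \<Rightarrow> complex" where
  "L_log q v = L_fun 1 (q_dual q) (q_star q v)"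

lemma q_star_neq_0 [simp]: "q_star q v \<noteq> 0"
  by (simp add: q_star_def)

lemma q_star_diff: "q_star q (s - m) = q_star q s / q_star q m"
  by (simp add: q_star_def exp_diff right_diff_distrib diff_divide_distrib exp_minus field_simps)

lemma L_fun_q_star: "L_fun (q_star q m) (q_dual q) (q_star q s) = L_log q (s - m)"
  by (simp add: L_log_def L_fun_def q_star_diff)

lemma q_star_add_ln:
  assumes q: "q > 1"
  shows "q_star q (v + of_real (ln q)) = q_star q v"
proof -
  have "- 2 * of_real pi * \<i> * (v + of_real (ln q)) / of_real (ln q) =
      - 2 * of_real pi * \<i> * v / of_real (ln q) - 2 * of_real pi * \<i>"
    using q by (simp add: field_simps)
  moreover have "exp (a - 2 * of_real pi * \<i>) = exp a" for a :: complex
    by (simp add: exp_diff)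
  ultimately show ?thesis unfolding q_star_def by (simp only:)
qed

text \<open>The source of \<open>q_dual\<close>: a full turn around 0 becomes multiplication by
  \<open>q_dual q\<close>, while scaling by \<open>q\<close> becomes invisible, so the two periods
  change roles.\<close>

lemma q_star_add_2pi: "q_star q (v + of_real (2 * pi) * \<i>) = of_real (q_dual q) * q_star q v"
proof -
  have "- 2 * of_real pi * \<i> * (v + of_real (2 * pi) * \<i>) / of_real (ln q) =
      4 * of_real pi ^ 2 / of_real (ln q) + (- 2 * of_real pi * \<i> * v / of_real (ln q))"
    unfolding add_divide_distrib[symmetric] by (simp add: algebra_simps power2_eq_square)
  then show ?thesis unfolding of_real_q_dual q_star_def by (simp only: exp_add)
qed

lemma L_log_add_ln: "q > 1 \<Longrightarrow> L_log q (v + of_real (ln q)) = L_log q v"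
  by (simp add: L_log_def q_star_add_ln)

text \<open>The logarithms of the integer powers of \<open>q\<close>. The poles of the Jackson
  series and those of the translates of \<open>L_log\<close> all lie on translates of this one
  lattice.\<close>

definition log_lattice :: "real \<Rightarrow> complex set" where
  "log_lattice q = {of_int m * of_real (ln q) + of_int n * (of_real (2 * pi) * \<i>) | m n. True}"

lemma exp_eq_powi_iff:
  assumes q: "q > 1"
  shows "(\<exists>n::int. exp v = of_real q powi n) \<longleftrightarrow> v \<in> log_lattice q"
proof -
  have e: "of_real q powi n = exp (of_int n * of_real (ln q) :: complex)" for n
    using q exp_power_int[of "complex_of_real (ln q)" n] by (simp add: exp_of_real)
  show ?thesis unfolding e exp_eq log_lattice_def by (auto simp: mult_ac)
qed

lemma theta_q_star_zero_iff:
  assumes q: "q > 1"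
  shows "theta (1 / q_dual q) (- q_star q v) = 0 \<longleftrightarrow> v \<in> log_lattice q"
proof -
  have lq: "complex_of_real (ln q) \<noteq> 0" "complex_of_real pi \<noteq> 0" using q by auto
  have e: "of_real (q_dual q) powi n = exp (of_int n * (4 * of_real pi ^ 2 / of_real (ln q)) :: complex)" for n
    unfolding of_real_q_dual by (rule exp_power_int)
  have eq: "q_star q v = of_real (q_dual q) powi n \<longleftrightarrow>
      (\<exists>m. v = of_int (- m) * of_real (ln q) + of_int n * (of_real (2 * pi) * \<i>))" for n
  proof -
    have "- 2 * of_real pi * \<i> * v / of_real (ln q) =
          of_int n * (4 * of_real pi ^ 2 / of_real (ln q)) + of_int (2 * m) * of_real pi * \<i> \<longleftrightarrow>
       v = of_int (- m) * of_real (ln q) + of_int n * (of_real (2 * pi) * \<i>)" (is "?l = ?r \<longleftrightarrow> v = ?v") for m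
    proof -
      \<comment> \<open>The factor \<open>i ln q / (2 pi)\<close> undoes the coefficient
        \<open>- 2 pi i / ln q\<close> in the exponent of \<open>q_star\<close>; it turns
        \<open>2 pi i m\<close> into \<open>- m ln q\<close>.\<close>
      have "?l = ?r \<longleftrightarrow> ?l * (of_real (ln q) * \<i> / (2 * of_real pi)) = ?r * (of_real (ln q) * \<i> / (2 * of_real pi))"
        using lq by (subst mult_right_cancel) auto
      also have "?l * (of_real (ln q) * \<i> / (2 * of_real pi)) = v"
        using lq by (simp add: field_simps)
      also have "?r * (of_real (ln q) * \<i> / (2 * of_real pi)) = ?v"
        using lq by (simp add: field_simps power2_eq_square)
      finally show ?thesis .
    qed
    then show ?thesis unfolding e q_star_def exp_eq by simp
  qed
  have "theta (1 / q_dual q) (- q_star q v) = 0 \<longleftrightarrow> (\<exists>n::int. q_star q v = of_real (q_dual q) powi n)"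
    by (subst theta_zero_iff[OF q_dual_gt_1[OF q]]) auto
  also have "\<dots> \<longleftrightarrow> v \<in> log_lattice q"
  proof
    assume "\<exists>n::int. q_star q v = of_real (q_dual q) powi n"
    then show "v \<in> log_lattice q" unfolding eq log_lattice_def by blast
  next
    assume "v \<in> log_lattice q"
    then obtain m n where "v = of_int m * of_real (ln q) + of_int n * (of_real (2 * pi) * \<i>)"
      by (auto simp: log_lattice_def)
    then have "v = of_int (- (- m)) * of_real (ln q) + of_int n * (of_real (2 * pi) * \<i>)" by simp
    then show "\<exists>n::int. q_star q v = of_real (q_dual q) powi n" unfolding eq by blast
  qed
  finally show ?thesis .
qed

text \<open>Logarithmic derivative of \<open>theta (Q z) = Q z theta z\<close> with
  \<open>Q = q_dual q\<close>: the factor \<open>z\<close> contributes the 1.\<close>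

lemma L_log_add_2pi:
  assumes q: "q > 1" and v: "v \<notin> log_lattice q"
  shows "L_log q (v + of_real (2 * pi) * \<i>) = L_log q v + 1"
proof -
  let ?Q = "q_dual q" and ?z = "- q_star q v"
  let ?t = "theta (1 / ?Q)"
  have Q: "?Q > 1" by (rule q_dual_gt_1[OF q])
  have p: "0 < 1 / ?Q" "1 / ?Q < 1" using Q by auto
  have D: "(?t has_field_derivative deriv ?t z) (at z)" if "z \<noteq> 0" for z
    by (rule holomorphic_derivI[OF theta_holomorphic[OF p]]) (use that in auto)
  have z0: "?z \<noteq> 0" "complex_of_real ?Q \<noteq> 0" using Q by auto
  have t0: "?t ?z \<noteq> 0" using theta_q_star_zero_iff[OF q] v by blast
  have 1: "((\<lambda>z. ?t (of_real ?Q * z)) has_field_derivative deriv ?t (of_real ?Q * ?z) * of_real ?Q) (at ?z)"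
    by (rule DERIV_chain2[OF D]) (use z0 in \<open>auto intro!: derivative_eq_intros\<close>)
  have 2: "((\<lambda>z. of_real ?Q * z * ?t z) has_field_derivative
      of_real ?Q * ?t ?z + of_real ?Q * ?z * deriv ?t ?z) (at ?z)"
    by (auto intro!: derivative_eq_intros D z0)
  have "((\<lambda>z. ?t (of_real ?Q * z)) has_field_derivative
      of_real ?Q * ?t ?z + of_real ?Q * ?z * deriv ?t ?z) (at ?z)"
    by (rule has_field_derivative_transform_within_open[OF 2, of "- {0}"])
      (use z0 theta_mult_q[OF Q] in auto)
  from DERIV_unique[OF 1 this]
  have d: "deriv ?t (of_real ?Q * ?z) * of_real ?Q = of_real ?Q * ?t ?z + of_real ?Q * ?z * deriv ?t ?z" .
  have "L_log q (v + of_real (2 * pi) * \<i>) = (deriv ?t (of_real ?Q * ?z) * of_real ?Q) * ?z / ?t (of_real ?Q * ?z)"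
    unfolding L_log_def L_fun_def q_star_add_2pi by simp
  also have "\<dots> = (of_real ?Q * ?t ?z + of_real ?Q * ?z * deriv ?t ?z) * ?z / (of_real ?Q * ?z * ?t ?z)"
    unfolding d theta_mult_q[OF Q z0(1)] ..
  also have "\<dots> = L_log q v + 1"
    using z0 t0 unfolding L_log_def L_fun_def by (simp add: divide_simps) (simp add: algebra_simps)
  finally show ?thesis .
qed

lemma q_star_holomorphic: "q_star q holomorphic_on A"
  unfolding q_star_def by (intro holomorphic_intros) (auto)

lemma theta_q_star_holomorphic:
  assumes q: "q > 1"
  shows "(\<lambda>v. theta (1 / q_dual q) (- q_star q v)) holomorphic_on UNIV"
    and "(\<lambda>v. deriv (theta (1 / q_dual q)) (- q_star q v)) holomorphic_on UNIV"
proof -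
  have p: "0 < 1 / q_dual q" "1 / q_dual q < 1" using q_dual_gt_1[OF q] by auto
  show "(\<lambda>v. theta (1 / q_dual q) (- q_star q v)) holomorphic_on UNIV"
    by (rule holomorphic_on_compose_gen[OF _ theta_holomorphic[OF p], unfolded o_def])
      (auto intro!: holomorphic_intros q_star_holomorphic)
  show "(\<lambda>v. deriv (theta (1 / q_dual q)) (- q_star q v)) holomorphic_on UNIV"
    by (rule holomorphic_on_compose_gen[OF _ holomorphic_deriv[OF theta_holomorphic[OF p]], unfolded o_def])
      (auto intro!: holomorphic_intros q_star_holomorphic)
qed

lemma L_log_eq: "L_log q v = - q_star q v * (deriv (theta (1 / q_dual q)) (- q_star q v) / theta (1 / q_dual q) (- q_star q v))"
  by (simp add: L_log_def L_fun_def)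

lemma L_log_holomorphic:
  assumes q: "q > 1" and A: "A \<inter> log_lattice q = {}"
  shows "L_log q holomorphic_on A"
  unfolding L_log_eq[abs_def]
proof (intro holomorphic_on_mult holomorphic_on_minus holomorphic_on_divide q_star_holomorphic)
  show "(\<lambda>v. theta (1 / q_dual q) (- q_star q v)) holomorphic_on A"
    "(\<lambda>v. deriv (theta (1 / q_dual q)) (- q_star q v)) holomorphic_on A"
    using theta_q_star_holomorphic[OF q] holomorphic_on_subset by blast+
  show "theta (1 / q_dual q) (- q_star q v) \<noteq> 0" if "v \<in> A" for v
    using theta_q_star_zero_iff[OF q] A that by blast
qed

lemma L_log_meromorphic:
  assumes q: "q > 1"
  shows "(\<lambda>s. L_log q (s - m)) meromorphic_on UNIV"
  unfolding L_log_eq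
proof (intro meromorphic_on_mult meromorphic_on_uminus meromorphic_on_divide)
  have "(\<lambda>s. f (s - m)) meromorphic_on UNIV" if "f holomorphic_on UNIV" for f :: "complex \<Rightarrow> complex"
  proof -
    have "(\<lambda>s. f (s - m)) holomorphic_on UNIV"
      by (rule holomorphic_on_compose_gen[OF _ that, unfolded o_def]) (auto intro!: holomorphic_intros)
    then show ?thesis by (simp add: analytic_on_imp_meromorphic_on analytic_on_open)
  qed
  then show "(\<lambda>s. q_star q (s - m)) meromorphic_on UNIV"
    "(\<lambda>s. theta (1 / q_dual q) (- q_star q (s - m))) meromorphic_on UNIV"
    "(\<lambda>s. deriv (theta (1 / q_dual q)) (- q_star q (s - m))) meromorphic_on UNIV"
    using theta_q_star_holomorphic[OF q] q_star_holomorphic[of q UNIV] by blast+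
qed

lemma log_lattice_closed:
  assumes q: "q > 1"
  shows "closed (log_lattice q)"
proof -
  have "log_lattice q = {v. theta (1 / q_dual q) (- q_star q v) = 0}"
    using theta_q_star_zero_iff[OF q] by blast
  then show ?thesis
    using holomorphic_on_imp_continuous_on[OF theta_q_star_holomorphic(1)[OF q]]
    by (simp add: continuous_closed_preimage_constant closed_Collect_eq continuous_on_const)
qed

text \<open>Multiplied by \<open>- 2 pi i / ln q\<close>, \<open>L_log\<close> is the logarithmic
  derivative in \<open>v\<close> of the dual theta function at \<open>- q_star q v\<close>. The
  latter has residue 1 at its simple zeros, hence the value
  \<open>- ln q / (2 pi i) = i ln q / (2 pi)\<close>.\<close>

lemma L_log_simple_pole:
  assumes q: "q > 1"
  shows "v \<in> log_lattice q \<Longrightarrow> ((\<lambda>z. (z - v) * L_log q z) \<longlongrightarrow> \<i> * of_real (ln q / (2 * pi))) (at v)"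
    and "v \<notin> log_lattice q \<Longrightarrow> ((\<lambda>z. (z - v) * L_log q z) \<longlongrightarrow> 0) (at v)"
proof -
  let ?t = "theta (1 / q_dual q)"
  have p: "0 < 1 / q_dual q" "1 / q_dual q < 1" using q_dual_gt_1[OF q] by auto
  have c: "isCont (q_star q) v" "isCont (\<lambda>v. ?t (- q_star q v)) v" "isCont (\<lambda>v. deriv ?t (- q_star q v)) v"
    using holomorphic_on_imp_continuous_on[OF theta_q_star_holomorphic(1)[OF q]]
      holomorphic_on_imp_continuous_on[OF theta_q_star_holomorphic(2)[OF q]]
      holomorphic_on_imp_continuous_on[OF q_star_holomorphic[of q UNIV]]
    by (simp_all add: continuous_on_eq_continuous_at)
  have lq: "complex_of_real (ln q) \<noteq> 0" "complex_of_real pi \<noteq> 0" using q by auto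
  {
    assume v: "v \<in> log_lattice q"
    then have t0: "?t (- q_star q v) = 0" using theta_q_star_zero_iff[OF q] by blast
    have d0: "deriv ?t (- q_star q v) \<noteq> 0"
      by (rule theta_simple_zero[OF q_dual_gt_1[OF q] _ t0]) simp
    have s: "((\<lambda>v. - q_star q v) has_field_derivative - q_star q v * (- 2 * of_real pi * \<i> / of_real (ln q))) (at v)"
      unfolding q_star_def using lq by (auto intro!: derivative_eq_intros)
    have "((\<lambda>v. ?t (- q_star q v)) has_field_derivative
        deriv ?t (- q_star q v) * (- q_star q v * (- 2 * of_real pi * \<i> / of_real (ln q)))) (at v)"
      by (rule DERIV_chain2[OF holomorphic_derivI[OF theta_holomorphic[OF p]] s]) auto
    from tendsto_div_simple_zero[OF this t0]
    have t1: "((\<lambda>z. (z - v) / ?t (- q_star q z)) \<longlongrightarrow>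
        1 / (deriv ?t (- q_star q v) * (- q_star q v * (- 2 * of_real pi * \<i> / of_real (ln q))))) (at v)"
      using d0 lq by simp
    have t2: "((\<lambda>z. - q_star q z * deriv ?t (- q_star q z)) \<longlongrightarrow> - q_star q v * deriv ?t (- q_star q v)) (at v)"
      using c by (intro tendsto_intros) (auto simp: isCont_def)
    have "((\<lambda>z. (- q_star q z * deriv ?t (- q_star q z)) * ((z - v) / ?t (- q_star q z))) \<longlongrightarrow>
        (- q_star q v * deriv ?t (- q_star q v)) *
        (1 / (deriv ?t (- q_star q v) * (- q_star q v * (- 2 * of_real pi * \<i> / of_real (ln q)))))) (at v)"
      by (rule tendsto_mult[OF t2 t1])
    also have "(- q_star q v * deriv ?t (- q_star q v)) *
        (1 / (deriv ?t (- q_star q v) * (- q_star q v * (- 2 * of_real pi * \<i> / of_real (ln q))))) =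
        \<i> * of_real (ln q / (2 * pi))"
      using d0 lq by (simp add: field_simps)
    also have "(\<lambda>z. (- q_star q z * deriv ?t (- q_star q z)) * ((z - v) / ?t (- q_star q z))) =
        (\<lambda>z. (z - v) * L_log q z)"
      by (simp add: L_log_eq fun_eq_iff)
    finally show "((\<lambda>z. (z - v) * L_log q z) \<longlongrightarrow> \<i> * of_real (ln q / (2 * pi))) (at v)" .
  next
    assume v: "v \<notin> log_lattice q"
    have "L_log q holomorphic_on - log_lattice q" by (rule L_log_holomorphic[OF q]) auto
    then have "isCont (L_log q) v"
      using v log_lattice_closed[OF q] by (metis ComplI continuous_on_eq_continuous_at holomorphic_on_imp_continuous_on open_Compl)
    then have "((\<lambda>z. (z - v) * L_log q z) \<longlongrightarrow> (v - v) * L_log q v) (at v)"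
      by (intro tendsto_intros) (simp add: isCont_def)
    then show "((\<lambda>z. (z - v) * L_log q z) \<longlongrightarrow> 0) (at v)" by simp
  }
qed

text \<open>
  In the strip between two rows of the lattice the mean of the periodic function \<open>L_log q\<close> over
  a horizontal period does not depend on the height.
\<close>

lemma L_log_strip_primitive:
  assumes q: "q > 1"
  obtains G where "\<And>v. - 2 * pi < Im v \<Longrightarrow> Im v < 0 \<Longrightarrow> (G has_field_derivative L_log q v) (at v)"
    "\<And>v w. - 2 * pi < Im v \<Longrightarrow> Im v < 0 \<Longrightarrow> - 2 * pi < Im w \<Longrightarrow> Im w < 0 \<Longrightarrow>
      G (v + of_real (ln q)) - G v = G (w + of_real (ln q)) - G w"
proof -
  define S where "S = {v. - 2 * pi < Im v} \<inter> {v. Im v < 0}"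
  have S: "open S" "convex S"
    unfolding S_def by (intro open_Int open_halfspace_Im_gt open_halfspace_Im_lt convex_Int
        convex_halfspace_Im_gt convex_halfspace_Im_lt)+
  \<comment> \<open>The rows of the lattice lie at heights \<open>2 pi n\<close>, and no integer is
    strictly between -1 and 0.\<close>
  have disj: "S \<inter> log_lattice q = {}"
  proof -
    have False if vS: "v \<in> S" and vl: "v \<in> log_lattice q" for v
    proof -
      obtain m n where v: "v = of_int m * of_real (ln q) + of_int n * (of_real (2 * pi) * \<i>)"
        using vl by (auto simp: log_lattice_def)
      have "Im v = 2 * pi * of_int n" by (simp add: v)
      then have "2 * pi * (- 1) < 2 * pi * of_int n" "2 * pi * of_int n < 2 * pi * 0" using vS by (auto simp: S_def)
      then have "(- 1 :: real) < of_int n" "of_int n < (0 :: real)"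
        unfolding mult_less_cancel_left by auto
      then have "- 1 < n" "n < 0" by linarith+
      then show False by linarith
    qed
    then show ?thesis by blast
  qed
  obtain G where G: "\<And>v. v \<in> S \<Longrightarrow> (G has_field_derivative L_log q v) (at v)"
    using holomorphic_convex_primitive'[OF S(2,1) L_log_holomorphic[OF q disj]] at_within_open[OF _ S(1)]
    by metis
  have sh: "v + of_real (ln q) \<in> S" if "v \<in> S" for v using that by (simp add: S_def)
  have "((\<lambda>v. G (v + of_real (ln q)) - G v) has_field_derivative 0) (at v within S)" if v: "v \<in> S" for v
  proof -
    have "((\<lambda>v. G (v + of_real (ln q))) has_field_derivative L_log q (v + of_real (ln q)) * 1) (at v)"
      by (rule DERIV_chain2[where f = G and g = "\<lambda>v. v + of_real (ln q)", OF G[OF sh[OF v]]]) (auto intro!: derivative_eq_intros)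
    from DERIV_diff[OF this G[OF v]] show ?thesis
      by (simp add: L_log_add_ln[OF q] has_field_derivative_at_within)
  qed
  then obtain c where c: "\<And>v. v \<in> S \<Longrightarrow> G (v + of_real (ln q)) - G v = c"
    using has_field_derivative_zero_constant[OF S(2), of "\<lambda>v. G (v + of_real (ln q)) - G v"] by blast
  show ?thesis
  proof (rule that[of G])
    fix v assume "- 2 * pi < Im v" "Im v < 0"
    then have v: "v \<in> S" by (simp add: S_def)
    then show "(G has_field_derivative L_log q v) (at v)" by (rule G)
    fix w assume "- 2 * pi < Im w" "Im w < 0"
    then have "w \<in> S" by (simp add: S_def)
    with v show "G (v + of_real (ln q)) - G v = G (w + of_real (ln q)) - G w" using c by metis
  qed
qed

section \<open>The Jackson integral as a function of the spiral\<close>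

text \<open>Covers the finitely many middle indices of a spiral; at both ends the bounds come from
  the behaviour at infinity and at 0.\<close>

lemma scaled_inverse_bound:
  fixes f :: "complex \<Rightarrow> complex"
  assumes f: "continuous_on UNIV f" and K: "compact K"
    and nz: "\<And>y n. y \<in> K \<Longrightarrow> f (of_real q powi n * y) \<noteq> 0"
  obtains C where "\<And>y n. y \<in> K \<Longrightarrow> \<bar>n\<bar> \<le> N \<Longrightarrow> norm (1 / f (of_real q powi n * y)) \<le> C"
proof -
  have "\<exists>c. \<forall>y\<in>K. norm (1 / f (of_real q powi n * y)) \<le> c" for n :: int
  proof -
    have "continuous_on K (\<lambda>y. 1 / f (of_real q powi n * y))"
      using nz by (intro continuous_intros continuous_on_compose2[OF f]) auto
    then have "bounded ((\<lambda>y. 1 / f (of_real q powi n * y)) ` K)"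
      by (intro compact_imp_bounded compact_continuous_image K)
    then show ?thesis by (auto simp: bounded_iff)
  qed
  then obtain c where c: "\<And>n y. y \<in> K \<Longrightarrow> norm (1 / f (of_real q powi n * y)) \<le> c n" by metis
  show ?thesis
  proof (rule that)
    fix y and n :: int assume y: "y \<in> K" and n: "\<bar>n\<bar> \<le> N"
    have "norm (1 / f (of_real q powi n * y)) \<le> c n" by (rule c[OF y])
    also have "\<dots> \<le> \<bar>c n\<bar>" by simp
    also have "\<dots> \<le> (\<Sum>m\<in>{-N..N}. \<bar>c m\<bar>)"
      by (rule member_le_sum) (use n in auto)
    finally show "norm (1 / f (of_real q powi n * y)) \<le> (\<Sum>m\<in>{-N..N}. \<bar>c m\<bar>)" .
  qed
qed

lemma compact_norm_bounds:
  fixes K :: "complex set"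
  assumes K: "compact K" "0 \<notin> K"
  obtains a b where "0 < a" "\<And>y. y \<in> K \<Longrightarrow> a \<le> norm y" "0 < b" "\<And>y. y \<in> K \<Longrightarrow> norm y \<le> b"
proof (cases "K = {}")
  case False
  obtain b where b: "b > 0" "\<And>y. y \<in> K \<Longrightarrow> norm y \<le> b"
    using compact_imp_bounded[OF K(1)] by (auto simp: bounded_pos)
  obtain x where x: "x \<in> K" "\<And>y. y \<in> K \<Longrightarrow> norm x \<le> norm y"
    using continuous_attains_inf[OF K(1) False, of norm] continuous_on_norm_id by blast
  with K(2) have "norm x > 0" by auto
  with x(2) b show ?thesis using that by blast
next
  case True
  show ?thesis by (rule that[of 1 1]) (use True in auto)
qed

lemma powi_large:
  assumes q: "(q::real) > 1"
  obtains N :: int where "N \<ge> 0" "\<And>n. n \<ge> N \<Longrightarrow> q powi n \<ge> B" "\<And>n. n \<ge> N \<Longrightarrow> q powi (- n) * B \<le> 1"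
proof -
  obtain N where N: "B < q ^ N" using real_arch_pow[OF q] by blast
  have 1: "q powi n \<ge> B" if "n \<ge> int N" for n
  proof -
    have "q powi (int N) \<le> q powi n" using q that by (intro power_int_increasing) auto
    then show ?thesis using N by (simp add: power_int_of_nat)
  qed
  show ?thesis
  proof (rule that[of "int N"])
    show "q powi (- n) * B \<le> 1" if "n \<ge> int N" for n
      using 1[OF that] q by (simp add: power_int_minus field_simps)
  qed (use 1 in auto)
qed

text \<open>For large \<open>n\<close> one step multiplies \<open>1 / q_exp\<close> by a factor of
  modulus at most \<open>1 / q^2\<close>, so its product with \<open>q^(2 n)\<close> no longer
  grows; for \<open>n\<close> towards minus infinity \<open>q_exp\<close> stays near 1. The
  quadratic weight is enough to absorb the numerator \<open>q^n\<close> of a Jackson term and to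
  give \<open>1 / (1 + r^2)\<close> on a ray.\<close>

lemma q_exp_spiral_bound:
  assumes q: "q > 1" and K: "compact K" "0 \<notin> K"
    and nz: "\<And>y n. y \<in> K \<Longrightarrow> q_exp q (of_real q powi n * y) \<noteq> 0"
  obtains C where "\<And>y n. y \<in> K \<Longrightarrow> norm (1 / q_exp q (of_real q powi n * y)) * (1 + (q powi n) ^ 2) \<le> C"
proof -
  obtain a b where ab: "0 < a" "\<And>y. y \<in> K \<Longrightarrow> a \<le> norm y" "0 < b" "\<And>y. y \<in> K \<Longrightarrow> norm y \<le> b"
    using compact_norm_bounds[OF K] by blast
  obtain \<delta> where d: "\<delta> > 0" "\<And>y. norm y < \<delta> \<Longrightarrow> norm (q_exp q y) \<ge> 1 / 2"
    using q_exp_near_0[OF q] by blast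
  \<comment> \<open>From \<open>N1\<close> on the point \<open>(q - 1) z\<close> has modulus at
    least \<open>q^2 + 1\<close>, so the factor \<open>1 + (q - 1) z\<close> has modulus at least
    \<open>q^2\<close>; below \<open>- N2\<close> the spiral stays within
    \<open>\<delta> / 2\<close> of 0.\<close>
  obtain N1 :: int where N1: "N1 \<ge> 0" "\<And>n. n \<ge> N1 \<Longrightarrow> q powi n \<ge> (q ^ 2 + 1) / ((q - 1) * a)"
    using powi_large[OF q] by metis
  obtain N2 :: int where N2: "N2 \<ge> 0" "\<And>n. n \<ge> N2 \<Longrightarrow> q powi (- n) * (2 * b / \<delta>) \<le> 1"
    using powi_large[OF q] by metis
  define N where "N = max N1 N2"
  have cont: "continuous_on UNIV (q_exp q)"
    by (rule holomorphic_on_imp_continuous_on[OF q_exp_holomorphic[OF q]])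
  obtain C where C: "\<And>y n. y \<in> K \<Longrightarrow> \<bar>n\<bar> \<le> N \<Longrightarrow> norm (1 / q_exp q (of_real q powi n * y)) \<le> C"
    using scaled_inverse_bound[OF cont K(1) nz] by blast
  define C' where "C' = \<bar>C\<bar> * (q powi N) ^ 2"
  let ?e = "\<lambda>n y. norm (1 / q_exp q (of_real q powi n * y))"
  have up: "?e n y * (q powi n) ^ 2 \<le> C'" if y: "y \<in> K" and n: "n \<ge> N" for y n
    using n
  proof (induction n rule: int_ge_induct)
    case base
    have "N \<ge> 0" using N1(1) by (simp add: N_def)
    then show ?case using C[OF y, of N] by (simp add: C'_def mult_right_mono)
  next
    case (step n)
    let ?z = "of_real q powi n * y"
    have qn: "q powi n > 0" using q by simp
    have "norm (of_real (q - 1) * ?z) = (q - 1) * q powi n * norm y"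
      using q by (simp add: norm_mult norm_power_int flip: of_real_diff)
    also have "\<dots> \<ge> (q - 1) * q powi n * a" using q qn ab(2)[OF y] by (intro mult_left_mono) auto
    also have "(q - 1) * q powi n * a \<ge> q ^ 2 + 1"
    proof -
      have "(q ^ 2 + 1) / ((q - 1) * a) \<le> q powi n" using N1(2)[of n] step by (simp add: N_def)
      then show ?thesis using q ab(1) by (simp add: divide_le_eq mult_ac)
    qed
    finally have "norm (of_real (q - 1) * ?z) \<ge> q ^ 2 + 1" .
    then have l: "norm (1 + of_real (q - 1) * ?z) \<ge> q ^ 2"
      using norm_triangle_ineq2[of "of_real (q - 1) * ?z" "- 1"] by (simp add: add.commute)
    have s: "of_real q powi (n + 1) * y = of_real q * ?z" using q by (simp add: power_int_add mult_ac)
    have "?e (n + 1) y * (q powi (n + 1)) ^ 2 = q ^ 2 / norm (1 + of_real (q - 1) * ?z) * (?e n y * (q powi n) ^ 2)"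
      unfolding s q_exp_mult_q[OF q] using q by (simp add: norm_mult norm_divide power_int_add power_mult_distrib)
    also have "\<dots> \<le> 1 * (?e n y * (q powi n) ^ 2)"
      using l q by (intro mult_right_mono) (auto simp: divide_le_eq_1)
    finally show ?case using step by simp
  qed
  show ?thesis
  proof (rule that[of "\<bar>C\<bar> * (1 + (q powi N) ^ 2) + 2 * C' + 4"])
    fix y and n :: int assume y: "y \<in> K"
    have C'0: "C' \<ge> 0" by (simp add: C'_def)
    consider "n \<ge> N" | "n < - N" | "\<bar>n\<bar> \<le> N" by linarith
    then show "?e n y * (1 + (q powi n) ^ 2) \<le> \<bar>C\<bar> * (1 + (q powi N) ^ 2) + 2 * C' + 4"
    proof cases
      case 1
      have "n \<ge> 0" using 1 N1(1) by (simp add: N_def)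
      then have "q powi n \<ge> 1" using q by (simp add: one_le_power_int)
      then have "(q powi n) ^ 2 \<ge> 1" by simp
      then have "?e n y * (1 + (q powi n) ^ 2) \<le> ?e n y * (2 * (q powi n) ^ 2)"
        by (intro mult_left_mono) auto
      also have "\<dots> \<le> 2 * C'" using up[OF y 1] by simp
      finally show ?thesis using C'0 by (smt (verit) abs_ge_zero mult_nonneg_nonneg zero_le_power2)
    next
      case 2
      have le1: "q powi n \<le> 1" using 2 N1(1) q power_int_increasing[of n 0 q] by (simp add: N_def)
      have "q powi n * (2 * b / \<delta>) \<le> 1" using N2(2)[of "- n"] 2 by (simp add: N_def)
      then have "q powi n * (2 * b / \<delta>) * \<delta> \<le> 1 * \<delta>" using d(1) by (intro mult_right_mono) auto
      then have "q powi n * b < \<delta>" using d(1) by simp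
      moreover have "norm (of_real q powi n * y) \<le> q powi n * b"
        using q ab(4)[OF y] by (simp add: norm_mult norm_power_int)
      ultimately have "norm (q_exp q (of_real q powi n * y)) \<ge> 1 / 2" by (intro d(2)) simp
      then have e: "?e n y \<le> 2"
        using frac_le[of 1 1 "1 / 2" "norm (q_exp q (of_real q powi n * y))"] by (simp add: norm_divide)
      have "(q powi n) ^ 2 \<le> 1" using le1 q by (intro power_le_one) auto
      then have "?e n y * (1 + (q powi n) ^ 2) \<le> 2 * 2" using e by (intro mult_mono) auto
      then show ?thesis using C'0 by (smt (verit) abs_ge_zero mult_nonneg_nonneg zero_le_power2)
    next
      case 3
      have "q powi n \<le> q powi N" using 3 q by (intro power_int_increasing) auto
      then have "(q powi n) ^ 2 \<le> (q powi N) ^ 2" using q by (intro power_mono) auto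
      then have "?e n y * (1 + (q powi n) ^ 2) \<le> \<bar>C\<bar> * (1 + (q powi N) ^ 2)"
        using C[OF y 3] by (intro mult_mono) auto
      then show ?thesis using C'0 by linarith
    qed
  qed
qed

lemma one_plus_spiral_bound:
  assumes q: "q > 1" and K: "compact K" "0 \<notin> K"
    and nz: "\<And>y n. y \<in> K \<Longrightarrow> 1 + of_real q powi n * y \<noteq> (0::complex)"
  obtains C where "\<And>y n. y \<in> K \<Longrightarrow> norm (1 / (1 + of_real q powi n * y)) \<le> C"
proof -
  obtain a b where ab: "0 < a" "\<And>y. y \<in> K \<Longrightarrow> a \<le> norm y" "0 < b" "\<And>y. y \<in> K \<Longrightarrow> norm y \<le> b"
    using compact_norm_bounds[OF K] by blast
  \<comment> \<open>Outside the middle range the modulus of \<open>q^n y\<close> is at least 2 or at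
    most 1/2; in both cases \<open>1 + q^n y\<close> has modulus at least 1/2.\<close>
  obtain N1 :: int where N1: "N1 \<ge> 0" "\<And>n. n \<ge> N1 \<Longrightarrow> q powi n \<ge> 2 / a"
    using powi_large[OF q] by metis
  obtain N2 :: int where N2: "N2 \<ge> 0" "\<And>n. n \<ge> N2 \<Longrightarrow> q powi (- n) * (2 * b) \<le> 1"
    using powi_large[OF q] by metis
  define N where "N = max N1 N2"
  have cont: "continuous_on UNIV (\<lambda>y::complex. 1 + y)" by (intro continuous_intros)
  obtain C where C: "\<And>y n. y \<in> K \<Longrightarrow> \<bar>n\<bar> \<le> N \<Longrightarrow> norm (1 / (1 + of_real q powi n * y)) \<le> C"
    using scaled_inverse_bound[OF cont K(1) nz] by blast
  show ?thesis
  proof (rule that[of "max C 2"])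
    fix y and n :: int assume y: "y \<in> K"
    let ?z = "of_real q powi n * y"
    have nm: "norm ?z = q powi n * norm y" using q by (simp add: norm_mult norm_power_int)
    have qn: "q powi n > 0" using q by simp
    have "norm (1 / (1 + ?z)) \<le> 2" if "norm (1 + ?z) \<ge> 1 / 2"
      using frac_le[of 1 1 "1 / 2" "norm (1 + ?z)"] that by (simp add: norm_divide)
    moreover consider "n \<ge> N" | "n < - N" | "\<bar>n\<bar> \<le> N" by linarith
    then have "norm (1 + ?z) \<ge> 1 / 2 \<or> \<bar>n\<bar> \<le> N"
    proof cases
      case 1
      have "2 / a * a \<le> q powi n * norm y"
        using N1(2)[of n] 1 ab(1) ab(2)[OF y] qn by (intro mult_mono) (auto simp: N_def)
      then have "norm ?z \<ge> 2" using ab(1) nm by simp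
      then show ?thesis using norm_triangle_ineq2[of ?z "- 1"] by (simp add: add.commute)
    next
      case 2
      have "q powi n * (2 * b) \<le> 1" using N2(2)[of "- n"] 2 by (simp add: N_def)
      moreover have "q powi n * norm y \<le> q powi n * b" using ab(4)[OF y] qn by (intro mult_left_mono) auto
      ultimately have "norm ?z \<le> 1 / 2" using nm by simp
      then show ?thesis using norm_triangle_ineq2[of 1 "- ?z"] by simp
    qed simp
    ultimately show "norm (1 / (1 + ?z)) \<le> max C 2" using C[OF y, of n] by fastforce
  qed
qed

text \<open>Here \<open>y\<close> stands for \<open>q \<xi> / x\<close>, and the spiral is indexed by powers of \<open>q\<close> instead of \<open>p = 1/q\<close>.\<close>

definition jackson_term :: "real \<Rightarrow> complex \<Rightarrow> complex \<Rightarrow> int \<Rightarrow> complex" where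
  "jackson_term q \<xi> y n = of_real q powi n * \<xi> / (1 + of_real q powi n * \<xi>) / q_exp q (of_real q powi n * y)"

definition jackson_series :: "real \<Rightarrow> complex \<Rightarrow> complex \<Rightarrow> complex" where
  "jackson_series q \<xi> y = (\<Sum>\<^sub>\<infinity>n. jackson_term q \<xi> y n)"

text \<open>Excludes terms with a vanishing denominator, which HOL would silently evaluate to
  0.\<close>

definition jackson_regular :: "real \<Rightarrow> complex \<Rightarrow> complex \<Rightarrow> bool" where
  "jackson_regular q \<xi> y \<longleftrightarrow> \<xi> \<noteq> 0 \<and> y \<noteq> 0 \<and> (\<forall>n::int. 1 + of_real q powi n * \<xi> \<noteq> 0) \<and>
     (\<forall>n::int. q_exp q (of_real q powi n * y) \<noteq> 0)"

lemma jackson_series_mult_q: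
  assumes q: "q > 1"
  shows "jackson_series q (of_real q * \<xi>) (of_real q * y) = jackson_series q \<xi> y"
proof -
  have "jackson_term q (of_real q * \<xi>) (of_real q * y) = (\<lambda>n. jackson_term q \<xi> y (n + 1))"
    using q by (simp add: jackson_term_def power_int_add mult_ac fun_eq_iff)
  then show ?thesis unfolding jackson_series_def by (simp add: infsum_int_shift)
qed

text \<open>The prefactor collects \<open>q / (1 - p)\<close>, the \<open>1 - p\<close> of the
  Jackson integral and the \<open>1 - p\<close> in its base point, in all
  \<open>q (1 - p) = q - 1\<close>; the powers of \<open>p\<close> become powers of \<open>q\<close>
  by reversing the index.\<close>

lemma E_jackson_eq:
  assumes q: "q > 1"
  shows "E_jackson q lam x = of_real (q - 1) * jackson_series q lam (of_real q * lam / x)"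
proof -
  let ?p = "1 / q"
  have p1: "complex_of_real (1 - ?p) \<noteq> 0" "complex_of_real q \<noteq> 0" using q by auto
  have qp: "complex_of_real q * of_real (1 - ?p) = of_real (q - 1)" using q by (simp add: field_simps)
  have t: "lam * (psi (of_real ?p powi n * (of_real (1 - ?p) * lam) / of_real (1 - ?p)) /
        q_exp q (of_real q * (of_real ?p powi n * (of_real (1 - ?p) * lam) / (of_real (1 - ?p) * x))) * of_real ?p powi n)
      = jackson_term q lam (of_real q * lam / x) (- n)" for n :: int
  proof -
    have e: "complex_of_real ?p powi n = of_real q powi (- n)"
      by (simp add: power_int_minus inverse_eq_divide power_int_divide_distrib)
    show ?thesis unfolding e jackson_term_def psi_def using p1 by (simp add: mult_ac)
  qed
  have "E_jackson q lam x = of_real q * of_real (1 - ?p) *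
     (lam * (\<Sum>\<^sub>\<infinity>n::int. psi (of_real ?p powi n * (of_real (1 - ?p) * lam) / of_real (1 - ?p)) /
        q_exp q (of_real q * (of_real ?p powi n * (of_real (1 - ?p) * lam) / (of_real (1 - ?p) * x))) * of_real ?p powi n))"
    unfolding E_jackson_def Let_def jackson_def using p1 by (simp add: field_simps)
  also have "\<dots> = of_real (q - 1) * (\<Sum>\<^sub>\<infinity>n::int. jackson_term q lam (of_real q * lam / x) (- n))"
    unfolding qp t[symmetric] by (subst infsum_cmult_right') simp
  finally show ?thesis unfolding infsum_int_minus jackson_series_def .
qed

text \<open>The parameter space is left general: discs and circles in the plane serve for holomorphy
  and poles, the interval \<open>[1, q]\<close> for the integral along a ray.\<close>

lemma jackson_term_bound:
  fixes X Y :: "'a::topological_space \<Rightarrow> complex"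
  assumes q: "q > 1" and A: "compact A" and X: "continuous_on A X" and Y: "continuous_on A Y"
    and reg: "\<And>z. z \<in> A \<Longrightarrow> jackson_regular q (X z) (Y z)"
  obtains M where "M summable_on UNIV" "\<And>z n. z \<in> A \<Longrightarrow> norm (jackson_term q (X z) (Y z) n) \<le> M n"
proof -
  have KX: "compact (X ` A)" "0 \<notin> X ` A" and KY: "compact (Y ` A)" "0 \<notin> Y ` A"
    using A X Y reg by (auto intro!: compact_continuous_image simp: jackson_regular_def)
  obtain C1 where C1: "\<And>y n. y \<in> X ` A \<Longrightarrow> norm (1 / (1 + of_real q powi n * y)) \<le> C1"
    using one_plus_spiral_bound[OF q KX] reg unfolding jackson_regular_def by blast
  obtain C2 where C2: "\<And>y n. y \<in> Y ` A \<Longrightarrow> norm (1 / q_exp q (of_real q powi n * y)) * (1 + (q powi n) ^ 2) \<le> C2"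
    using q_exp_spiral_bound[OF q KY] reg unfolding jackson_regular_def by blast
  obtain b where b: "b > 0" "\<And>y. y \<in> X ` A \<Longrightarrow> norm y \<le> b"
    using compact_norm_bounds[OF KX] by metis
  \<comment> \<open>One power \<open>q^n\<close> from the numerator against the weight from
    \<open>q_exp_spiral_bound\<close>; in both directions this is at most a geometric sequence with
    ratio \<open>1 / q\<close>.\<close>
  define w where "w = (\<lambda>n::int. q powi n / (1 + (q powi n) ^ 2))"
  have geo: "summable (\<lambda>n. (1 / q) ^ n)" using q by (intro summable_geometric) simp
  have w0: "w n \<ge> 0" for n using q by (simp add: w_def)
  have "w summable_on UNIV"
  proof (rule summable_on_int)
    have le1: "w (int n) \<le> (1 / q) ^ n" for n
    proof -
      have "w (int n) \<le> q ^ n / (q ^ n) ^ 2"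
        unfolding w_def power_int_of_nat using q by (intro divide_left_mono) (auto intro!: mult_pos_pos add_pos_pos)
      also have "\<dots> = (1 / q) ^ n" using q by (simp add: power2_eq_square power_divide)
      finally show ?thesis .
    qed
    have le2: "w (- int n) \<le> (1 / q) ^ n" for n
    proof -
      have "w (- int n) \<le> q powi (- int n) / 1"
        unfolding w_def using q by (intro divide_left_mono) (auto intro!: mult_pos_pos add_pos_pos)
      also have "\<dots> = (1 / q) ^ n" by (simp add: power_int_minus power_int_of_nat inverse_eq_divide power_divide)
      finally show ?thesis .
    qed
    show "summable (\<lambda>n. w (int n))" "summable (\<lambda>n. w (- int n))"
      by (rule summable_comparison_test'[OF geo]; use le1 le2 w0 in simp)+
  qed (rule w0)
  then have "(\<lambda>n. b * C1 * C2 * w n) summable_on UNIV" by (rule summable_on_cmult_right)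
  moreover have "norm (jackson_term q (X z) (Y z) n) \<le> b * C1 * C2 * w n" if z: "z \<in> A" for z n
  proof -
    have pos: "1 + (q powi n) ^ 2 > 0" by (smt (verit) zero_le_power2)
    have qn: "q powi n > 0" using q by simp
    have c1: "norm (1 / (1 + of_real q powi n * X z)) \<le> C1" using C1 z by blast
    have c2: "norm (1 / q_exp q (of_real q powi n * Y z)) \<le> C2 / (1 + (q powi n) ^ 2)"
      using C2[of "Y z" n] z pos by (simp add: pos_le_divide_eq)
    have c3: "norm (of_real q powi n * X z) \<le> q powi n * b"
      using b(2)[of "X z"] z q by (simp add: norm_mult norm_power_int)
    have "norm (jackson_term q (X z) (Y z) n) =
      norm (of_real q powi n * X z) * norm (1 / (1 + of_real q powi n * X z)) * norm (1 / q_exp q (of_real q powi n * Y z))"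
      by (simp add: jackson_term_def norm_mult norm_divide)
    also have "\<dots> \<le> (q powi n * b) * C1 * (C2 / (1 + (q powi n) ^ 2))"
      using b qn c1 c2 c3 order_trans[OF norm_ge_zero c1]
      by (intro mult_mono) auto
    also have "\<dots> = b * C1 * C2 * w n" by (simp add: w_def)
    finally show ?thesis .
  qed
  ultimately show ?thesis using that by blast
qed

lemma jackson_term_holomorphic:
  assumes q: "q > 1" and XY: "X holomorphic_on S" "Y holomorphic_on S"
    and reg: "\<And>z. z \<in> S \<Longrightarrow> jackson_regular q (X z) (Y z)"
  shows "(\<lambda>z. jackson_term q (X z) (Y z) n) holomorphic_on S"
proof -
  have 1: "(\<lambda>z. q_exp q (of_real q powi n * Y z)) holomorphic_on S"
    by (rule holomorphic_on_compose_gen[OF _ q_exp_holomorphic[OF q, of UNIV], unfolded o_def])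
      (auto intro!: holomorphic_on_mult holomorphic_on_const XY)
  have 2: "(\<lambda>z. of_real q powi n * X z) holomorphic_on S"
    by (intro holomorphic_on_mult holomorphic_on_const XY)
  have "1 + of_real q powi n * X z \<noteq> 0" "q_exp q (of_real q powi n * Y z) \<noteq> 0" if "z \<in> S" for z
    using reg[OF that] unfolding jackson_regular_def by blast+
  then show ?thesis
    unfolding jackson_term_def
    by (intro holomorphic_on_divide holomorphic_on_add holomorphic_on_const 1 2)
qed

lemma jackson_series_holomorphic:
  assumes q: "q > 1" and S: "open S" and XY: "X holomorphic_on S" "Y holomorphic_on S"
    and reg: "\<And>z. z \<in> S \<Longrightarrow> jackson_regular q (X z) (Y z)"
  shows "(\<lambda>z. jackson_series q (X z) (Y z)) holomorphic_on S"
  unfolding jackson_series_def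
proof (rule holomorphic_infsum_local[OF S jackson_term_holomorphic[OF q XY reg]])
  fix w assume "w \<in> S"
  then obtain r where r: "r > 0" "cball w r \<subseteq> S" using S open_contains_cball by blast
  have c: "continuous_on (cball w r) X" "continuous_on (cball w r) Y"
    using XY r(2) by (meson holomorphic_on_imp_continuous_on holomorphic_on_subset)+
  obtain M where "M summable_on UNIV" "\<And>z n. z \<in> cball w r \<Longrightarrow> norm (jackson_term q (X z) (Y z) n) \<le> M n"
    using jackson_term_bound[OF q compact_cball c] reg r(2) by blast
  then show "\<exists>r>0. \<exists>M. cball w r \<subseteq> S \<and> M summable_on UNIV \<and>
      (\<forall>n. \<forall>z\<in>cball w r. norm (jackson_term q (X z) (Y z) n) \<le> M n)"
    using r by blast
qed

lemma jackson_series_simple_pole: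
  assumes q: "q > 1" and r: "r > 0" and XY: "X holomorphic_on ball w r" "Y holomorphic_on ball w r"
    and reg: "\<And>z. z \<in> ball w r - {w} \<Longrightarrow> jackson_regular q (X z) (Y z)"
    and lim: "\<And>n. ((\<lambda>z. (z - w) * jackson_term q (X z) (Y z) n) \<longlongrightarrow> b n) (at w)"
  obtains G where "G holomorphic_on ball w r"
    "\<And>z. z \<in> ball w r - {w} \<Longrightarrow> G z = (z - w) * jackson_series q (X z) (Y z)" "G w = (\<Sum>\<^sub>\<infinity>n. b n)"
proof -
  have holo: "(\<lambda>z. jackson_term q (X z) (Y z) n) holomorphic_on ball w r - {w}" for n
    using XY by (intro jackson_term_holomorphic[OF q _ _ reg]) (auto intro: holomorphic_on_subset)
  have bound: "\<exists>M. M summable_on UNIV \<and> (\<forall>n. \<forall>z\<in>sphere w s. norm (jackson_term q (X z) (Y z) n) \<le> M n)"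
    if s: "0 < s" "s < r" for s
  proof -
    have sub: "sphere w s \<subseteq> ball w r - {w}" using s by auto
    have c: "continuous_on (sphere w s) X" "continuous_on (sphere w s) Y"
      using XY sub by (meson Diff_subset holomorphic_on_imp_continuous_on holomorphic_on_subset subset_trans)+
    obtain M where "M summable_on UNIV" "\<And>z n. z \<in> sphere w s \<Longrightarrow> norm (jackson_term q (X z) (Y z) n) \<le> M n"
      using jackson_term_bound[OF q compact_sphere c] reg sub by blast
    then show ?thesis by blast
  qed
  obtain G where G: "G holomorphic_on ball w r"
    "\<And>z. z \<in> ball w r - {w} \<Longrightarrow> G z = (z - w) * (\<Sum>\<^sub>\<infinity>n. jackson_term q (X z) (Y z) n)"
    "G w = (\<Sum>\<^sub>\<infinity>n. b n)"
    using infsum_simple_poles[OF r holo lim bound] by metis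
  show ?thesis
    by (rule that[of G]) (use G in \<open>simp_all add: jackson_series_def\<close>)
qed

section \<open>The period lattice and the poles of the Jackson series\<close>

lemma log_lattice_diff: "v \<in> log_lattice q \<Longrightarrow> w \<in> log_lattice q \<Longrightarrow> v - w \<in> log_lattice q"
proof -
  assume "v \<in> log_lattice q" "w \<in> log_lattice q"
  then obtain m n m' n' where "v = of_int m * of_real (ln q) + of_int n * (of_real (2 * pi) * \<i>)"
    "w = of_int m' * of_real (ln q) + of_int n' * (of_real (2 * pi) * \<i>)"
    by (auto simp: log_lattice_def)
  then have "v - w = of_int (m - m') * of_real (ln q) + of_int (n - n') * (of_real (2 * pi) * \<i>)"
    by (simp add: algebra_simps)
  then show ?thesis unfolding log_lattice_def by blast
qed

lemma log_latticeI: "of_int m * of_real (ln q) + of_int n * (of_real (2 * pi) * \<i>) \<in> log_lattice q"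
  unfolding log_lattice_def by blast

lemma log_lattice_0: "0 \<in> log_lattice q"
  using log_latticeI[of 0 q 0] by simp

lemma log_lattice_2pi: "of_real (2 * pi) * \<i> \<in> log_lattice q"
  using log_latticeI[of 0 q 1] by simp

lemma log_lattice_minus: "- v \<in> log_lattice q \<longleftrightarrow> v \<in> log_lattice q"
  using log_lattice_diff[OF log_lattice_0, of v q] log_lattice_diff[OF log_lattice_0, of "- v" q] by auto

lemma log_lattice_minus_commute: "v - w \<in> log_lattice q \<longleftrightarrow> w - v \<in> log_lattice q"
  using log_lattice_minus[of "v - w" q] by simp

lemma log_lattice_add_iff: "w \<in> log_lattice q \<Longrightarrow> v + w \<in> log_lattice q \<longleftrightarrow> v \<in> log_lattice q"
  using log_lattice_diff[of "v + w" q w] log_lattice_diff[of v q "- w"] log_lattice_minus[of w q] by auto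

lemma log_lattice_discrete:
  assumes q: "q > 1" and v: "v \<in> log_lattice q" "norm v < min (ln q) (2 * pi)"
  shows "v = 0"
proof -
  obtain m n where e: "v = of_int m * of_real (ln q) + of_int n * (of_real (2 * pi) * \<i>)"
    using v(1) by (auto simp: log_lattice_def)
  have re: "Re v = of_int m * ln q" and im: "Im v = of_int n * (2 * pi)" by (simp_all add: e)
  have lq: "ln q > 0" using q by simp
  have "\<bar>Re v\<bar> = \<bar>of_int m\<bar> * ln q" "\<bar>Im v\<bar> = \<bar>of_int n\<bar> * (2 * pi)"
    using lq by (simp_all add: re im abs_mult)
  moreover have "\<bar>Re v\<bar> < 1 * ln q" "\<bar>Im v\<bar> < 1 * (2 * pi)"
    using abs_Re_le_cmod[of v] abs_Im_le_cmod[of v] v(2) by auto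
  ultimately have mn: "\<bar>of_int m\<bar> * ln q < 1 * ln q" "\<bar>of_int n\<bar> * (2 * pi) < 1 * (2 * pi)"
    by simp_all
  have "\<bar>of_int m :: real\<bar> < 1" using mn(1) lq by (simp only: mult_less_cancel_right)
  then have "m = 0" by linarith
  have "\<bar>of_int n :: real\<bar> < 1" using mn(2) pi_gt_zero by (simp only: mult_less_cancel_right)
  then have "n = 0" by linarith
  with \<open>m = 0\<close> show ?thesis by (simp add: e)
qed

lemma log_lattice_isolated:
  assumes q: "q > 1"
  obtains r where "r > 0" "\<And>z. z \<in> ball u r - {u} \<Longrightarrow> z - a \<notin> log_lattice q"
proof (cases "u - a \<in> log_lattice q")
  case True
  show ?thesis
  proof (rule that)
    show "min (ln q) (2 * pi) > 0" using q by simp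
    fix z assume z: "z \<in> ball u (min (ln q) (2 * pi)) - {u}"
    show "z - a \<notin> log_lattice q"
    proof
      assume "z - a \<in> log_lattice q"
      from log_lattice_diff[OF this True] have "z - u \<in> log_lattice q" by simp
      from log_lattice_discrete[OF q this] z show False by (auto simp: dist_norm norm_minus_commute)
    qed
  qed
next
  case False
  then obtain r where r: "r > 0" "ball (u - a) r \<subseteq> - log_lattice q"
    using log_lattice_closed[OF q] by (metis ComplI open_Compl open_contains_ball)
  show ?thesis
  proof (rule that[OF r(1)])
    fix z assume "z \<in> ball u r - {u}"
    then have "z - a \<in> ball (u - a) r" by (simp add: dist_norm)
    with r(2) show "z - a \<notin> log_lattice q" by blast
  qed
qed

lemma eventually_not_log_lattice:
  assumes q: "q > 1"
  shows "\<forall>\<^sub>F z in at u. z - a \<notin> log_lattice q"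
proof -
  obtain r where r: "r > 0" "\<And>z. z \<in> ball u r - {u} \<Longrightarrow> z - a \<notin> log_lattice q"
    using log_lattice_isolated[OF q] by blast
  have "\<forall>\<^sub>F z in at u. z \<in> ball u r - {u}" by (rule eventually_at_in_open) (use r in auto)
  then show ?thesis by eventually_elim (rule r(2))
qed

lemma exp_mult_powi:
  assumes q: "q > 0"
  shows "of_real q powi n * exp u = exp (u + of_int n * of_real (ln q) :: complex)"
  using exp_power_int[of "complex_of_real (ln q)" n] q by (simp add: exp_of_real exp_add)

lemma psi_pole_iff:
  assumes q: "q > 1"
  shows "(\<exists>n::int. 1 + of_real q powi n * exp u = 0) \<longleftrightarrow> u + of_real pi * \<i> \<in> log_lattice q"
proof -
  have "1 + of_real q powi n * exp u = 0 \<longleftrightarrow> exp (- (u + of_real pi * \<i>)) = of_real q powi n" for n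
  proof -
    have "exp (- (u + of_real pi * \<i>)) = - (1 / exp u)"
      by (simp add: exp_diff exp_minus inverse_eq_divide)
    moreover have "1 + of_real q powi n * exp u = 0 \<longleftrightarrow> - (1 / exp u) = of_real q powi n"
    proof -
      have "1 + of_real q powi n * exp u = 0 \<longleftrightarrow> of_real q powi n * exp u = - 1"
        by (metis add.commute eq_neg_iff_add_eq_0)
      also have "\<dots> \<longleftrightarrow> of_real q powi n = - 1 / exp u"
        by (rule nonzero_eq_divide_eq[symmetric]) simp
      finally show ?thesis by auto
    qed
    ultimately show ?thesis by simp
  qed
  then show ?thesis using exp_eq_powi_iff[OF q, of "- (u + of_real pi * \<i>)"] log_lattice_minus by blast
qed

text \<open>The zeros of \<open>q_exp\<close> fill only half of a spiral, but \<open>n\<close> runs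
  over all integers, so some dilate meets a zero as soon as the point lies on the full
  spiral.\<close>

lemma q_exp_pole_iff:
  assumes q: "q > 1"
  shows "(\<exists>n::int. q_exp q (of_real q powi n * (of_real q * exp w)) = 0) \<longleftrightarrow>
    w + of_real (ln (1 - 1 / q)) + of_real pi * \<i> \<in> log_lattice q"
proof -
  \<comment> \<open>The zeros of \<open>q_exp\<close> are known in terms of
    \<open>(q - 1) y\<close>, and \<open>y\<close> carries a factor \<open>q\<close>; here
    \<open>(q - 1) q = (1 - 1 / q) q^2\<close>. The square becomes the shift \<open>n + 2\<close>
    below.\<close>
  have lnq: "ln (q - 1) + ln q = ln (1 - 1 / q) + 2 * ln q"
  proof -
    have "1 - 1 / q = (q - 1) / q" using q by (simp add: field_simps)
    then show ?thesis using q by (simp add: ln_div)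
  qed
  have e: "of_real (q - 1) * (of_real q powi n * (of_real q * exp w)) =
      - exp (w + of_real (ln (1 - 1 / q)) + of_real pi * \<i> + of_int (n + 2) * of_real (ln q))" for n
  proof -
    have "of_real (q - 1) * (of_real q powi n * (of_real q * exp w)) =
       exp (of_real (ln (q - 1))) * (exp (of_int n * of_real (ln q)) * (exp (of_real (ln q)) * exp w))"
      using q exp_power_int[of "complex_of_real (ln q)" n] by (simp add: exp_of_real)
    also have "\<dots> = exp (w + of_real (ln (q - 1) + ln q) + of_int n * of_real (ln q))"
      by (simp add: exp_add mult_ac)
    also have "\<dots> = - exp (w + of_real (ln (q - 1) + ln q) + of_int n * of_real (ln q) + of_real pi * \<i>)"
      by (simp add: exp_add)
    also have "w + of_real (ln (q - 1) + ln q) + of_int n * of_real (ln q) + of_real pi * \<i> =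
      w + of_real (ln (1 - 1 / q)) + of_real pi * \<i> + of_int (n + 2) * of_real (ln q)"
      unfolding lnq by (simp add: algebra_simps)
    finally show ?thesis .
  qed
  let ?v = "w + of_real (ln (1 - 1 / q)) + of_real pi * \<i>"
  have z: "q_exp q (of_real q powi n * (of_real q * exp w)) = 0 \<longleftrightarrow>
     (\<exists>k::nat. exp (?v + of_int (n + 2) * of_real (ln q)) = of_real q powi (int k + 1))" for n
    unfolding q_exp_eq_0_iff[OF q] e
    by (simp add: power_int_add power_int_of_nat q[THEN less_imp_neq, symmetric] del: of_int_add)
       (use q in \<open>auto simp: mult.commute\<close>)
  have lat: "of_int m * of_real (ln q) \<in> log_lattice q" for m
    using log_latticeI[of m q 0] by simp
  show ?thesis
  proof
    assume "\<exists>n::int. q_exp q (of_real q powi n * (of_real q * exp w)) = 0"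
    then obtain n :: int where "?v + of_int (n + 2) * of_real (ln q) \<in> log_lattice q"
      unfolding z using exp_eq_powi_iff[OF q] by blast
    then show "?v \<in> log_lattice q" using log_lattice_add_iff[OF lat] by blast
  next
    assume "?v \<in> log_lattice q"
    then obtain m :: int where m: "exp ?v = of_real q powi m" using exp_eq_powi_iff[OF q] by blast
    \<comment> \<open>The index \<open>- m - 1\<close> aims at the first zero, \<open>k = 0\<close>:
      the exponents add up to \<open>(- m + 1) + m = 1\<close>.\<close>
    have "exp (?v + of_int (- m - 1 + 2) * of_real (ln q)) = of_real q powi (- m + 1) * exp ?v"
      using exp_mult_powi[of q "- m + 1" ?v] q by simp
    also have "\<dots> = of_real q powi (int 0 + 1)"
      unfolding m using q by (simp flip: power_int_add)
    finally have "q_exp q (of_real q powi (- m - 1) * (of_real q * exp w)) = 0" unfolding z by blast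
    then show "\<exists>n::int. q_exp q (of_real q powi n * (of_real q * exp w)) = 0" by blast
  qed
qed

lemma jackson_regular_exp:
  assumes q: "q > 1"
  shows "jackson_regular q (exp u) (of_real q * exp w) \<longleftrightarrow> u + of_real pi * \<i> \<notin> log_lattice q \<and>
    w + of_real (ln (1 - 1 / q)) + of_real pi * \<i> \<notin> log_lattice q"
proof -
  have "exp u \<noteq> 0" "of_real q * exp w \<noteq> 0" using q by auto
  then show ?thesis
    unfolding jackson_regular_def using psi_pole_iff[OF q, of u] q_exp_pole_iff[OF q, of w] by blast
qed

lemma isCont_q_exp: "q > 1 \<Longrightarrow> isCont (q_exp q) y"
  using holomorphic_on_imp_continuous_on[OF q_exp_holomorphic[of q UNIV]]
  by (simp add: continuous_on_eq_continuous_at)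

text \<open>The value of the limit is left open; in the end it is forced by the
  quasi-periods.\<close>

lemma jackson_term_lim_q_exp_zero:
  assumes q: "q > 1" and X: "isCont X w" and Y: "(Y has_field_derivative D) (at w)" "D \<noteq> 0"
    and nz: "1 + of_real q powi n * X w \<noteq> 0"
  shows "\<exists>b. ((\<lambda>z. (z - w) * jackson_term q (X z) (Y z) n) \<longlongrightarrow> b) (at w)"
proof -
  let ?A = "\<lambda>z. of_real q powi n * X z / (1 + of_real q powi n * X z)"
  have A: "(?A \<longlongrightarrow> ?A w) (at w)"
    using X nz by (intro tendsto_intros) (auto simp: isCont_def)
  have "\<exists>b. ((\<lambda>z. (z - w) / q_exp q (of_real q powi n * Y z)) \<longlongrightarrow> b) (at w)"
  proof (cases "q_exp q (of_real q powi n * Y w) = 0")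
    case True
    have "((\<lambda>z. q_exp q (of_real q powi n * Y z)) has_field_derivative
        deriv (q_exp q) (of_real q powi n * Y w) * (of_real q powi n * D)) (at w)"
      by (rule DERIV_chain2[where f = "q_exp q" and g = "\<lambda>z. of_real q powi n * Y z",
            OF holomorphic_derivI[OF q_exp_holomorphic[OF q, of UNIV]]])
        (auto intro!: DERIV_cmult Y)
    from tendsto_div_simple_zero[OF this True] q_exp_simple_zero[OF q True] Y(2) q
    show ?thesis by auto
  next
    case False
    have "isCont (\<lambda>z. q_exp q (of_real q powi n * Y z)) w"
      by (rule isCont_o2[OF _ isCont_q_exp[OF q]]) (use DERIV_isCont[OF Y(1)] in \<open>auto intro!: continuous_intros\<close>)
    then have "((\<lambda>z. (z - w) / q_exp q (of_real q powi n * Y z)) \<longlongrightarrow> (w - w) / q_exp q (of_real q powi n * Y w)) (at w)"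
      using False by (intro tendsto_intros) (auto simp: isCont_def)
    then show ?thesis by blast
  qed
  then obtain b where "((\<lambda>z. (z - w) / q_exp q (of_real q powi n * Y z)) \<longlongrightarrow> b) (at w)" by blast
  from tendsto_mult[OF this A] show ?thesis by (auto simp: jackson_term_def mult_ac)
qed

text \<open>In the logarithmic variable the derivative of \<open>1 + q^n exp z\<close> is
  \<open>q^n exp z\<close>, which cancels the numerator of the term; so the residue at a pole is
  just the reciprocal of \<open>q_exp\<close>.\<close>

lemma jackson_term_lim_psi_pole:
  assumes q: "q > 1" and Y: "isCont Y w" and nz: "q_exp q (of_real q powi n * Y w) \<noteq> 0"
  shows "((\<lambda>z. (z - w) * jackson_term q (exp z) (Y z) n) \<longlongrightarrow>
    (if 1 + of_real q powi n * exp w = 0 then 1 / q_exp q (of_real q powi n * Y w) else 0)) (at w)"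
proof -
  let ?e = "\<lambda>z. q_exp q (of_real q powi n * Y z)"
  have "isCont ?e w"
    by (rule isCont_o2[OF _ isCont_q_exp[OF q]]) (use Y in \<open>auto intro!: continuous_intros\<close>)
  then have e: "((\<lambda>z. of_real q powi n * exp z / ?e z) \<longlongrightarrow> of_real q powi n * exp w / ?e w) (at w)"
    using nz by (intro tendsto_intros) (auto simp: isCont_def)
  have d: "((\<lambda>z. 1 + of_real q powi n * exp z) has_field_derivative of_real q powi n * exp w) (at w)"
    by (auto intro!: derivative_eq_intros)
  have q0: "of_real q powi n \<noteq> (0 :: complex)" using q by simp
  have "((\<lambda>z. (z - w) / (1 + of_real q powi n * exp z)) \<longlongrightarrow>
    (if 1 + of_real q powi n * exp w = 0 then 1 / (of_real q powi n * exp w) else 0)) (at w)"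
  proof (cases "1 + of_real q powi n * exp w = 0")
    case True
    from tendsto_div_simple_zero[OF d True] q0 True show ?thesis by simp
  next
    case False
    have "((\<lambda>z. (z - w) / (1 + of_real q powi n * exp z)) \<longlongrightarrow> (w - w) / (1 + of_real q powi n * exp w)) (at w)"
      using False by (intro tendsto_intros)
    with False show ?thesis by simp
  qed
  from tendsto_mult[OF this e]
  have "((\<lambda>z. (z - w) * jackson_term q (exp z) (Y z) n) \<longlongrightarrow>
      (if 1 + of_real q powi n * exp w = 0 then 1 / (of_real q powi n * exp w) else 0) *
      (of_real q powi n * exp w / ?e w)) (at w)"
    by (simp add: jackson_term_def mult_ac)
  then show ?thesis using q0 by (simp split: if_splits)
qed

lemma jackson_series_exp_holomorphic:
  assumes q: "q > 1" and S: "open S"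
    and reg: "\<And>u. u \<in> S \<Longrightarrow> jackson_regular q (exp u) (of_real q * exp (u - t))"
  shows "(\<lambda>u. jackson_series q (exp u) (of_real q * exp (u - t))) holomorphic_on S"
  by (rule jackson_series_holomorphic[OF q S _ _ reg]) (auto intro!: holomorphic_intros)

lemma tendsto_of_holomorphic_extension:
  assumes "r > 0" "G holomorphic_on ball u r" "\<And>z. z \<in> ball u r - {u} \<Longrightarrow> G z = f z"
  shows "(f \<longlongrightarrow> G u) (at u)"
proof (rule Lim_transform_eventually)
  show "(G \<longlongrightarrow> G u) (at u)"
    using holomorphic_on_imp_continuous_on[OF assms(2)] assms(1)
    by (metis centre_in_ball continuous_on_eq_continuous_at isCont_def open_ball)
  have "\<forall>\<^sub>F z in at u. z \<in> ball u r - {u}" by (rule eventually_at_in_open) (use assms in auto)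
  then show "\<forall>\<^sub>F z in at u. G z = f z" by eventually_elim (rule assms(3))
qed

text \<open>Only the index \<open>k\<close> with \<open>q^k exp u = - 1\<close> contributes, and for
  it \<open>q_exp\<close> is taken at \<open>- q / exp t\<close>. This is the origin of the factor
  \<open>1 / q_exp q (- q / x)\<close> in the identity.\<close>

lemma jackson_series_exp_residue:
  assumes q: "q > 1" and u: "u + of_real pi * \<i> \<in> log_lattice q"
    and nz: "u - t + of_real (ln (1 - 1 / q)) + of_real pi * \<i> \<notin> log_lattice q"
  shows "((\<lambda>z. (z - u) * jackson_series q (exp z) (of_real q * exp (z - t))) \<longlongrightarrow>
    1 / q_exp q (- of_real q / exp t)) (at u)"
proof -
  let ?c = "of_real (ln (1 - 1 / q)) + of_real pi * \<i>"
  obtain r1 where r1: "r1 > 0" "\<And>z. z \<in> ball u r1 - {u} \<Longrightarrow> z - (- (of_real pi * \<i>)) \<notin> log_lattice q"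
    using log_lattice_isolated[OF q] by blast
  obtain r2 where r2: "r2 > 0" "\<And>z. z \<in> ball u r2 - {u} \<Longrightarrow> z - (t - ?c) \<notin> log_lattice q"
    using log_lattice_isolated[OF q] by blast
  define r where "r = min r1 r2"
  have r: "r > 0" using r1 r2 by (simp add: r_def)
  have reg: "jackson_regular q (exp z) (of_real q * exp (z - t))" if "z \<in> ball u r - {u}" for z
    unfolding jackson_regular_exp[OF q] using r1(2)[of z] r2(2)[of z] that by (simp add: r_def algebra_simps)
  have nz': "q_exp q (of_real q powi n * (of_real q * exp (u - t))) \<noteq> 0" for n
    using nz q_exp_pole_iff[OF q, of "u - t"] by blast
  obtain k :: int where k: "1 + of_real q powi k * exp u = 0" using psi_pole_iff[OF q] u by blast
  have k': "1 + of_real q powi n * exp u = 0 \<longleftrightarrow> n = k" for n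
  proof
    assume "1 + of_real q powi n * exp u = 0"
    then have "of_real q powi n * exp u = of_real q powi k * exp u" using k by (metis add_left_cancel)
    then have "complex_of_real (q powi n) = of_real (q powi k)" by simp
    then have "q powi n = q powi k" unfolding of_real_eq_iff .
    then show "n = k" using power_int_strict_increasing[of _ _ q] q by (metis less_irrefl linorder_cases)
  qed (use k in simp)
  define b where "b = (\<lambda>n. if 1 + of_real q powi n * exp u = 0 then 1 / q_exp q (of_real q powi n * (of_real q * exp (u - t))) else 0)"
  have lim: "((\<lambda>z. (z - u) * jackson_term q (exp z) (of_real q * exp (z - t)) n) \<longlongrightarrow> b n) (at u)" for n
    unfolding b_def
    by (rule jackson_term_lim_psi_pole[OF q, where Y = "\<lambda>z. of_real q * exp (z - t)"])
      (use nz' in \<open>auto intro!: continuous_intros\<close>)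
  obtain G where G: "G holomorphic_on ball u r"
    "\<And>z. z \<in> ball u r - {u} \<Longrightarrow> G z = (z - u) * jackson_series q (exp z) (of_real q * exp (z - t))"
    "G u = infsum b UNIV"
    by (rule jackson_series_simple_pole[OF q r _ _ reg lim])
      (auto intro!: holomorphic_intros)
  have "infsum b UNIV = infsum b {k}"
    by (rule infsum_cong_neutral) (auto simp: b_def k')
  also have "\<dots> = 1 / q_exp q (- of_real q / exp t)"
  proof -
    have "of_real q powi k * (of_real q * exp (u - t)) = (of_real q powi k * exp u) * of_real q / exp t"
      by (simp add: exp_diff)
    also have "of_real q powi k * exp u = - 1" using k by (metis add.commute eq_neg_iff_add_eq_0)
    finally show ?thesis using k by (simp add: b_def)
  qed
  finally show ?thesis using tendsto_of_holomorphic_extension[OF r G(1,2)] G(3) by simp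
qed

text \<open>At such a point infinitely many terms can be singular at once, since the zeros of
  \<open>q_exp\<close> fill half a spiral; the residue is then an infinite sum, of which only the
  existence is recorded.\<close>

lemma jackson_series_exp_pole:
  assumes q: "q > 1" and u: "u + of_real pi * \<i> \<notin> log_lattice q"
  shows "\<exists>l. ((\<lambda>z. (z - u) * jackson_series q (exp z) (of_real q * exp (z - t))) \<longlongrightarrow> l) (at u)"
proof -
  let ?c = "of_real (ln (1 - 1 / q)) + of_real pi * \<i>"
  obtain r1 where r1: "r1 > 0" "\<And>z. z \<in> ball u r1 - {u} \<Longrightarrow> z - (- (of_real pi * \<i>)) \<notin> log_lattice q"
    using log_lattice_isolated[OF q] by blast
  obtain r2 where r2: "r2 > 0" "\<And>z. z \<in> ball u r2 - {u} \<Longrightarrow> z - (t - ?c) \<notin> log_lattice q"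
    using log_lattice_isolated[OF q] by blast
  define r where "r = min r1 r2"
  have r: "r > 0" using r1 r2 by (simp add: r_def)
  have reg: "jackson_regular q (exp z) (of_real q * exp (z - t))" if "z \<in> ball u r - {u}" for z
    unfolding jackson_regular_exp[OF q] using r1(2)[of z] r2(2)[of z] that by (simp add: r_def algebra_simps)
  have nz: "1 + of_real q powi n * exp u \<noteq> 0" for n using psi_pole_iff[OF q] u by blast
  have "\<exists>b. ((\<lambda>z. (z - u) * jackson_term q (exp z) (of_real q * exp (z - t)) n) \<longlongrightarrow> b) (at u)" for n
    by (rule jackson_term_lim_q_exp_zero[where X = exp and Y = "\<lambda>z. of_real q * exp (z - t)" and D = "of_real q * exp (u - t)", OF q _ _ _ nz])
      (use q in \<open>auto intro!: derivative_eq_intros\<close>)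
  then obtain b where lim: "\<And>n. ((\<lambda>z. (z - u) * jackson_term q (exp z) (of_real q * exp (z - t)) n) \<longlongrightarrow> b n) (at u)"
    by metis
  obtain G where G: "G holomorphic_on ball u r"
    "\<And>z. z \<in> ball u r - {u} \<Longrightarrow> G z = (z - u) * jackson_series q (exp z) (of_real q * exp (z - t))"
    by (rule jackson_series_simple_pole[OF q r _ _ reg lim])
      (auto intro!: holomorphic_intros)
  show ?thesis using tendsto_of_holomorphic_extension[OF r G] by blast
qed

text \<open>The base point is now fixed and \<open>x = exp t\<close> moves: this is the Jackson part
  of the function that continues the ray integrals to the whole Riemann surface.\<close>

lemma jackson_series_meromorphic:
  assumes q: "q > 1" and v: "v + of_real pi * \<i> \<notin> log_lattice q"
  shows "(\<lambda>t. jackson_series q (exp v) (of_real q * exp (v - t))) meromorphic_on UNIV"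
proof (subst meromorphic_on_meromorphic_at, intro ballI)
  fix t
  let ?c = "of_real (ln (1 - 1 / q)) + of_real pi * \<i>"
  obtain r where r: "r > 0" "\<And>z. z \<in> ball t r - {t} \<Longrightarrow> z - (v + ?c) \<notin> log_lattice q"
    using log_lattice_isolated[OF q] by blast
  have reg: "jackson_regular q (exp v) (of_real q * exp (v - z))" if "z \<in> ball t r - {t}" for z
  proof -
    have "v - z + of_real (ln (1 - 1 / q)) + of_real pi * \<i> = (v + ?c) - z" by simp
    then show ?thesis
      unfolding jackson_regular_exp[OF q] using v r(2)[OF that] log_lattice_minus_commute by metis
  qed
  have nz: "1 + of_real q powi n * exp v \<noteq> 0" for n using psi_pole_iff[OF q] v by blast
  have "\<exists>b. ((\<lambda>z. (z - t) * jackson_term q (exp v) (of_real q * exp (v - z)) n) \<longlongrightarrow> b) (at t)" for n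
    by (rule jackson_term_lim_q_exp_zero[where X = "\<lambda>_. exp v" and Y = "\<lambda>z. of_real q * exp (v - z)" and D = "- of_real q * exp (v - t)", OF q _ _ _ nz])
      (use q in \<open>auto intro!: derivative_eq_intros\<close>)
  then obtain b where lim: "\<And>n. ((\<lambda>z. (z - t) * jackson_term q (exp v) (of_real q * exp (v - z)) n) \<longlongrightarrow> b n) (at t)"
    by metis
  obtain G where G: "G holomorphic_on ball t r"
    "\<And>z. z \<in> ball t r - {t} \<Longrightarrow> G z = (z - t) * jackson_series q (exp v) (of_real q * exp (v - z))"
    by (rule jackson_series_simple_pole[OF q r(1) _ _ reg lim])
      (auto intro!: holomorphic_intros)
  have "G analytic_on {t}" using G(1) r(1) by (meson analytic_at centre_in_ball open_ball)
  then have "(\<lambda>z. G z / (z - t)) meromorphic_on {t}"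
    by (intro meromorphic_intros analytic_on_imp_meromorphic_on) (auto intro!: analytic_intros)
  moreover have "\<forall>\<^sub>F z in at t. G z / (z - t) = jackson_series q (exp v) (of_real q * exp (v - z))"
  proof -
    have "\<forall>\<^sub>F z in at t. z \<in> ball t r - {t}" by (rule eventually_at_in_open) (use r in auto)
    then show ?thesis by eventually_elim (auto simp: G(2))
  qed
  then have "(\<lambda>z. G z / (z - t)) meromorphic_on {t} \<longleftrightarrow>
      (\<lambda>z. jackson_series q (exp v) (of_real q * exp (v - z))) meromorphic_on {t}"
    by (intro meromorphic_on_cong) auto
  ultimately show "(\<lambda>t. jackson_series q (exp v) (of_real q * exp (v - t))) meromorphic_on {t}" by blast
qed

lemma tendsto_times_shift:
  fixes f :: "complex \<Rightarrow> complex"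
  assumes "((\<lambda>z. (z - u) * f z) \<longlongrightarrow> l) (at u)" "\<And>z. f (z + a) = f z"
  shows "((\<lambda>z. (z - (u + a)) * f z) \<longlongrightarrow> l) (at (u + a))"
proof -
  have "((\<lambda>h. h * f (u + h)) \<longlongrightarrow> l) (at 0)"
    using assms(1) by (simp add: LIM_offset_zero_iff[of u])
  moreover have "f (u + a + h) = f (u + h)" for h using assms(2)[of "u + h"] by (simp add: ac_simps)
  ultimately show ?thesis
    by (subst LIM_offset_zero_iff[of "u + a"]) simp_all
qed

text \<open>The base point enters \<open>L_fun\<close> through its parameter, so with
  \<open>u\<close> as the variable the argument of \<open>L_log\<close> is reflected and the residue
  changes sign.\<close>

lemma L_log_reflect_simple_pole:
  assumes q: "q > 1"
  shows "((\<lambda>z. (z - u) * L_log q (a - z)) \<longlongrightarrow>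
    (if a - u \<in> log_lattice q then - \<i> * of_real (ln q / (2 * pi)) else 0)) (at u)"
proof -
  have f: "filterlim (\<lambda>z. a - z) (at (a - u)) (at u)"
    by (rule filterlim_atI) (auto intro!: tendsto_intros simp: eventually_at_filter)
  have "((\<lambda>z. - ((a - z - (a - u)) * L_log q (a - z))) \<longlongrightarrow>
      - (if a - u \<in> log_lattice q then \<i> * of_real (ln q / (2 * pi)) else 0)) (at u)"
    by (intro tendsto_minus filterlim_compose[OF _ f]) (use L_log_simple_pole[OF q] in auto)
  then show ?thesis by (auto simp: algebra_simps split: if_splits)
qed

lemma L_log_reflect_analytic:
  assumes q: "q > 1"
  shows "(\<lambda>z. L_log q (a - z)) analytic_on {z. a - z \<notin> log_lattice q}"
proof -
  have "open {z. a - z \<notin> log_lattice q}"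
  proof -
    have "open ((\<lambda>z. a - z) -` (- log_lattice q))"
      using log_lattice_closed[OF q] by (intro open_vimage) (auto intro!: continuous_intros)
    then show ?thesis by (simp add: vimage_def)
  qed
  moreover have "(\<lambda>z. L_log q (a - z)) holomorphic_on {z. a - z \<notin> log_lattice q}"
    by (rule holomorphic_on_compose_gen[OF _ L_log_holomorphic[OF q, of "- log_lattice q"], unfolded o_def])
      (auto intro!: holomorphic_intros)
  ultimately show ?thesis by (simp add: analytic_on_open)
qed

lemma jackson_series_exp_analytic:
  assumes q: "q > 1"
  shows "(\<lambda>u. jackson_series q (exp u) (of_real q * exp (u - t))) analytic_on
    {u. - (of_real pi * \<i>) - u \<notin> log_lattice q \<and> t - of_real (ln (1 - 1 / q)) - of_real pi * \<i> - u \<notin> log_lattice q}"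
proof -
  let ?S = "{u. - (of_real pi * \<i>) - u \<notin> log_lattice q \<and> t - of_real (ln (1 - 1 / q)) - of_real pi * \<i> - u \<notin> log_lattice q}"
  have "open ((\<lambda>z. a - z) -` (- log_lattice q))" for a
    using log_lattice_closed[OF q] by (intro open_vimage) (auto intro!: continuous_intros)
  then have "open ((\<lambda>z. - (of_real pi * \<i>) - z) -` (- log_lattice q) \<inter> (\<lambda>z. t - of_real (ln (1 - 1 / q)) - of_real pi * \<i> - z) -` (- log_lattice q))"
    by blast
  also have "\<dots> = ?S" by auto
  finally have S: "open ?S" .
  have "jackson_regular q (exp u) (of_real q * exp (u - t))" if "u \<in> ?S" for u
  proof -
    have "u + of_real pi * \<i> = u - (- (of_real pi * \<i>))"
      "u - t + of_real (ln (1 - 1 / q)) + of_real pi * \<i> = u - (t - of_real (ln (1 - 1 / q)) - of_real pi * \<i>)"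
      by simp_all
    moreover have "u - (- (of_real pi * \<i>)) \<notin> log_lattice q"
      "u - (t - of_real (ln (1 - 1 / q)) - of_real pi * \<i>) \<notin> log_lattice q"
      using that log_lattice_minus_commute by blast+
    ultimately show ?thesis unfolding jackson_regular_exp[OF q] by metis
  qed
  from jackson_series_exp_holomorphic[OF q S this] show ?thesis by (simp add: analytic_on_open[OF S])
qed

text \<open>
  As functions of the logarithm \<open>u\<close> of the base point of the spiral both sides of the identity
  are elliptic with the same two classes of simple poles.  The coefficients of the two translates
  of \<open>L_log q\<close> are fixed by the residues; they agree since a doubly quasi-periodic entire function
  is constant.
\<close>

lemma jackson_series_plus_L_log_constant:
  assumes q: "q > 1" and t: "t - of_real (ln (1 - 1 / q)) \<notin> log_lattice q"
  defines "a \<equiv> t - of_real (ln (1 - 1 / q)) - of_real pi * \<i>" and "b \<equiv> - (of_real pi * \<i>)"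
  defines "B \<equiv> 2 * of_real pi * \<i> * of_real ((q - 1) / ln q) * inverse (q_exp q (- of_real q / exp t))"
  shows "\<exists>k. \<forall>u. a - u \<notin> log_lattice q \<longrightarrow> b - u \<notin> log_lattice q \<longrightarrow>
    of_real (q - 1) * jackson_series q (exp u) (of_real q * exp (u - t)) + B * (L_log q (a - u) - L_log q (b - u)) = k"
proof -
  define J where "J = (\<lambda>u. jackson_series q (exp u) (of_real q * exp (u - t)))"
  \<comment> \<open>Residue of each reflected translate \<open>L_log q (d - u)\<close> at its
    poles.\<close>
  define c where "c = - \<i> * of_real (ln q / (2 * pi))"
  have c0: "c \<noteq> 0" using q by (simp add: c_def)
  have J1: "J (u + of_real (ln q)) = J u" for u
  proof -
    have "exp (u + of_real (ln q)) = of_real q * exp u"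
      "exp (u + of_real (ln q) - t) = of_real q * exp (u - t)"
      using q by (simp_all add: exp_add exp_diff exp_of_real)
    then show ?thesis unfolding J_def using jackson_series_mult_q[OF q, of "exp u" "of_real q * exp (u - t)"] by simp
  qed
  have J2: "J (u + of_real (2 * pi) * \<i>) = J u" for u
    by (simp add: J_def exp_add exp_diff mult_ac)
  have J1': "J (u + of_int m * of_real (ln q)) = J u" for u m
  proof (induction m rule: int_induct[of _ 0])
    case (step1 i) then show ?case using J1[of "u + of_int i * of_real (ln q)"] by (simp add: algebra_simps)
  next
    case (step2 i) then show ?case using J1[of "u + of_int (i - 1) * of_real (ln q)"] by (simp add: algebra_simps)
  qed simp
  have J2': "J (u + of_int m * (of_real (2 * pi) * \<i>)) = J u" for u m
  proof (induction m rule: int_induct[of _ 0])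
    case (step1 i) then show ?case using J2[of "u + of_int i * (of_real (2 * pi) * \<i>)"] by (simp add: algebra_simps)
  next
    case (step2 i) then show ?case using J2[of "u + of_int (i - 1) * (of_real (2 * pi) * \<i>)"] by (simp add: algebra_simps)
  qed simp
  have Jlat: "J (u + v) = J u" if "v \<in> log_lattice q" for u v
    using that J1' J2' unfolding log_lattice_def by (auto simp: add.assoc[symmetric])
  \<comment> \<open>The difference \<open>a - b = t - ln (1 - 1 / q)\<close> is off the lattice by
    assumption, so the two classes of poles are disjoint.\<close>
  have not_both: "\<not> (a - u \<in> log_lattice q \<and> b - u \<in> log_lattice q)" for u
    using log_lattice_diff[of "a - u" q "b - u"] t by (auto simp: a_def b_def)
  have bu: "b - u \<in> log_lattice q \<longleftrightarrow> u + of_real pi * \<i> \<in> log_lattice q" for u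
    using log_lattice_minus_commute[of b u] by (simp add: b_def)
  have au: "a - u \<in> log_lattice q \<longleftrightarrow> u - t + of_real (ln (1 - 1 / q)) + of_real pi * \<i> \<in> log_lattice q" for u
    using log_lattice_minus_commute[of a u q] by (simp add: a_def algebra_simps)
  have Jb: "((\<lambda>z. (z - u) * J z) \<longlongrightarrow> 1 / q_exp q (- of_real q / exp t)) (at u)" if "b - u \<in> log_lattice q" for u
    unfolding J_def using that not_both[of u] by (intro jackson_series_exp_residue[OF q]) (auto simp: au bu)
  have "b - a \<notin> log_lattice q" using not_both[of a] by (auto simp: log_lattice_0)
  \<comment> \<open>The unknown residue at \<open>a\<close> is carried to the whole class by the
    periods of \<open>J\<close>.\<close>
  then obtain l where l: "((\<lambda>z. (z - a) * J z) \<longlongrightarrow> l) (at a)"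
    using jackson_series_exp_pole[OF q, of a t] unfolding J_def bu by blast
  have Ja: "((\<lambda>z. (z - u) * J z) \<longlongrightarrow> l) (at u)" if "a - u \<in> log_lattice q" for u
  proof -
    have "u - a \<in> log_lattice q" using that log_lattice_minus_commute by blast
    then show ?thesis using tendsto_times_shift[OF l, of "u - a"] Jlat by simp
  qed
  have Jan: "J analytic_on {u. b - u \<notin> log_lattice q \<and> a - u \<notin> log_lattice q}"
    unfolding J_def a_def b_def by (rule jackson_series_exp_analytic[OF q])
  have J0: "((\<lambda>z. (z - u) * J z) \<longlongrightarrow> 0) (at u)" if "a - u \<notin> log_lattice q" "b - u \<notin> log_lattice q" for u
  proof -
    have "J analytic_on {u}" by (rule analytic_on_subset[OF Jan]) (use that in auto)
    then have "((\<lambda>z. (z - u) * J z) \<longlongrightarrow> (u - u) * J u) (at u)"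
      by (intro tendsto_intros) (use analytic_at_imp_isCont in \<open>auto simp: isCont_def\<close>)
    then show ?thesis by simp
  qed
  \<comment> \<open>\<open>A\<close> is chosen to cancel the poles at the class of \<open>a\<close>.
    The given \<open>B\<close> cancels those at the class of \<open>b\<close>, where the residue is
    known; that the two coefficients agree is only a consequence of the quasi-periods.\<close>
  define A where "A = - of_real (q - 1) * l / c"
  define H where "H = (\<lambda>u. of_real (q - 1) * J u + A * L_log q (a - u) - B * L_log q (b - u))"
  have Bc: "B * c = of_real (q - 1) * (1 / q_exp q (- of_real q / exp t))"
  proof -
    have "2 * of_real pi * \<i> * of_real ((q - 1) / ln q) * c = of_real (q - 1)"
      using q by (simp add: c_def field_simps)
    moreover have "B * c = (2 * of_real pi * \<i> * of_real ((q - 1) / ln q) * c) * inverse (q_exp q (- of_real q / exp t))"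
      unfolding B_def by (simp only: ac_simps)
    ultimately show ?thesis by (simp only: inverse_eq_divide)
  qed
  have Han: "H analytic_on {u. b - u \<notin> log_lattice q \<and> a - u \<notin> log_lattice q}"
    unfolding H_def
    by (intro analytic_intros Jan analytic_on_subset[OF L_log_reflect_analytic[OF q]]) auto
  have sing: "isolated_singularity_at H u" for u
  proof -
    obtain r1 where r1: "r1 > 0" "\<And>z. z \<in> ball u r1 - {u} \<Longrightarrow> z - a \<notin> log_lattice q"
      using log_lattice_isolated[OF q] by blast
    obtain r2 where r2: "r2 > 0" "\<And>z. z \<in> ball u r2 - {u} \<Longrightarrow> z - b \<notin> log_lattice q"
      using log_lattice_isolated[OF q] by blast
    have "H analytic_on ball u (min r1 r2) - {u}"
      by (rule analytic_on_subset[OF Han]) (use r1(2) r2(2) log_lattice_minus_commute in fastforce)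
    then show ?thesis unfolding isolated_singularity_at_def using r1(1) r2(1) by (intro exI[of _ "min r1 r2"]) auto
  qed
  have lim: "((\<lambda>z. (z - u) * H z) \<longlongrightarrow> 0) (at u)" for u
  proof -
    define j where "j = (if a - u \<in> log_lattice q then l else if b - u \<in> log_lattice q then 1 / q_exp q (- of_real q / exp t) else 0)"
    have "((\<lambda>z. (z - u) * J z) \<longlongrightarrow> j) (at u)"
      unfolding j_def using Ja Jb J0 by simp
    moreover have "((\<lambda>z. (z - u) * L_log q (d - z)) \<longlongrightarrow> (if d - u \<in> log_lattice q then c else 0)) (at u)" for d
      unfolding c_def by (rule L_log_reflect_simple_pole[OF q])
    ultimately have "((\<lambda>z. of_real (q - 1) * ((z - u) * J z) + A * ((z - u) * L_log q (a - z)) - B * ((z - u) * L_log q (b - z))) \<longlongrightarrow>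
        of_real (q - 1) * j + A * (if a - u \<in> log_lattice q then c else 0) - B * (if b - u \<in> log_lattice q then c else 0)) (at u)"
      by (intro tendsto_intros)
    also have "(\<lambda>z. of_real (q - 1) * ((z - u) * J z) + A * ((z - u) * L_log q (a - z)) - B * ((z - u) * L_log q (b - z))) =
        (\<lambda>z. (z - u) * H z)"
      by (simp add: H_def fun_eq_iff algebra_simps)
    also have "of_real (q - 1) * j +
        A * (if a - u \<in> log_lattice q then c else 0) - B * (if b - u \<in> log_lattice q then c else 0) = 0"
    proof -
      have "A * c = - (of_real (q - 1) * l)" using c0 by (simp add: A_def del: of_real_diff)
      then show ?thesis using not_both[of u] Bc unfolding j_def
        by (cases "a - u \<in> log_lattice q"; cases "b - u \<in> log_lattice q") (simp_all del: of_real_diff)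
    qed
    finally show ?thesis .
  qed
  have p1: "H (z + of_real (ln q)) = H z" for z
  proof -
    have "L_log q (d - (z + of_real (ln q))) = L_log q (d - z)" for d
      using L_log_add_ln[OF q, of "d - (z + of_real (ln q))"] by simp
    then show ?thesis by (simp add: H_def J1)
  qed
  \<comment> \<open>A shift by \<open>2 pi i\<close> lowers each reflected \<open>L_log\<close> by
    1, so \<open>H\<close> gains \<open>B - A\<close>; as all its singularities are removable, this
    forces \<open>A = B\<close>.\<close>
  have p2: "H (z + of_real (2 * pi) * \<i>) = H z + (B - A)"
    if "z - a \<notin> log_lattice q" "z - b \<notin> log_lattice q" for z
  proof -
    have sh: "L_log q (d - (z + of_real (2 * pi) * \<i>)) = L_log q (d - z) - 1" if "z - d \<notin> log_lattice q" for d
    proof -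
      have "d - z \<notin> log_lattice q" using that log_lattice_minus_commute by blast
      then have "d - (z + of_real (2 * pi) * \<i>) \<notin> log_lattice q"
        using log_lattice_add_iff[OF log_lattice_2pi, of "d - (z + of_real (2 * pi) * \<i>)" q] by auto
      from L_log_add_2pi[OF q this] show ?thesis by simp
    qed
    show ?thesis unfolding H_def J2 sh[OF that(1)] sh[OF that(2)] by (simp add: algebra_simps)
  qed
  have "B - A = 0 \<and> (\<exists>k. \<forall>u. isCont H u \<longrightarrow> H u = k)"
  proof (rule quasi_periodic_constant[OF sing lim])
    show "ln q > 0" "2 * pi > 0" using q by auto
    show "\<forall>\<^sub>F z in at u. H (z + of_real (ln q)) = H z" for u using p1 by simp
    show "\<forall>\<^sub>F z in at u. H (z + of_real (2 * pi) * \<i>) = H z + (B - A)" for u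
      using eventually_not_log_lattice[OF q, where u = u and a = a] eventually_not_log_lattice[OF q, where u = u and a = b]
      by eventually_elim (rule p2)
  qed
  then obtain k where AB: "A = B" and k: "\<And>u. isCont H u \<Longrightarrow> H u = k" by auto
  have "H u = k" if "a - u \<notin> log_lattice q" "b - u \<notin> log_lattice q" for u
    by (rule k, rule analytic_at_imp_isCont, rule analytic_on_subset[OF Han]) (use that in auto)
  then show ?thesis
    by (intro exI[of _ k] allI impI) (simp add: H_def J_def AB right_diff_distrib add_diff_eq)
qed

section \<open>The integral along a ray\<close>

definition ray_integrand :: "real \<Rightarrow> real \<Rightarrow> complex \<Rightarrow> real \<Rightarrow> complex" where
  "ray_integrand q d s r = psi (of_real r * cis d) / q_exp q (of_real q * (of_real r * cis d) / exp s) * cis d"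

lemma not_in_log_lattice:
  assumes "0 < \<bar>Im v\<bar>" "\<bar>Im v\<bar> < 2 * pi"
  shows "v \<notin> log_lattice q"
proof
  assume "v \<in> log_lattice q"
  then obtain m n where "v = of_int m * of_real (ln q) + of_int n * (of_real (2 * pi) * \<i>)"
    by (auto simp: log_lattice_def)
  then have "\<bar>Im v\<bar> = \<bar>of_int n\<bar> * (2 * pi)" by (simp add: abs_mult)
  with assms have "0 * (2 * pi) < \<bar>of_int n\<bar> * (2 * pi)" "\<bar>of_int n\<bar> * (2 * pi) < 1 * (2 * pi)" by auto
  then have "0 < \<bar>of_int n :: real\<bar>" "\<bar>of_int n :: real\<bar> < 1"
    unfolding mult_less_cancel_right by auto
  then have "0 < \<bar>n\<bar>" "\<bar>n\<bar> < 1" by linarith+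
  then show False by linarith
qed

lemma of_real_cis: "v > 0 \<Longrightarrow> of_real v * cis d = exp (of_real (ln v) + of_real d * \<i>)"
  by (simp add: exp_add exp_of_real cis_conv_exp mult.commute)

text \<open>The imaginary parts that decide about poles are \<open>d + pi\<close> and
  \<open>d - Im s + pi\<close>; the two bounds put both strictly between 0 and \<open>2 pi\<close>,
  where the lattice has no row.\<close>

lemma jackson_regular_ray:
  assumes q: "q > 1" and v: "v > 0" and d: "\<bar>d\<bar> < pi" "\<bar>Im s - d\<bar> < pi"
  shows "jackson_regular q (of_real v * cis d) (of_real q * (of_real v * cis d) / exp s)"
proof -
  let ?u = "of_real (ln v) + of_real d * \<i>"
  have "jackson_regular q (exp ?u) (of_real q * exp (?u - s))"
    unfolding jackson_regular_exp[OF q] using d by (intro conjI not_in_log_lattice) auto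
  then show ?thesis unfolding of_real_cis[OF v] by (simp add: exp_diff)
qed

lemma scale_decomposition:
  assumes q: "q > 1" and r: "(r::real) > 0"
  obtains n :: int and v where "r = q powi n * v" "1 \<le> v" "v \<le> q"
proof -
  define n where "n = \<lfloor>log q r\<rfloor>"
  have p: "q powi k = q powr of_int k" for k using q by (simp add: powr_real_of_int')
  have "q powi n \<le> q powr (log q r)" unfolding p using q by (intro powr_mono) (auto simp: n_def)
  then have 1: "q powi n \<le> r" using q r by simp
  have "log q r \<le> of_int (n + 1)" unfolding n_def by linarith
  then have "q powr (log q r) \<le> q powi (n + 1)" unfolding p using q by (intro powr_mono) auto
  then have 2: "r \<le> q powi n * q" using q r by (simp add: power_int_add)
  have qn: "q powi n > 0" using q by simp
  show ?thesis
    by (rule that[of n "r / q powi n"]) (use 1 2 qn in \<open>auto simp: field_simps\<close>)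
qed

text \<open>Substituting \<open>r = q^n v\<close> turns the piece of the ray over
  \<open>[q^n, q^(n + 1)]\<close> into a Jackson term integrated over \<open>[1, q]\<close> against
  \<open>dv / v\<close>.\<close>

lemma ray_integrand_scale:
  assumes "q > 1" and "v > 0"
  shows "of_real (q powi n) * ray_integrand q d s (q powi n * v) =
    jackson_term q (of_real v * cis d) (of_real q * (of_real v * cis d) / exp s) n / of_real v"
  using assms by (simp add: ray_integrand_def jackson_term_def psi_def mult_ac)

text \<open>Compactness of \<open>[1, q]\<close> times a disc around \<open>t\<close>, combined with
  the two spiral bounds, gives a majorant that is uniform in \<open>s\<close>; integrability and
  continuity in \<open>s\<close> rest on it.\<close>

lemma ray_integrand_bound:
  assumes q: "q > 1" and d: "\<bar>d\<bar> < pi" "\<bar>Im t - d\<bar> < pi"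
  obtains \<epsilon> C where "\<epsilon> > 0" "\<And>s. s \<in> cball t \<epsilon> \<Longrightarrow> \<bar>Im s - d\<bar> < pi"
    "\<And>s r. s \<in> cball t \<epsilon> \<Longrightarrow> r > 0 \<Longrightarrow> norm (ray_integrand q d s r) \<le> C * inverse (1 + r\<^sup>2)"
proof -
  \<comment> \<open>Half the distance from \<open>Im t\<close> to the edge of the strip of the
    ray.\<close>
  define \<epsilon> where "\<epsilon> = (pi - \<bar>Im t - d\<bar>) / 2"
  have \<epsilon>: "\<epsilon> > 0" using d by (simp add: \<epsilon>_def)
  have im: "\<bar>Im s - d\<bar> < pi" if "s \<in> cball t \<epsilon>" for s
  proof -
    have "\<bar>Im (s - t)\<bar> \<le> \<epsilon>" using abs_Im_le_cmod[of "s - t"] that by (simp add: dist_norm norm_minus_commute)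
    then show ?thesis using \<epsilon> unfolding \<epsilon>_def by (simp add: field_simps abs_if split: if_splits)
  qed
  define X where "X = (\<lambda>v. of_real v * cis d)"
  define Y where "Y = (\<lambda>(v, s). of_real q * (of_real v * cis d) / exp s)"
  have reg: "jackson_regular q (X v) (Y (v, s))" if "v \<in> {1..q}" "s \<in> cball t \<epsilon>" for v s
    unfolding X_def Y_def using jackson_regular_ray[OF q _ d(1) im[OF that(2)], of v] that(1) by simp
  have KX: "compact (X ` {1..q})" "0 \<notin> X ` {1..q}"
    by (auto intro!: compact_continuous_image continuous_intros simp: X_def)
  have KY: "compact (Y ` ({1..q} \<times> cball t \<epsilon>))" "0 \<notin> Y ` ({1..q} \<times> cball t \<epsilon>)"
    unfolding Y_def case_prod_beta using q
    by (auto intro!: compact_continuous_image continuous_intros compact_Times)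
  obtain C1 where C1: "\<And>y n. y \<in> X ` {1..q} \<Longrightarrow> norm (1 / (1 + of_real q powi n * y)) \<le> C1"
  proof (rule one_plus_spiral_bound[OF q KX])
    fix y and n :: int assume "y \<in> X ` {1..q}"
    then show "1 + of_real q powi n * y \<noteq> 0" using reg[of _ t] \<epsilon> by (auto simp: jackson_regular_def)
  qed blast
  obtain C2 where C2: "\<And>y n. y \<in> Y ` ({1..q} \<times> cball t \<epsilon>) \<Longrightarrow>
      norm (1 / q_exp q (of_real q powi n * y)) * (1 + (q powi n) ^ 2) \<le> C2"
  proof (rule q_exp_spiral_bound[OF q KY])
    fix y and n :: int assume "y \<in> Y ` ({1..q} \<times> cball t \<epsilon>)"
    then show "q_exp q (of_real q powi n * y) \<noteq> 0" using reg by (auto simp: jackson_regular_def)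
  qed blast
  show ?thesis
  proof (rule that[OF \<epsilon> im])
    fix s r assume s: "s \<in> cball t \<epsilon>" and r: "(r::real) > 0"
    obtain n v where nv: "r = q powi n * v" "1 \<le> v" "v \<le> q" using scale_decomposition[OF q r] by blast
    define w where "w = (q powi n) ^ 2"
    have w: "w > 0" using q by (simp add: w_def)
    have c1: "norm (1 / (1 + of_real q powi n * X v)) \<le> C1" using C1 nv by auto
    have "norm (1 / q_exp q (of_real q powi n * Y (v, s))) * (1 + w) \<le> C2" unfolding w_def using C2 nv s by auto
    then have c2: "norm (1 / q_exp q (of_real q powi n * Y (v, s))) \<le> C2 / (1 + w)"
      using w by (simp add: pos_le_divide_eq)
    have C0: "C1 \<ge> 0" "C2 / (1 + w) \<ge> 0" using order_trans[OF norm_ge_zero c1] order_trans[OF norm_ge_zero c2] by auto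
    then have C20: "C2 \<ge> 0" using w by (simp add: zero_le_divide_iff)
    have "norm (ray_integrand q d s r) =
        norm (1 / (1 + of_real q powi n * X v)) * norm (1 / q_exp q (of_real q powi n * Y (v, s)))"
      by (simp add: ray_integrand_def psi_def X_def Y_def nv(1) norm_mult norm_divide mult_ac)
    also have "\<dots> \<le> C1 * (C2 / (1 + w))" using c1 c2 C0 by (intro mult_mono) auto
    \<comment> \<open>From \<open>v \<le> q\<close>: \<open>1 + r^2\<close> is at most
      \<open>q^2 (1 + q^(2 n))\<close>, whence the factor \<open>q^2\<close>.\<close>
    also have "\<dots> \<le> C1 * (C2 * q\<^sup>2 * inverse (1 + r\<^sup>2))"
    proof (rule mult_left_mono[OF _ C0(1)])
      have "r\<^sup>2 = w * v\<^sup>2" by (simp add: nv(1) w_def power_mult_distrib)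
      also have "\<dots> \<le> w * q\<^sup>2" using nv w by (intro mult_left_mono power_mono) auto
      finally have "r\<^sup>2 \<le> w * q\<^sup>2" .
      moreover have "1 \<le> q\<^sup>2" by (rule one_le_power) (use q in simp)
      moreover have "q\<^sup>2 * (1 + w) = q\<^sup>2 + w * q\<^sup>2" by (simp add: algebra_simps)
      ultimately have "1 + r\<^sup>2 \<le> q\<^sup>2 * (1 + w)" by linarith
      then have "1 / (1 + w) \<le> q\<^sup>2 / (1 + r\<^sup>2)"
        using w by (simp add: divide_le_eq le_divide_eq add_pos_nonneg mult.commute)
      from mult_left_mono[OF this C20] show "C2 / (1 + w) \<le> C2 * q\<^sup>2 * inverse (1 + r\<^sup>2)"
        by (simp add: divide_inverse mult_ac)
    qed
    finally show "norm (ray_integrand q d s r) \<le> (C1 * C2 * q\<^sup>2) * inverse (1 + r\<^sup>2)" by (simp add: mult_ac)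
  qed
qed

lemma ray_integrand_continuous:
  assumes q: "q > 1" and d: "\<bar>d\<bar> < pi" "\<bar>Im s - d\<bar> < pi"
  shows "continuous_on {0<..} (ray_integrand q d s)"
proof -
  have reg: "1 + of_real r * cis d \<noteq> 0" "q_exp q (of_real q * (of_real r * cis d) / exp s) \<noteq> 0" if "r > 0" for r
    using jackson_regular_ray[OF q that d] unfolding jackson_regular_def
    by (metis power_int_0_right mult_1)+
  have "continuous_on UNIV (q_exp q)"
    by (rule holomorphic_on_imp_continuous_on[OF q_exp_holomorphic[OF q]])
  then have "continuous_on {0<..} (\<lambda>r. q_exp q (of_real q * (of_real r * cis d) / exp s))"
    by (rule continuous_on_compose2) (auto intro!: continuous_intros)
  then show ?thesis
    unfolding ray_integrand_def psi_def using reg by (intro continuous_intros) auto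
qed

lemma integrable_inverse_1_plus_square_lborel: "integrable lborel (\<lambda>r::real. C * inverse (1 + r\<^sup>2))"
  using integrable_inverse_1_plus_square by (simp add: set_integrable_def)

lemma ray_integrand_integrable:
  assumes q: "q > 1" and d: "\<bar>d\<bar> < pi" "\<bar>Im s - d\<bar> < pi"
  shows "set_integrable lborel {0<..} (ray_integrand q d s)"
proof -
  obtain \<epsilon> C where \<epsilon>: "\<epsilon> > 0"
    and "\<And>z r. z \<in> cball s \<epsilon> \<Longrightarrow> r > 0 \<Longrightarrow> norm (ray_integrand q d z r) \<le> C * inverse (1 + r\<^sup>2)"
    using ray_integrand_bound[OF q d] by metis
  then have C: "norm (ray_integrand q d s r) \<le> C * inverse (1 + r\<^sup>2)" if "r > 0" for r
    using that by simp
  have C0: "C * inverse (1 + r\<^sup>2) \<ge> 0" for r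
    using order_trans[OF norm_ge_zero C[of 1]] by simp
  show ?thesis unfolding set_integrable_def
  proof (rule Bochner_Integration.integrable_bound[OF integrable_inverse_1_plus_square_lborel[of C]])
    show "(\<lambda>r. indicator {0<..} r *\<^sub>R ray_integrand q d s r) \<in> borel_measurable lborel"
      using borel_measurable_continuous_on_indicator[OF _ ray_integrand_continuous[OF q d]] by simp
    show "AE r in lborel. norm (indicator {0<..} r *\<^sub>R ray_integrand q d s r) \<le> norm (C * inverse (1 + r\<^sup>2))"
      using C C0 by (intro always_eventually allI) (auto simp: indicator_def intro: order_trans[OF _ abs_ge_self])
  qed
qed

lemma E_ray_eq: "E_ray q d (exp s) = of_real ((q - 1) / ln q) * (LINT r:{0<..}|lborel. ray_integrand q d s r)"
  by (simp add: E_ray_def ray_integrand_def)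

text \<open>The values of the continuation are limits over punctured neighbourhoods; continuity is
  what carries an identity proved for generic \<open>t\<close> to every point of the strip.\<close>

lemma E_ray_continuous:
  assumes q: "q > 1" and d: "\<bar>d\<bar> < pi" "\<bar>Im t - d\<bar> < pi"
  shows "isCont (\<lambda>s. E_ray q d (exp s)) t"
proof -
  obtain \<epsilon> C where \<epsilon>: "\<epsilon> > 0" and im: "\<And>s. s \<in> cball t \<epsilon> \<Longrightarrow> \<bar>Im s - d\<bar> < pi"
    and C: "\<And>s r. s \<in> cball t \<epsilon> \<Longrightarrow> r > 0 \<Longrightarrow> norm (ray_integrand q d s r) \<le> C * inverse (1 + r\<^sup>2)"
    using ray_integrand_bound[OF q d] by metis
  have C0: "C * inverse (1 + r\<^sup>2) \<ge> 0" for r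
    using order_trans[OF norm_ge_zero C[of t 1]] \<epsilon> by simp
  have "continuous_on (cball t \<epsilon>) (\<lambda>s. E_ray q d (exp s))"
    unfolding E_ray_eq set_lebesgue_integral_def
  proof (intro continuous_on_mult continuous_on_const continuous_on_sequentiallyI)
    fix u a assume u: "\<forall>n. u n \<in> cball t \<epsilon>" and a: "a \<in> cball t \<epsilon>" and lim: "u \<longlonglongrightarrow> a"
    show "(\<lambda>n. LINT r|lborel. indicator {0<..} r *\<^sub>R ray_integrand q d (u n) r) \<longlonglongrightarrow>
        (LINT r|lborel. indicator {0<..} r *\<^sub>R ray_integrand q d a r)"
    proof (rule integral_dominated_convergence[OF _ _ integrable_inverse_1_plus_square_lborel[of C]])
      show "(\<lambda>r. indicator {0<..} r *\<^sub>R ray_integrand q d a r) \<in> borel_measurable lborel"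
        "(\<lambda>r. indicator {0<..} r *\<^sub>R ray_integrand q d (u n) r) \<in> borel_measurable lborel" for n
        using borel_measurable_continuous_on_indicator[OF _ ray_integrand_continuous[OF q d(1) im]] a u by auto
      show "AE r in lborel. norm (indicator {0<..} r *\<^sub>R ray_integrand q d (u n) r) \<le> C * inverse (1 + r\<^sup>2)" for n
        using C C0 u by (intro always_eventually allI) (auto simp: indicator_def)
      show "AE r in lborel. (\<lambda>n. indicator {0<..} r *\<^sub>R ray_integrand q d (u n) r) \<longlonglongrightarrow> indicator {0<..} r *\<^sub>R ray_integrand q d a r"
      proof (intro always_eventually allI)
        fix r :: real
        show "(\<lambda>n. indicator {0<..} r *\<^sub>R ray_integrand q d (u n) r) \<longlonglongrightarrow> indicator {0<..} r *\<^sub>R ray_integrand q d a r"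
        proof (cases "r > 0")
          case True
          have "q_exp q (of_real q * (of_real r * cis d) / exp a) \<noteq> 0"
            using jackson_regular_ray[OF q True d(1) im[OF a]] unfolding jackson_regular_def
            by (metis power_int_0_right mult_1)
          moreover have "(\<lambda>n. q_exp q (of_real q * (of_real r * cis d) / exp (u n))) \<longlonglongrightarrow> q_exp q (of_real q * (of_real r * cis d) / exp a)"
            by (rule isCont_tendsto_compose[OF isCont_q_exp[OF q]]) (auto intro!: tendsto_intros lim)
          ultimately show ?thesis unfolding ray_integrand_def by (intro tendsto_intros)
        qed simp
      qed
    qed
  qed
  then show ?thesis using \<epsilon> by (intro continuous_on_interior[of "cball t \<epsilon>"]) auto
qed

text \<open>Connects unordered summation over the integers with symmetric blocks, which correspond
  to the growing segments \<open>[q^(- N), q^N]\<close> of the ray.\<close>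

lemma filterlim_int_intervals:
  "filterlim (\<lambda>N. {- int N..<int N}) (finite_subsets_at_top UNIV) sequentially"
  unfolding filterlim_finite_subsets_at_top
proof safe
  fix X :: "int set" assume X: "finite X"
  define N where "N = (\<Sum>x\<in>X. nat \<bar>x\<bar>) + 1"
  have "x \<in> {- int n..<int n}" if "x \<in> X" "n \<ge> N" for x n
  proof -
    have "nat \<bar>x\<bar> \<le> (\<Sum>x\<in>X. nat \<bar>x\<bar>)" by (rule member_le_sum) (use that X in auto)
    then show ?thesis using that by (auto simp: N_def)
  qed
  then show "\<forall>\<^sub>F n in sequentially. finite {- int n..<int n} \<and> X \<subseteq> {- int n..<int n} \<and> {- int n..<int n} \<subseteq> UNIV"
    by (auto simp: eventually_sequentially intro!: exI[of _ N])
qed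

text \<open>The ray is cut into the segments \<open>[q^n, q^(n + 1)]\<close>, each rescaled to
  \<open>[1, q]\<close>; uniform convergence there allows summing under the integral. What is
  integrated against \<open>dv / v\<close> is the Jackson series whose base point runs through one
  period of the ray.\<close>

lemma LINT_ray_integrand:
  assumes q: "q > 1" and d: "\<bar>d\<bar> < pi" "\<bar>Im s - d\<bar> < pi"
  shows "((\<lambda>v. jackson_series q (of_real v * cis d) (of_real q * (of_real v * cis d) / exp s) / of_real v) has_integral
    (LINT r:{0<..}|lborel. ray_integrand q d s r)) {1..q}"
proof -
  let ?F = "ray_integrand q d s"
  define g where "g = (\<lambda>n::int. \<lambda>v. jackson_term q (of_real v * cis d) (of_real q * (of_real v * cis d) / exp s) n / of_real v)"
  define P where "P = (\<lambda>n::int. integral {q powi n..q powi (n + 1)} ?F)"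
  have Fc: "continuous_on {a..b} ?F" if "a > 0" for a b
    by (rule continuous_on_subset[OF ray_integrand_continuous[OF q d]]) (use that in auto)
  have qp: "q powi n > 0" for n using q by simp
  have qS: "q powi (n + 1) = q powi n * q" for n using q by (simp add: power_int_add)
  have gP: "(g n has_integral P n) {1..q}" for n
  proof -
    have sub: "((\<lambda>v. (q powi n) *\<^sub>R ?F (q powi n * v)) has_integral (integral {q powi n * 1..q powi n * q} ?F)) {1..q}"
    proof (rule has_integral_substitution[where c = "q powi n" and d = "q powi n * q"])
      show "(\<lambda>v. q powi n * v) ` {1..q} \<subseteq> {q powi n..q powi n * q}" using qp[of n] by auto
      show "((\<lambda>v. q powi n * v) has_real_derivative q powi n) (at x within {1..q})" for x
        by (auto intro!: derivative_eq_intros)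
      show "continuous_on {q powi n..q powi n * q} ?F" by (rule Fc[OF qp])
    qed (use q qp[of n] in auto)
    have "(g n has_integral (integral {q powi n * 1..q powi n * q} ?F)) {1..q}"
      by (rule has_integral_eq[OF _ sub])
        (use ray_integrand_scale[OF q] in \<open>simp add: g_def scaleR_conv_of_real\<close>)
    then show ?thesis by (simp add: P_def qS)
  qed
  have gc: "continuous_on {1..q} (g n)" for n
  proof -
    have "continuous_on {1..q} (\<lambda>v. of_real (q powi n) * ?F (q powi n * v))"
      by (intro continuous_intros continuous_on_compose2[OF ray_integrand_continuous[OF q d]])
        (use q qp[of n] less_le_trans[OF qp[of n]] in \<open>auto intro!: mult_pos_pos\<close>)
    also have "?this \<longleftrightarrow> ?thesis"
      by (rule continuous_on_cong) (use ray_integrand_scale[OF q] in \<open>auto simp: g_def\<close>)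
    finally show ?thesis .
  qed
  obtain M where M: "M summable_on UNIV"
    "\<And>v n. v \<in> {1..q} \<Longrightarrow> norm (jackson_term q (of_real v * cis d) (of_real q * (of_real v * cis d) / exp s) n) \<le> M n"
    by (rule jackson_term_bound[OF q compact_Icc, of 1 q "\<lambda>v. of_real v * cis d" "\<lambda>v. of_real q * (of_real v * cis d) / exp s"])
      (use jackson_regular_ray[OF q _ d] in \<open>auto intro!: continuous_intros\<close>)
  have ul: "uniform_limit {1..q} (\<lambda>X v. \<Sum>n\<in>X. g n v) (\<lambda>v. \<Sum>\<^sub>\<infinity>n. g n v) (finite_subsets_at_top UNIV)"
  proof (rule Weierstrass_m_test_general[OF _ M(1)])
    fix n :: int and v assume v: "v \<in> {1..q}"
    have "norm (g n v) \<le> M n / v" using M(2)[OF v, of n] v by (simp add: g_def norm_divide divide_right_mono)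
    also have "\<dots> \<le> M n / 1" using v order_trans[OF norm_ge_zero M(2)[OF v, of n]] by (intro divide_left_mono) auto
    finally show "norm (g n v) \<le> M n" by simp
  qed
  obtain I J where IJ: "\<And>X. ((\<lambda>v. \<Sum>n\<in>X. g n v) has_integral I X) {1..q}"
    "((\<lambda>v. \<Sum>\<^sub>\<infinity>n. g n v) has_integral J) {1..q}" "(I \<longlongrightarrow> J) (finite_subsets_at_top UNIV)"
    by (rule uniform_limit_integral[OF ul]) (auto intro!: continuous_intros gc)
  have IP: "I X = (\<Sum>n\<in>X. P n)" if "finite X" for X
    by (rule has_integral_unique[OF IJ(1) has_integral_sum[OF that gP]])
  have "(\<lambda>N. I {- int N..<int N}) \<longlonglongrightarrow> J"
    by (rule filterlim_compose[OF IJ(3) filterlim_int_intervals])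
  moreover have "I {- int N..<int N} = (LINT r:{q powi (- int N)..q powi (int N)}|lborel. ?F r)" for N
  proof -
    have combine: "integral {q powi a..q powi b} ?F + integral {q powi b..q powi c} ?F = integral {q powi a..q powi c} ?F"
      if "a \<le> b" "b \<le> c" for a b c :: int
    proof (rule Henstock_Kurzweil_Integration.integral_combine)
      show "q powi a \<le> q powi b" "q powi b \<le> q powi c" using q that by (auto intro!: power_int_increasing)
      show "?F integrable_on {q powi a..q powi c}" by (rule integrable_continuous_real[OF Fc[OF qp]])
    qed
    have "(\<Sum>n\<in>{- int N..<int N}. P n) = integral {q powi (- int N)..q powi (int N)} ?F"
    proof (induction N)
      case (Suc N)
      \<comment> \<open>A block grows by one segment at each end: index \<open>- N - 1\<close> below
        and \<open>N\<close> above.\<close>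
      have e: "{- int (Suc N)..<int (Suc N)} = insert (- int (Suc N)) (insert (int N) {- int N..<int N})" by auto
      have "(\<Sum>n\<in>{- int (Suc N)..<int (Suc N)}. P n) =
          P (- int (Suc N)) + (integral {q powi (- int N)..q powi (int N)} ?F + P (int N))"
        unfolding e Suc[symmetric] by (simp add: add_ac)
      also have "integral {q powi (- int N)..q powi (int N)} ?F + P (int N) = integral {q powi (- int N)..q powi (int N + 1)} ?F"
        unfolding P_def by (rule combine) simp_all
      also have "P (- int (Suc N)) + \<dots> = integral {q powi (- int (Suc N))..q powi (int N + 1)} ?F"
      proof -
        have "- int (Suc N) + 1 = - int N" by simp
        then show ?thesis unfolding P_def by (simp only:) (rule combine, simp_all)
      qed
      also have "int N + 1 = int (Suc N)" by simp
      finally show ?case .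
    qed simp
    moreover have "set_integrable lborel {q powi (- int N)..q powi (int N)} ?F"
      by (rule set_integrable_subset[OF ray_integrand_integrable[OF q d]])
        (auto intro: less_le_trans[OF qp])
    ultimately show ?thesis using IP[of "{- int N..<int N}"] by (simp add: set_borel_integral_eq_integral(2))
  qed
  moreover have "(\<lambda>N. LINT r:{q powi (- int N)..q powi (int N)}|lborel. ?F r) \<longlonglongrightarrow>
      (LINT r:(\<Union>N. {q powi (- int N)..q powi (int N)})|lborel. ?F r)"
  proof (rule set_integral_cont_up)
    show "incseq (\<lambda>N. {q powi (- int N)..q powi (int N)})"
      unfolding incseq_def
    proof (intro allI impI)
      fix m n :: nat assume "m \<le> n"
      then have "q powi (- int n) \<le> q powi (- int m)" "q powi (int m) \<le> q powi (int n)"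
        using q by (auto intro!: power_int_increasing)
      then show "{q powi (- int m)..q powi (int m)} \<subseteq> {q powi (- int n)..q powi (int n)}" by auto
    qed
    show "set_integrable lborel (\<Union>N. {q powi (- int N)..q powi (int N)}) ?F"
      by (rule set_integrable_subset[OF ray_integrand_integrable[OF q d]])
        (auto intro: less_le_trans[OF qp])
  qed simp
  moreover have "(\<Union>N. {q powi (- int N)..q powi (int N)}) = {0<..}"
  proof -
    have "\<exists>N. q powi (- int N) \<le> r \<and> r \<le> q powi (int N)" if "r > 0" for r
    proof -
      obtain N where N: "N \<ge> 0" "\<And>n. n \<ge> N \<Longrightarrow> q powi n \<ge> max r (1 / r)"
        using powi_large[OF q] by metis
      then have "q powi (int (nat N)) \<ge> r" "q powi (int (nat N)) \<ge> 1 / r" by (metis int_nat_eq max.bounded_iff order_refl)+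
      then show ?thesis using that q by (intro exI[of _ "nat N"]) (simp add: power_int_minus field_simps)
    qed
    then show ?thesis by (auto intro: less_le_trans[OF qp])
  qed
  ultimately have "J = (LINT r:{0<..}|lborel. ?F r)" using LIMSEQ_unique by simp
  moreover have "(\<Sum>\<^sub>\<infinity>n. g n v) = jackson_series q (of_real v * cis d) (of_real q * (of_real v * cis d) / exp s) / of_real v" for v
    unfolding g_def jackson_series_def divide_inverse by (rule infsum_cmult_left')
  ultimately show ?thesis using IJ(2) by simp
qed

text \<open>The identity with the constant \<open>k\<close> is integrated over \<open>[1, q]\<close>
  against \<open>dv / v\<close> with base point \<open>v cis d\<close>: the Jackson part gives the
  ray integral, the theta parts cancel, and \<open>k\<close> is left with the factor
  \<open>ln q\<close>, which the prefactor of \<open>E_ray\<close> divides out.\<close>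

lemma E_ray_eq_jackson_series:
  assumes q: "q > 1" and d: "\<bar>d\<bar> < pi" "\<bar>Im t - d\<bar> < pi"
    and t: "t - of_real (ln (1 - 1 / q)) \<notin> log_lattice q"
  defines "a \<equiv> t - of_real (ln (1 - 1 / q)) - of_real pi * \<i>" and "b \<equiv> - (of_real pi * \<i>)"
  defines "B \<equiv> 2 * of_real pi * \<i> * of_real ((q - 1) / ln q) * inverse (q_exp q (- of_real q / exp t))"
  assumes u: "a - u \<notin> log_lattice q" "b - u \<notin> log_lattice q"
  shows "E_ray q d (exp t) =
    of_real (q - 1) * jackson_series q (exp u) (of_real q * exp (u - t)) + B * (L_log q (a - u) - L_log q (b - u))"
proof -
  obtain k where k: "\<And>u. a - u \<notin> log_lattice q \<Longrightarrow> b - u \<notin> log_lattice q \<Longrightarrow>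
    of_real (q - 1) * jackson_series q (exp u) (of_real q * exp (u - t)) + B * (L_log q (a - u) - L_log q (b - u)) = k"
    using jackson_series_plus_L_log_constant[OF q t] unfolding a_def b_def B_def by blast
  define \<phi> where "\<phi> = (\<lambda>v. of_real (ln v) + of_real d * \<i>)"
  obtain G where G: "\<And>v. - 2 * pi < Im v \<Longrightarrow> Im v < 0 \<Longrightarrow> (G has_field_derivative L_log q v) (at v)"
    "\<And>v w. - 2 * pi < Im v \<Longrightarrow> Im v < 0 \<Longrightarrow> - 2 * pi < Im w \<Longrightarrow> Im w < 0 \<Longrightarrow>
      G (v + of_real (ln q)) - G v = G (w + of_real (ln q)) - G w"
    using L_log_strip_primitive[OF q] by metis
  \<comment> \<open>The heights are \<open>Im t - d - pi\<close> here and \<open>- d - pi\<close>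
    for \<open>b\<close>. The assumptions on \<open>d\<close> place both in the open strip from
    \<open>- 2 pi\<close> to 0, so one primitive \<open>G\<close> serves for both
    translates.\<close>
  have ima: "- 2 * pi < Im (a - \<phi> v)" "Im (a - \<phi> v) < 0" for v
    using d by (auto simp: a_def \<phi>_def)
  have imb: "- 2 * pi < Im (b - \<phi> v)" "Im (b - \<phi> v) < 0" for v
    using d by (auto simp: b_def \<phi>_def)
  have notin: "a - \<phi> v \<notin> log_lattice q" "b - \<phi> v \<notin> log_lattice q" for v
    by (rule not_in_log_lattice; use ima[of v] imb[of v] in linarith)+
  \<comment> \<open>Solving the identity for the Jackson series leaves \<open>k\<close> minus the
    theta terms; their sign is reversed once more by the inner derivative \<open>- 1 / v\<close> of
    \<open>a - \<phi> v\<close> and \<open>b - \<phi> v\<close>.\<close>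
  define \<Phi> where "\<Phi> = (\<lambda>v. k * of_real (ln v) + B * (G (a - \<phi> v) - G (b - \<phi> v)))"
  have der: "(\<Phi> has_vector_derivative (of_real (q - 1) *
      (jackson_series q (of_real v * cis d) (of_real q * (of_real v * cis d) / exp t) / of_real v))) (at v within {1..q})"
    if v: "v \<in> {1..q}" for v
  proof -
    have v0: "v > 0" using v by auto
    have ln: "((\<lambda>v. of_real (ln v) :: complex) has_vector_derivative 1 / of_real v) (at v within {1..q})"
    proof -
      have "(ln has_real_derivative 1 / v) (at v within {1..q})"
        by (rule DERIV_subset[OF DERIV_ln_divide[OF v0]]) simp
      then have "((\<lambda>v. of_real (ln v) :: complex) has_vector_derivative of_real (1 / v)) (at v within {1..q})"
        by (rule has_vector_derivative_of_real)
      then show ?thesis by simp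
    qed
    have \<phi>: "((\<lambda>v. e - \<phi> v) has_vector_derivative - (1 / of_real v)) (at v within {1..q})" for e
      unfolding \<phi>_def using has_vector_derivative_diff[OF has_vector_derivative_const[of e] 
          has_vector_derivative_add[OF ln has_vector_derivative_const[of "of_real d * \<i>"]]] by simp
    have ga: "((\<lambda>v. G (a - \<phi> v)) has_vector_derivative - (1 / of_real v) * L_log q (a - \<phi> v)) (at v within {1..q})"
      using field_vector_diff_chain_within[OF \<phi> has_field_derivative_at_within[OF G(1)[OF ima]]]
      by (simp add: o_def)
    have gb: "((\<lambda>v. G (b - \<phi> v)) has_vector_derivative - (1 / of_real v) * L_log q (b - \<phi> v)) (at v within {1..q})"
      using field_vector_diff_chain_within[OF \<phi> has_field_derivative_at_within[OF G(1)[OF imb]]]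
      by (simp add: o_def)
    have "(\<Phi> has_vector_derivative k * (1 / of_real v) +
        B * (- (1 / of_real v) * L_log q (a - \<phi> v) - - (1 / of_real v) * L_log q (b - \<phi> v))) (at v within {1..q})"
      unfolding \<Phi>_def by (intro has_vector_derivative_add has_vector_derivative_mult_right has_vector_derivative_diff ln ga gb)
    also have "k * (1 / of_real v) + B * (- (1 / of_real v) * L_log q (a - \<phi> v) - - (1 / of_real v) * L_log q (b - \<phi> v)) =
        (k - B * (L_log q (a - \<phi> v) - L_log q (b - \<phi> v))) / of_real v"
      using v0 by (simp add: field_simps)
    also have "k - B * (L_log q (a - \<phi> v) - L_log q (b - \<phi> v)) =
        of_real (q - 1) * jackson_series q (exp (\<phi> v)) (of_real q * exp (\<phi> v - t))"
      using k[OF notin, of v] by (simp add: algebra_simps)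
    also have "exp (\<phi> v) = of_real v * cis d" unfolding \<phi>_def by (rule of_real_cis[OF v0, symmetric])
    also have "of_real q * exp (\<phi> v - t) = of_real q * (of_real v * cis d) / exp t"
      unfolding exp_diff \<open>exp (\<phi> v) = of_real v * cis d\<close> by simp
    finally show ?thesis by simp
  qed
  \<comment> \<open>Over one period both theta terms change by the same amount, as it does not
    depend on the point of the strip; only \<open>k ln q\<close> remains.\<close>
  have \<Phi>: "\<Phi> q - \<Phi> 1 = k * of_real (ln q)"
  proof -
    have "G (a - \<phi> q + of_real (ln q)) - G (a - \<phi> q) = G (b - \<phi> q + of_real (ln q)) - G (b - \<phi> q)"
      by (rule G(2)[OF ima imb])
    moreover have s: "e - \<phi> q + of_real (ln q) = e - \<phi> 1" for e by (simp add: \<phi>_def)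
    ultimately have "G (a - \<phi> q) - G (b - \<phi> q) = G (a - \<phi> 1) - G (b - \<phi> 1)"
      unfolding s by (simp add: algebra_simps)
    then show ?thesis by (simp add: \<Phi>_def)
  qed
  have I1: "((\<lambda>v. of_real (q - 1) *
      (jackson_series q (of_real v * cis d) (of_real q * (of_real v * cis d) / exp t) / of_real v)) has_integral (\<Phi> q - \<Phi> 1)) {1..q}"
    by (rule fundamental_theorem_of_calculus) (use q der in auto)
  have I2: "((\<lambda>v. of_real (q - 1) *
      (jackson_series q (of_real v * cis d) (of_real q * (of_real v * cis d) / exp t) / of_real v)) has_integral
      of_real (q - 1) * (LINT r:{0<..}|lborel. ray_integrand q d t r)) {1..q}"
    by (rule has_integral_mult_right[OF LINT_ray_integrand[OF q d(1,2)]])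
  have "of_real (q - 1) * (LINT r:{0<..}|lborel. ray_integrand q d t r) = k * of_real (ln q)"
    using has_integral_unique[OF I2 I1] \<Phi> by simp
  then have "E_ray q d (exp t) = k" unfolding E_ray_eq using q by (simp add: field_simps)
  then show ?thesis using k[OF u] by simp
qed

section \<open>Uniqueness of the continuation and the identity\<close>

text \<open>Agreement on an open set spreads to punctured neighbourhoods of all points by the
  identity theorem; the convention for values, limit or 0 at a pole, then settles the points
  themselves.\<close>

lemma nicely_meromorphic_eqI:
  assumes f: "f nicely_meromorphic_on UNIV" and g: "g nicely_meromorphic_on UNIV"
    and S: "open S" "S \<noteq> {}" "\<And>z. z \<in> S \<Longrightarrow> f z = g z"
  shows "f = g"
proof -
  have "(\<lambda>z. f z - g z) meromorphic_on UNIV"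
    using f g by (intro meromorphic_intros) (auto simp: nicely_meromorphic_on_def)
  then have sing: "isolated_singularity_at (\<lambda>z. f z - g z) z" for z
    by (meson UNIV_I empty_subsetI insert_subset meromorphic_at_iff meromorphic_on_subset)
  define h where "h = remove_sings (\<lambda>z. f z - g z)"
  have h: "h nicely_meromorphic_on UNIV"
    unfolding h_def by (rule remove_sings_nicely_meromorphic) fact
  have ev: "\<forall>\<^sub>F w in at z. h w = f w - g w" for z
    unfolding h_def by (rule eventually_remove_sings_eq_at[OF sing])
  obtain z0 where z0: "z0 \<in> S" using S(2) by blast
  have "\<forall>\<^sub>F w in at z0. w \<in> S" using S(1) z0 by (simp add: eventually_at_in_open')
  with ev[of z0] have "\<forall>\<^sub>F w in at z0. h w = 0" by eventually_elim (simp add: S(3))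
  then have "\<exists>\<^sub>F w in at z0. h w = 0" by (rule eventually_frequently[rotated]) simp
  from frequently_eq_meromorphic_imp_constant[OF this h] have h0: "h w = 0" for w
    by (simp add: connected_UNIV)
  have eq: "\<forall>\<^sub>F w in at z. f w = g w" for z using ev[of z] by eventually_elim (simp add: h0)
  show ?thesis
  proof
    fix z
    have "(is_pole f z \<and> f z = 0) \<or> f \<midarrow>z\<rightarrow> f z" "(is_pole g z \<and> g z = 0) \<or> g \<midarrow>z\<rightarrow> g z"
      using f g by (auto simp: nicely_meromorphic_on_def)
    moreover have "is_pole f z \<longleftrightarrow> is_pole g z" by (rule is_pole_cong[OF eq refl])
    moreover have "f \<midarrow>z\<rightarrow> g z" if "g \<midarrow>z\<rightarrow> g z"
    proof (rule Lim_transform_eventually[OF that])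
      show "\<forall>\<^sub>F w in at z. g w = f w" using eq[of z] by eventually_elim simp
    qed
    moreover have "\<not> is_pole f z" if "f \<midarrow>z\<rightarrow> c" for c
      using that unfolding is_pole_def by (meson at_neq_bot not_tendsto_and_filterlim_at_infinity)
    moreover have "\<not> is_pole g z" if "g \<midarrow>z\<rightarrow> c" for c
      using that unfolding is_pole_def by (meson at_neq_bot not_tendsto_and_filterlim_at_infinity)
    ultimately show "f z = g z" by (metis LIM_unique)
  qed
qed

text \<open>A candidate such as a Jackson series plus theta terms may take wrong values at isolated
  points, so it is compared with the ray integrals only on punctured neighbourhoods;
  \<open>remove_sings\<close> repairs the values.\<close>

lemma E_cont_eqI:
  assumes f: "f meromorphic_on UNIV"
    and ev: "\<And>d t. \<bar>d\<bar> < pi \<Longrightarrow> \<bar>Im t - d\<bar> < pi \<Longrightarrow> \<forall>\<^sub>F s in at t. f s = E_ray q d (exp s)"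
    and q: "q > 1"
  shows "E_cont q = remove_sings f"
  unfolding E_cont_def
proof (rule the_equality, intro conjI ballI allI impI)
  show nice: "remove_sings f nicely_meromorphic_on UNIV" by (rule remove_sings_nicely_meromorphic[OF f])
  show eq: "remove_sings f t = E_ray q d (exp t)" if "d \<in> {- pi<..<pi}" "Im t \<in> {d - pi<..<d + pi}" for d t
  proof (rule remove_sings_eqI)
    have d: "\<bar>d\<bar> < pi" "\<bar>Im t - d\<bar> < pi" using that by auto
    show "f \<midarrow>t\<rightarrow> E_ray q d (exp t)"
      by (rule Lim_transform_eventually[OF E_ray_continuous[OF q d, unfolded isCont_def]])
        (use ev[OF d] in \<open>auto elim!: eventually_mono\<close>)
  qed
  fix E assume E: "E nicely_meromorphic_on UNIV \<and>
    (\<forall>d\<in>{- pi<..<pi}. \<forall>t. Im t \<in> {d - pi<..<d + pi} \<longrightarrow> E t = E_ray q d (exp t))"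
  show "E = remove_sings f"
  proof (rule nicely_meromorphic_eqI[OF _ nice])
    \<comment> \<open>The ray \<open>d = 0\<close> alone determines the continuation, through its
      values at heights between \<open>- pi\<close> and \<open>pi\<close>.\<close>
    show "open ({t. Im t > - pi} \<inter> {t. Im t < pi})"
      by (intro open_Int open_halfspace_Im_gt open_halfspace_Im_lt)
    have "0 \<in> {t. Im t > - pi} \<inter> {t. Im t < pi}" by simp
    then show "{t. Im t > - pi} \<inter> {t. Im t < pi} \<noteq> {}" by blast
    fix t assume "t \<in> {t. Im t > - pi} \<inter> {t. Im t < pi}"
    then have "Im t \<in> {0 - pi<..<0 + pi}" "(0::real) \<in> {- pi<..<pi}" by simp_all
    then show "E t = remove_sings f t" using E eq[of 0 t] by metis
  qed (use E in blast)
qed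

text \<open>The factor is \<open>2 pi i\<close>, where the formula in English prints
  \<open>- 2 pi i\<close>: with the stated definitions the residues of the Jackson series and of
  \<open>L_log\<close> force the plus sign. At a zero of \<open>q_exp q (- q / exp t)\<close> the
  value of \<open>R\<close> is only the convention \<open>inverse 0 = 0\<close>; there the identity
  is stated as a limit, or near the point if \<open>E_cont\<close> has a pole. Another choice of the
  logarithm \<open>mu\<close> shifts both \<open>L_fun\<close> terms by the same integer, so their
  difference does not see it.\<close>

theorem proposition3p6:
  fixes q p :: real and lam mu t :: complex and C :: complex and R :: "complex \<Rightarrow> complex"
  assumes q: "1 < q" and p: "p = 1 / q"
    and lam: "lam \<noteq> 0" "lam \<notin> q_spiral (-1) q"
    and mu: "exp mu = - lam * of_real (1 - p)"
    and t: "exp t \<notin> q_spiral (- lam * of_real (1 - p)) q"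
  defines "C \<equiv> L_fun (q_star q mu) (q_dual q) (q_star q (of_real (ln (1 - p))))"
    and "R \<equiv> (\<lambda>s. 2 * of_real pi * \<i> * of_real ((q - 1) / ln q) *
               (L_fun (q_star q mu) (q_dual q) (q_star q s) - C) *
               inverse (q_exp q (- of_real q / exp s)))"
  shows "(q_exp q (- of_real q / exp t) \<noteq> 0 \<longrightarrow> E_cont q t - E_jackson q lam (exp t) = R t) \<and>
         (\<not> is_pole (E_cont q) t \<longrightarrow> (R \<longlongrightarrow> E_cont q t - E_jackson q lam (exp t)) (at t)) \<and>
         (\<forall>\<^sub>F s in at t. E_cont q s - E_jackson q lam (exp s) = R s)"
proof -
  define c where "c = complex_of_real (ln (1 - 1 / q))"
  \<comment> \<open>A logarithm of \<open>lam\<close>. As base point it turns the two arguments of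
    \<open>L_log\<close> in \<open>E_ray_eq_jackson_series\<close> into \<open>t - mu\<close> and
    \<open>c - mu\<close>, that is, into \<open>L_fun\<close> at \<open>x\<close> and the constant
    \<open>C\<close>.\<close>
  define v where "v = mu - c - of_real pi * \<i>"
  have q1: "1 - 1 / q > 0" using q by simp
  have expv: "exp v = lam"
  proof -
    have c: "exp c = of_real (1 - 1 / q)" using q1 unfolding c_def by (simp only: exp_of_real exp_ln)
    have nz: "complex_of_real (1 - 1 / q) \<noteq> 0" using q1 unfolding of_real_eq_0_iff by linarith
    have "exp v = - (exp mu / exp c)" by (simp add: v_def exp_diff)
    also have "\<dots> = lam" using nz unfolding mu p c minus_divide_left by (simp del: of_real_diff)
    finally show ?thesis .
  qed
  have v1: "v + of_real pi * \<i> \<notin> log_lattice q"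
  proof
    assume "v + of_real pi * \<i> \<in> log_lattice q"
    then obtain n :: int where "1 + of_real q powi n * lam = 0"
      using psi_pole_iff[OF q, of v] expv by auto
    then have "lam = - 1 * of_real q powi (- n)"
      using q by (simp add: power_int_minus field_simps eq_neg_iff_add_eq_0)
    with lam(2) show False by (auto simp: q_spiral_def)
  qed
  then have cmu: "c - mu \<notin> log_lattice q"
    using log_lattice_minus_commute[of c mu q] by (simp add: v_def)
  have tmu: "t - mu \<notin> log_lattice q"
  proof
    assume "t - mu \<in> log_lattice q"
    then obtain n :: int where "exp (t - mu) = of_real q powi n" using exp_eq_powi_iff[OF q] by blast
    then have "exp t = exp mu * of_real q powi n" by (simp add: exp_diff field_simps)
    with t mu show False by (auto simp: q_spiral_def)
  qed
  define J where "J = (\<lambda>s. E_jackson q lam (exp s))"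
  have J: "J s = of_real (q - 1) * jackson_series q (exp v) (of_real q * exp (v - s))" for s
    unfolding J_def E_jackson_eq[OF q] by (simp add: exp_diff expv)
  have R: "R s = 2 * of_real pi * \<i> * of_real ((q - 1) / ln q) * inverse (q_exp q (- of_real q / exp s)) *
      (L_log q (s - mu) - L_log q (c - mu))" for s
    by (simp add: R_def C_def L_fun_q_star p c_def)
  have qh: "(\<lambda>s. q_exp q (- of_real q / exp s)) holomorphic_on UNIV"
    by (rule holomorphic_on_compose_gen[OF _ q_exp_holomorphic[OF q, of UNIV], unfolded o_def])
      (auto intro!: holomorphic_intros)
  have Jm: "J meromorphic_on UNIV"
    unfolding J by (intro meromorphic_on_mult meromorphic_on_const jackson_series_meromorphic[OF q v1])
  have Rm: "R meromorphic_on UNIV"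
    unfolding R[abs_def]
    by (intro meromorphic_on_mult meromorphic_on_const meromorphic_on_diff meromorphic_on_inverse L_log_meromorphic[OF q])
      (use qh in \<open>simp add: analytic_on_imp_meromorphic_on analytic_on_open\<close>)
  define f where "f = (\<lambda>s. J s + R s)"
  have fm: "f meromorphic_on UNIV" unfolding f_def by (intro meromorphic_on_add Jm Rm)
  have E: "E_cont q = remove_sings f"
  proof (rule E_cont_eqI[OF fm _ q])
    fix d s assume d: "\<bar>d\<bar> < pi" "\<bar>Im s - d\<bar> < pi"
    have "open ({s. Im s > d - pi} \<inter> {s. Im s < d + pi})"
      by (intro open_Int open_halfspace_Im_gt open_halfspace_Im_lt)
    then have "\<forall>\<^sub>F z in at s. z \<in> {s. Im s > d - pi} \<inter> {s. Im s < d + pi}"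
      by (rule eventually_at_in_open') (use d in auto)
    \<comment> \<open>Generic points: \<open>z - c\<close> off the lattice separates the two classes
      of poles, \<open>z - mu\<close> off the lattice keeps the spiral regular.\<close>
    then show "\<forall>\<^sub>F z in at s. f z = E_ray q d (exp z)"
      using eventually_not_log_lattice[OF q, where u = s and a = c] eventually_not_log_lattice[OF q, where u = s and a = mu]
    proof eventually_elim
      case (elim z)
      have e: "z - c - of_real pi * \<i> - v = z - mu" "- (of_real pi * \<i>) - v = c - mu"
        by (simp_all add: v_def)
      have im: "\<bar>Im z - d\<bar> < pi" using elim(1) by (auto simp: abs_less_iff)
      show ?case
        unfolding f_def J R
        using E_ray_eq_jackson_series[OF q d(1) im, of v, folded c_def, unfolded e] elim(2,3) cmu by simp
    qed
  qed
  have S: "open {s. s - mu \<notin> log_lattice q}"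
  proof -
    have "open ((\<lambda>s. s - mu) -` (- log_lattice q))"
      using log_lattice_closed[OF q] by (intro open_vimage) (auto intro!: continuous_intros)
    then show ?thesis by (simp add: vimage_def)
  qed
  have "J holomorphic_on {s. s - mu \<notin> log_lattice q}"
    unfolding J
  proof (intro holomorphic_on_mult holomorphic_on_const jackson_series_holomorphic[OF q S])
    fix s assume s: "s \<in> {s. s - mu \<notin> log_lattice q}"
    have e: "v - s + of_real (ln (1 - 1 / q)) + of_real pi * \<i> = mu - s" by (simp add: v_def c_def)
    show "jackson_regular q (exp v) (of_real q * exp (v - s))"
      unfolding jackson_regular_exp[OF q] e using v1 s log_lattice_minus_commute[of s mu] by simp
  qed (auto intro!: holomorphic_intros)
  then have Jan: "J analytic_on {t}" using S tmu by (meson analytic_at mem_Collect_eq)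
  have "L_log q holomorphic_on - log_lattice q" by (rule L_log_holomorphic[OF q]) auto
  then have "(\<lambda>s. L_log q (s - mu)) holomorphic_on {s. s - mu \<notin> log_lattice q}"
    by (rule holomorphic_on_compose_gen[rotated, unfolded o_def]) (auto intro!: holomorphic_intros)
  then have Lan: "(\<lambda>s. L_log q (s - mu)) analytic_on {t}" using S tmu by (meson analytic_at mem_Collect_eq)
  have ev: "\<forall>\<^sub>F s in at t. E_cont q s - J s = R s"
  proof -
    have "isolated_singularity_at f t"
      using fm by (meson UNIV_I empty_subsetI insert_subset meromorphic_at_iff meromorphic_on_subset)
    from eventually_remove_sings_eq_at[OF this] show ?thesis
      unfolding E by eventually_elim (simp add: f_def)
  qed
  \<comment> \<open>Where the denominator does not vanish, \<open>f\<close> is analytic at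
    \<open>t\<close>, and \<open>remove_sings\<close> leaves its value unchanged.\<close>
  have 1: "E_cont q t - J t = R t" if "q_exp q (- of_real q / exp t) \<noteq> 0"
  proof -
    have "(\<lambda>s. q_exp q (- of_real q / exp s)) analytic_on {t}"
      using qh by (meson UNIV_I analytic_at open_UNIV)
    then have "R analytic_on {t}"
      unfolding R[abs_def] using that Lan by (intro analytic_intros) auto
    then have "f analytic_on {t}" unfolding f_def by (intro analytic_intros Jan)
    then show ?thesis unfolding E by (simp add: f_def)
  qed
  \<comment> \<open>Without a pole the continuation is continuous at \<open>t\<close>, also where
    \<open>R\<close> has a removable singularity.\<close>
  have 2: "(R \<longlongrightarrow> E_cont q t - J t) (at t)" if "\<not> is_pole (E_cont q) t"
  proof -
    have "E_cont q nicely_meromorphic_on UNIV" unfolding E by (rule remove_sings_nicely_meromorphic[OF fm])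
    from nicely_meromorphic_on_imp_analytic_at[OF this _ that] have "isCont (E_cont q) t"
      by (simp add: analytic_at_imp_isCont)
    then have "((\<lambda>s. E_cont q s - J s) \<longlongrightarrow> E_cont q t - J t) (at t)"
      using analytic_at_imp_isCont[OF Jan] by (intro tendsto_diff) (auto simp: isCont_def)
    then show ?thesis by (rule Lim_transform_eventually[OF _ ev])
  qed
  show ?thesis using 1 2 ev unfolding J_def by blast
qed

end
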